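(* Let $C\subseteq\{N,H,R,L,Fa,Fu\}$. For a distributive $\nabla$-algebra $\mathcal{A}$ let $\mathfrak{S}'(\mathcal{A})=(\mathcal{F}_p(\mathsf{A}),R)$. Here $\mathcal{F}_p(\mathsf{A})$ is the set of prime filters with the topology generated by the basis $\{P\mid a\in P\}$ ($a\in A$), and $(P,Q)\in R$ iff $\nabla[P]\subseteq Q$. For a $\nabla$-algebra morphism $f$ let $\mathfrak{S}'(f)=f^{-1}$. For a $\nabla$-spectral space $(X,R)$ let $\mathfrak{A}'(X,R)=(CO(X),\nabla_R,\to_R)$. Here $CO(X)$ is the lattice (under $\subseteq$) of compact open subsets, $\nabla_R(U)=\{x\mid\exists y\in U,\ (y,x)\in R\}$ and $U\to_RV=\{x\mid R[x]\cap U\subseteq V\}$. For a $\nabla$-spectral map $f$ let $\mathfrak{A}'(f)=f^{-1}$. Then $\mathfrak{S}'$ and $\mathfrak{A}'$ together with the natural isomorphisms $\alpha'(a)=\{P\in\mathcal{F}_p(\mathsf{A})\mid a\in P\}$ and $\beta'(x)=\{U\in CO(X)\mid x\in U\}$ establish an equivalence between $\mathbf{Alg}_\nabla(D,C)$ and $[\mathbf{Spec}_\nabla(C)]^{op}$. The same holds for $\mathbf{Alg}^H_\nabla(D,C)$ and $[\mathbf{Spec}^H_\nabla(C)]^{op}$.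
   Context: \textbf{$\nabla$-algebras.} A $\nabla$-algebra is $(\mathsf{A},\nabla,\to)$ with $\mathsf{A}$ a bounded lattice and $\nabla c\wedge a\le b$ iff $c\le a\to b$. Write $\Box a=1\to a$. Properties: - (D): $\mathsf{A}$ distributive. - (H): $\mathsf{A}$ a Heyting algebra. - (N): $\nabla1=1$, $\nabla(a\wedge b)=\nabla a\wedge\nabla b$. - (R): $a\le\nabla a$. - (L): $\nabla a\le a$. - (Fa): $\nabla$ surjective. - (Fu): $\Box$ surjective (equivalently $\nabla$ injective). Morphisms are bounded lattice homomorphisms preserving $\nabla,\to$. $\mathbf{Alg}_\nabla(D,C)$ is the category of distributive $\nabla$-algebras satisfying $C$. $\mathbf{Alg}^H_\nabla(D,C)$ is the category of explicitly Heyting $\nabla$-algebras $(\mathsf{A},\nabla,\to,\supset)$ ($\supset$ the Heyting implication, in the signature) satisfying $C$, with morphisms also preserving $\supset$. \textbf{Spectral spaces.} A space is spectral if it is sober (every irreducible closed set is the closure of a unique point), compact, and its compact opens form a basis. A spectral map is a continuous map between spectral spaces pulling compact opens back to compact opens. A subset $Y\subseteq X$ is: - spectral if it is a spectral space in the subspace topology and the inclusion is a spectral map; - doubly spectral if $Y$ and $X\setminus Y$ are spectral; - saturated if it is an intersection of opens; - co-saturated if it is a union of closed sets. $Cl$ denotes closure and $Sat_X(x)$ is the intersection of all opens containing $x$. A spectral space is Heyting if $Cl(Y)$ is doubly spectral for every doubly spectral $Y$. A spectral map $f$ between Heyting spectral spaces is Heyting if $f[Sat_X(x)]=Sat_Y(f(x))$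 for all $x$. \textbf{$\nabla$-spectral spaces.} A $\nabla$-spectral space is $(X,R)$ with $X$ spectral and $R\subseteq X^2$ such that: - $R[x]=\{y\mid(x,y)\in R\}$ is compact and saturated; - $R^{-1}[y]=\{x\mid(x,y)\in R\}$ is co-saturated; - $\lozenge_R(Y)=\{x\mid\exists y\in Y,(x,y)\in R\}$ is doubly spectral for every doubly spectral $Y$; - $\nabla_R(V)$ is compact open for every compact open $V$. Conditions on a $\nabla$-spectral space: - (N): there is a continuous $\pi:X\to X$ with $(x,y)\in R$ iff $x\in Cl(\{\pi(y)\})$. - (H): $X$ is a Heyting spectral space. - (R): $R$ is reflexive. - (L): $(x,y)\in R$ implies $x\in Cl(\{y\})$. - (Fa): for all $x$ there is $y$ with $(y,x)\in R$ such that $(y,z)\in R$ implies $x\in Cl(\{z\})$. - (Fu): for all $x$ there is $y$ with $(x,y)\in R$ such that $(z,y)\in R$ implies $z\in Cl(\{x\})$. A $\nabla$-spectral map $f:(X,R_X)\to(Y,R_Y)$ is a spectral map such that: - $(x,z)\in R_X$ implies $(f(x),f(z))\in R_Y$; - if $(f(x),y)\in R_Y$ there is $z$ with $(x,z)\in R_X$ and $f(z)=y$; - if $(y,f(x))\in R_Y$ there is $z$ with $(z,x)\in R_X$ and $y\in Cl_Y(\{f(z)\})$. It is Heyting if it is a Heyting spectral map. $\mathbf{Spec}_\nabla(C)$ is the category of $\nabla$-spectral spaces satisfying $C$ with $\nabla$-spectral maps. $\mathbf{Spec}^H_\nabla(C)$ is the category of Heyting ones satisfying $C$ with Heyting $\nabla$-spectral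 maps.
   Formalization: Spectral spaces are additionally required to have compact opens closed under binary intersections (the standard definition); without this CO(X) need not be a lattice, e.g. ℕ discrete plus two points with least neighbourhoods ℕ∪{p} and ℕ∪{q}, with R empty. *)

theory Defs
  imports "HOL-Analysis.Analysis" "HOL-Algebra.Lattice"
begin

section \<open>Nabla-algebras\<close>

record 'a nabla_alg = "'a gorder" +
  nab :: "'a \<Rightarrow> 'a"
  arr :: "'a \<Rightarrow> 'a \<Rightarrow> 'a"

record 'a heyting_nabla_alg = "'a nabla_alg" +
  himp :: "'a \<Rightarrow> 'a \<Rightarrow> 'a"

datatype nabla_cond = CN | CH | CR | CL | CFa | CFu

definition nabla_algebra :: "('a, 'm) nabla_alg_scheme \<Rightarrow> bool" where
  "nabla_algebra A \<longleftrightarrow>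
     Lattice.bounded_lattice A \<and>
     (\<forall>a\<in>carrier A. nab A a \<in> carrier A) \<and>
     (\<forall>a\<in>carrier A. \<forall>b\<in>carrier A. arr A a b \<in> carrier A) \<and>
     (\<forall>a\<in>carrier A. \<forall>b\<in>carrier A. \<forall>c\<in>carrier A.
        nab A c \<sqinter>\<^bsub>A\<^esub> a \<sqsubseteq>\<^bsub>A\<^esub> b \<longleftrightarrow> c \<sqsubseteq>\<^bsub>A\<^esub> arr A a b)"

definition box :: "('a, 'm) nabla_alg_scheme \<Rightarrow> 'a \<Rightarrow> 'a" where
  "box A a = arr A \<top>\<^bsub>A\<^esub> a"

definition distributive :: "('a, 'm) gorder_scheme \<Rightarrow> bool" where
  "distributive L \<longleftrightarrow>
     (\<forall>a\<in>carrier L. \<forall>b\<in>carrier L. \<forall>c\<in>carrier L.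
        a \<sqinter>\<^bsub>L\<^esub> (b \<squnion>\<^bsub>L\<^esub> c) = (a \<sqinter>\<^bsub>L\<^esub> b) \<squnion>\<^bsub>L\<^esub> (a \<sqinter>\<^bsub>L\<^esub> c))"

definition is_heyting_imp :: "('a, 'm) gorder_scheme \<Rightarrow> 'a \<Rightarrow> 'a \<Rightarrow> 'a \<Rightarrow> bool" where
  "is_heyting_imp L a b c \<longleftrightarrow>
     c \<in> carrier L \<and> (\<forall>x\<in>carrier L. x \<sqinter>\<^bsub>L\<^esub> a \<sqsubseteq>\<^bsub>L\<^esub> b \<longleftrightarrow> x \<sqsubseteq>\<^bsub>L\<^esub> c)"

definition heyting_algebra :: "('a, 'm) gorder_scheme \<Rightarrow> bool" where
  "heyting_algebra L \<longleftrightarrow>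
     Lattice.bounded_lattice L \<and>
     (\<forall>a\<in>carrier L. \<forall>b\<in>carrier L. \<exists>c. is_heyting_imp L a b c)"

definition heyting_imp :: "('a, 'm) gorder_scheme \<Rightarrow> 'a \<Rightarrow> 'a \<Rightarrow> 'a" where
  "heyting_imp L a b = (THE c. is_heyting_imp L a b c)"

fun alg_satisfies :: "('a, 'm) nabla_alg_scheme \<Rightarrow> nabla_cond \<Rightarrow> bool" where
  "alg_satisfies A CN \<longleftrightarrow>
     nab A \<top>\<^bsub>A\<^esub> = \<top>\<^bsub>A\<^esub> \<and>
     (\<forall>a\<in>carrier A. \<forall>b\<in>carrier A. nab A (a \<sqinter>\<^bsub>A\<^esub> b) = nab A a \<sqinter>\<^bsub>A\<^esub> nab A b)"
| "alg_satisfies A CH \<longleftrightarrow> heyting_algebra A"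
| "alg_satisfies A CR \<longleftrightarrow> (\<forall>a\<in>carrier A. a \<sqsubseteq>\<^bsub>A\<^esub> nab A a)"
| "alg_satisfies A CL \<longleftrightarrow> (\<forall>a\<in>carrier A. nab A a \<sqsubseteq>\<^bsub>A\<^esub> a)"
| "alg_satisfies A CFa \<longleftrightarrow> nab A ` carrier A = carrier A"
| "alg_satisfies A CFu \<longleftrightarrow> box A ` carrier A = carrier A"

definition Alg :: "nabla_cond set \<Rightarrow> 'a nabla_alg set" where
  "Alg C = {A. nabla_algebra A \<and> distributive A \<and> (\<forall>c\<in>C. alg_satisfies A c)}"

definition AlgH :: "nabla_cond set \<Rightarrow> 'a heyting_nabla_alg set" where
  "AlgH C = {A. nabla_algebra A \<and> distributive A \<and> (\<forall>c\<in>C. alg_satisfies A c) \<and>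
     (\<forall>a\<in>carrier A. \<forall>b\<in>carrier A. is_heyting_imp A a b (himp A a b))}"

text \<open>Arrows are extensional functions (\<open>undefined\<close> off the domain), so that HOL equality
  of arrows is equality of maps. Source and target may live over different types.\<close>

definition alg_hom ::
  "('a, 'm) nabla_alg_scheme \<Rightarrow> ('b, 'n) nabla_alg_scheme \<Rightarrow> ('a \<Rightarrow> 'b) set" where
  "alg_hom A B = {f \<in> carrier A \<rightarrow>\<^sub>E carrier B.
     f \<top>\<^bsub>A\<^esub> = \<top>\<^bsub>B\<^esub> \<and> f \<bottom>\<^bsub>A\<^esub> = \<bottom>\<^bsub>B\<^esub> \<and>
     (\<forall>a\<in>carrier A. f (nab A a) = nab B (f a)) \<and>
     (\<forall>a\<in>carrier A. \<forall>b\<in>carrier A.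
        f (a \<sqinter>\<^bsub>A\<^esub> b) = f a \<sqinter>\<^bsub>B\<^esub> f b \<and>
        f (a \<squnion>\<^bsub>A\<^esub> b) = f a \<squnion>\<^bsub>B\<^esub> f b \<and>
        f (arr A a b) = arr B (f a) (f b))}"

definition algH_hom ::
  "'a heyting_nabla_alg \<Rightarrow> 'b heyting_nabla_alg \<Rightarrow> ('a \<Rightarrow> 'b) set" where
  "algH_hom A B = {f \<in> alg_hom A B.
     \<forall>a\<in>carrier A. \<forall>b\<in>carrier A. f (himp A a b) = himp B (f a) (f b)}"

section \<open>Spectral spaces\<close>

definition CO :: "'x topology \<Rightarrow> 'x set set" where
  "CO X = {U. openin X U \<and> compactin X U}"

definition irreducible_closedin :: "'x topology \<Rightarrow> 'x set \<Rightarrow> bool" where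
  "irreducible_closedin X F \<longleftrightarrow> closedin X F \<and> F \<noteq> {} \<and>
     (\<forall>G H. closedin X G \<and> closedin X H \<and> F = G \<union> H \<longrightarrow> F = G \<or> F = H)"

definition sober_space :: "'x topology \<Rightarrow> bool" where
  "sober_space X \<longleftrightarrow>
     (\<forall>F. irreducible_closedin X F \<longrightarrow> (\<exists>!x. x \<in> topspace X \<and> F = X closure_of {x}))"

text \<open>As usual for spectral spaces, the basis of compact opens is required to be closed under
  binary intersections (the empty intersection is covered by compactness). Without this,
  \<open>CO X\<close> need not be a lattice: take the discrete space \<open>\<nat>\<close> with two
  additional points \<open>p\<close>, \<open>q\<close> whose least neighbourhoods are
  \<open>\<nat> \<union> {p}\<close> and \<open>\<nat> \<union> {q}\<close>.\<close>

definition spectral_space :: "'x topology \<Rightarrow> bool" where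
  "spectral_space X \<longleftrightarrow> sober_space X \<and> compact_space X \<and>
     (\<forall>U. openin X U \<longrightarrow> (\<exists>\<V>. \<V> \<subseteq> CO X \<and> U = \<Union>\<V>)) \<and>
     (\<forall>U\<in>CO X. \<forall>V\<in>CO X. U \<inter> V \<in> CO X)"

definition spectral_map :: "'x topology \<Rightarrow> 'y topology \<Rightarrow> ('x \<Rightarrow> 'y) \<Rightarrow> bool" where
  "spectral_map X Y f \<longleftrightarrow> spectral_space X \<and> spectral_space Y \<and> continuous_map X Y f \<and>
     (\<forall>V\<in>CO Y. {x \<in> topspace X. f x \<in> V} \<in> CO X)"

definition spectral_subset :: "'x topology \<Rightarrow> 'x set \<Rightarrow> bool" where
  "spectral_subset X Y \<longleftrightarrow> Y \<subseteq> topspace X \<and> spectral_map (subtopology X Y) X id"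

definition doubly_spectral :: "'x topology \<Rightarrow> 'x set \<Rightarrow> bool" where
  "doubly_spectral X Y \<longleftrightarrow> spectral_subset X Y \<and> spectral_subset X (topspace X - Y)"

definition saturated_in :: "'x topology \<Rightarrow> 'x set \<Rightarrow> bool" where
  "saturated_in X S \<longleftrightarrow> (\<exists>\<U>. (\<forall>U\<in>\<U>. openin X U) \<and> S = topspace X \<inter> \<Inter>\<U>)"

definition co_saturated_in :: "'x topology \<Rightarrow> 'x set \<Rightarrow> bool" where
  "co_saturated_in X S \<longleftrightarrow> (\<exists>\<F>. (\<forall>F\<in>\<F>. closedin X F) \<and> S = \<Union>\<F>)"

definition Sat :: "'x topology \<Rightarrow> 'x \<Rightarrow> 'x set" where
  "Sat X x = \<Inter>{U. openin X U \<and> x \<in> U}"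

definition heyting_spectral_space :: "'x topology \<Rightarrow> bool" where
  "heyting_spectral_space X \<longleftrightarrow> spectral_space X \<and>
     (\<forall>Y. doubly_spectral X Y \<longrightarrow> doubly_spectral X (X closure_of Y))"

definition heyting_spectral_map :: "'x topology \<Rightarrow> 'y topology \<Rightarrow> ('x \<Rightarrow> 'y) \<Rightarrow> bool" where
  "heyting_spectral_map X Y f \<longleftrightarrow>
     heyting_spectral_space X \<and> heyting_spectral_space Y \<and> spectral_map X Y f \<and>
     (\<forall>x\<in>topspace X. f ` Sat X x = Sat Y (f x))"

section \<open>Nabla-spectral spaces\<close>

record 'x nabla_space =
  Top :: "'x topology"
  Rel :: "('x \<times> 'x) set"

abbreviation pts :: "'x nabla_space \<Rightarrow> 'x set" where
  "pts S \<equiv> topspace (Top S)"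

definition lozenge_rel :: "('x \<times> 'x) set \<Rightarrow> 'x set \<Rightarrow> 'x set" where
  "lozenge_rel R Y = {x. \<exists>y\<in>Y. (x, y) \<in> R}"

definition nabla_rel :: "('x \<times> 'x) set \<Rightarrow> 'x set \<Rightarrow> 'x set" where
  "nabla_rel R U = {x. \<exists>y\<in>U. (y, x) \<in> R}"

definition arrow_rel :: "'x nabla_space \<Rightarrow> 'x set \<Rightarrow> 'x set \<Rightarrow> 'x set" where
  "arrow_rel S U V = {x \<in> pts S. {y. (x, y) \<in> Rel S} \<inter> U \<subseteq> V}"

definition nabla_spectral_space :: "'x nabla_space \<Rightarrow> bool" where
  "nabla_spectral_space S \<longleftrightarrow>
     spectral_space (Top S) \<and>
     Rel S \<subseteq> pts S \<times> pts S \<and>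
     (\<forall>x\<in>pts S. compactin (Top S) {y. (x, y) \<in> Rel S} \<and>
                 saturated_in (Top S) {y. (x, y) \<in> Rel S}) \<and>
     (\<forall>y\<in>pts S. co_saturated_in (Top S) {x. (x, y) \<in> Rel S}) \<and>
     (\<forall>Y. doubly_spectral (Top S) Y \<longrightarrow> doubly_spectral (Top S) (lozenge_rel (Rel S) Y)) \<and>
     (\<forall>V\<in>CO (Top S). nabla_rel (Rel S) V \<in> CO (Top S))"

fun space_satisfies :: "'x nabla_space \<Rightarrow> nabla_cond \<Rightarrow> bool" where
  "space_satisfies S CN \<longleftrightarrow>
     (\<exists>\<pi>. continuous_map (Top S) (Top S) \<pi> \<and>
        (\<forall>x\<in>pts S. \<forall>y\<in>pts S. (x, y) \<in> Rel S \<longleftrightarrow> x \<in> Top S closure_of {\<pi> y}))"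
| "space_satisfies S CH \<longleftrightarrow> heyting_spectral_space (Top S)"
| "space_satisfies S CR \<longleftrightarrow> (\<forall>x\<in>pts S. (x, x) \<in> Rel S)"
| "space_satisfies S CL \<longleftrightarrow> (\<forall>(x, y)\<in>Rel S. x \<in> Top S closure_of {y})"
| "space_satisfies S CFa \<longleftrightarrow>
     (\<forall>x\<in>pts S. \<exists>y. (y, x) \<in> Rel S \<and>
        (\<forall>z. (y, z) \<in> Rel S \<longrightarrow> x \<in> Top S closure_of {z}))"
| "space_satisfies S CFu \<longleftrightarrow>
     (\<forall>x\<in>pts S. \<exists>y. (x, y) \<in> Rel S \<and>
        (\<forall>z. (z, y) \<in> Rel S \<longrightarrow> z \<in> Top S closure_of {x}))"

definition Spec :: "nabla_cond set \<Rightarrow> 'x nabla_space set" where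
  "Spec C = {S. nabla_spectral_space S \<and> (\<forall>c\<in>C. space_satisfies S c)}"

definition SpecH :: "nabla_cond set \<Rightarrow> 'x nabla_space set" where
  "SpecH C = {S \<in> Spec C. heyting_spectral_space (Top S)}"

definition spec_hom :: "'x nabla_space \<Rightarrow> 'y nabla_space \<Rightarrow> ('x \<Rightarrow> 'y) set" where
  "spec_hom S T = {f \<in> pts S \<rightarrow>\<^sub>E pts T.
     spectral_map (Top S) (Top T) f \<and>
     (\<forall>x z. (x, z) \<in> Rel S \<longrightarrow> (f x, f z) \<in> Rel T) \<and>
     (\<forall>x\<in>pts S. \<forall>y. (f x, y) \<in> Rel T \<longrightarrow> (\<exists>z. (x, z) \<in> Rel S \<and> f z = y)) \<and>
     (\<forall>x\<in>pts S. \<forall>y. (y, f x) \<in> Rel T \<longrightarrow>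
        (\<exists>z. (z, x) \<in> Rel S \<and> y \<in> Top T closure_of {f z}))}"

definition specH_hom :: "'x nabla_space \<Rightarrow> 'y nabla_space \<Rightarrow> ('x \<Rightarrow> 'y) set" where
  "specH_hom S T = {f \<in> spec_hom S T. heyting_spectral_map (Top S) (Top T) f}"

section \<open>The functors and the natural isomorphisms\<close>

definition prime_filters :: "('a, 'm) gorder_scheme \<Rightarrow> 'a set set" where
  "prime_filters L = {P. P \<subseteq> carrier L \<and> \<top>\<^bsub>L\<^esub> \<in> P \<and> \<bottom>\<^bsub>L\<^esub> \<notin> P \<and>
     (\<forall>a\<in>P. \<forall>b\<in>carrier L. a \<sqsubseteq>\<^bsub>L\<^esub> b \<longrightarrow> b \<in> P) \<and>
     (\<forall>a\<in>P. \<forall>b\<in>P. a \<sqinter>\<^bsub>L\<^esub> b \<in> P) \<and>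
     (\<forall>a\<in>carrier L. \<forall>b\<in>carrier L. a \<squnion>\<^bsub>L\<^esub> b \<in> P \<longrightarrow> a \<in> P \<or> b \<in> P)}"

definition spec_obj :: "('a, 'm) nabla_alg_scheme \<Rightarrow> 'a set nabla_space" where
  "spec_obj A =
     \<lparr> Top = topology_generated_by {{P \<in> prime_filters A. a \<in> P} | a. a \<in> carrier A},
       Rel = {(P, Q). P \<in> prime_filters A \<and> Q \<in> prime_filters A \<and> nab A ` P \<subseteq> Q} \<rparr>"

text \<open>For \<open>f : A \<rightarrow> B\<close>, \<open>spec_mor A B f\<close> goes from
  \<open>spec_obj B\<close> to \<open>spec_obj A\<close>; likewise for \<open>alg_mor\<close> below.\<close>

definition spec_mor ::
  "('a, 'm) nabla_alg_scheme \<Rightarrow> ('b, 'n) nabla_alg_scheme \<Rightarrow> ('a \<Rightarrow> 'b) \<Rightarrow> 'b set \<Rightarrow> 'a set" where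
  "spec_mor A B f = (\<lambda>Q\<in>prime_filters B. {a \<in> carrier A. f a \<in> Q})"

definition alg_obj :: "'x nabla_space \<Rightarrow> 'x set nabla_alg" where
  "alg_obj S = \<lparr> carrier = CO (Top S), eq = (=), le = (\<subseteq>),
     nab = nabla_rel (Rel S), arr = arrow_rel S \<rparr>"

definition algH_obj :: "'x nabla_space \<Rightarrow> 'x set heyting_nabla_alg" where
  "algH_obj S = \<lparr> carrier = CO (Top S), eq = (=), le = (\<subseteq>),
     nab = nabla_rel (Rel S), arr = arrow_rel S, himp = heyting_imp (alg_obj S) \<rparr>"

definition alg_mor ::
  "'x nabla_space \<Rightarrow> 'y nabla_space \<Rightarrow> ('x \<Rightarrow> 'y) \<Rightarrow> 'y set \<Rightarrow> 'x set" where
  "alg_mor S T f = (\<lambda>V\<in>CO (Top T). {x \<in> pts S. f x \<in> V})"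

definition alpha :: "('a, 'm) nabla_alg_scheme \<Rightarrow> 'a \<Rightarrow> 'a set set" where
  "alpha A = (\<lambda>a\<in>carrier A. {P \<in> prime_filters A. a \<in> P})"

definition beta :: "'x nabla_space \<Rightarrow> 'x \<Rightarrow> 'x set set" where
  "beta S = (\<lambda>x\<in>pts S. {U \<in> CO (Top S). x \<in> U})"

text \<open>\<open>f\<close> has a two-sided inverse, where \<open>F\<close> is the hom-set from an object with
  underlying set \<open>A\<close> to one with underlying set \<open>B\<close>, and \<open>G\<close> the hom-set
  in the opposite direction.\<close>

definition iso_arrow ::
  "('a \<Rightarrow> 'b) set \<Rightarrow> ('b \<Rightarrow> 'a) set \<Rightarrow> 'a set \<Rightarrow> 'b set \<Rightarrow> ('a \<Rightarrow> 'b) \<Rightarrow> bool" where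
  "iso_arrow F G A B f \<longleftrightarrow> f \<in> F \<and>
     (\<exists>g\<in>G. compose A g f = (\<lambda>x\<in>A. x) \<and> compose B f g = (\<lambda>y\<in>B. y))"

end

theory Submission
  imports Defs
begin

text \<open>Everything rests on two instances of the prime filter theorem. First, it makes the patch
  topology (generated by the compact opens and their complements) of a spectral space compact
  Hausdorff; hence the spectral subsets are the patch-closed ones, the doubly spectral subsets are the
  finite unions of differences of compact opens, and a doubly spectral set that is closed under
  generalization is compact open. Since \<open>U \<rightarrow> V\<close> is the complement of
  \<open>\<lozenge>(U - V)\<close> and the Heyting implication is the complement of the closure of
  \<open>U - V\<close>, the conditions on doubly spectral sets say exactly that these operations preserve
  compact opens. Second, it produces the prime filters that the relational conditions ask for: the
  filter is generated by what the new prime filter has to contain, the ideal consists of what it has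
  to avoid, and the adjunction between \<open>\<nabla>\<close> and \<open>\<rightarrow>\<close> shows that
  they are disjoint. The relation of a nabla-spectral space is recovered from its compact opens
  because \<open>R[x]\<close> is compact saturated: if \<open>y\<close> is not in \<open>R[x]\<close>, some
  compact open \<open>W\<close> contains \<open>R[x]\<close> but not \<open>y\<close>, and then
  \<open>x \<in> \<box>W\<close> while \<open>y \<notin> \<nabla>\<box>W\<close>.\<close>

section \<open>Prime filters of distributive lattices\<close>

text \<open>The Heyting half is no second duality proof. \<open>CO_lattice\<close>,
  \<open>CO_nabla\<close> and \<open>alg_morphism\<close> accept every extension of the algebra
  record, so \<open>alg_obj\<close> and \<open>algH_obj\<close> share their arguments and only the
  implication is left over. It is determined by the order, hence preserved by bijective
  homomorphisms; for other maps its preservation amounts to lifting generalizations along the map,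
  which is what the condition on \<open>Sat\<close> expresses. The two lifting clauses for
  nabla-spectral maps differ for a reason. A prime filter above \<nabla>[P] can be made to contain
  some elements and to avoid others, because \<rightarrow> turns the required disjointness into
  membership in P. A prime filter P with \<nabla>[P] inside Q can be made to contain given elements,
  but avoiding some j means excluding k \<le> i \<squnion> j with \<nabla>i outside Q, and the
  adjunction gives no hold on that. So one clause yields an equality of points and the other only a
  point of a closure.\<close>

locale dist_lattice = Lattice.bounded_lattice L for L (structure) +
  assumes distrib: "distributive L"
begin

declare le_antisym [rule del] weak_refl [rule del] le_cong_l [rule del] le_cong_r [rule del] weak_le_antisym [rule del]



lemma meet_distrib:
  assumes "a \<in> carrier L" "b \<in> carrier L" "c \<in> carrier L"
  shows "a \<sqinter> (b \<squnion> c) = (a \<sqinter> b) \<squnion> (a \<sqinter> c)"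
  using distrib assms unfolding distributive_def by blast

lemma meet_mono:
  assumes "a \<sqsubseteq> a'" "b \<sqsubseteq> b'"
    and "a \<in> carrier L" "a' \<in> carrier L" "b \<in> carrier L" "b' \<in> carrier L"
  shows "a \<sqinter> b \<sqsubseteq> a' \<sqinter> b'"
proof (rule meet_le)
  show "a \<sqinter> b \<sqsubseteq> a'"
    by (rule le_trans[OF meet_left]) (use assms in auto)
  show "a \<sqinter> b \<sqsubseteq> b'"
    by (rule le_trans[OF meet_right]) (use assms in auto)
qed (use assms in auto)

lemma top_meet_eq: "a \<in> carrier L \<Longrightarrow> \<top> \<sqinter> a = a"
  using top_meet eq_is_equal by simp

lemma meet_top_eq: "a \<in> carrier L \<Longrightarrow> a \<sqinter> \<top> = a"
  by (metis top_meet_eq meet_comm)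

lemma prime_filterI:
  assumes "P \<subseteq> carrier L" "\<top> \<in> P" "\<bottom> \<notin> P"
    and "\<And>a b. a \<in> P \<Longrightarrow> b \<in> carrier L \<Longrightarrow> a \<sqsubseteq> b \<Longrightarrow> b \<in> P"
    and "\<And>a b. a \<in> P \<Longrightarrow> b \<in> P \<Longrightarrow> a \<sqinter> b \<in> P"
    and "\<And>a b. a \<in> carrier L \<Longrightarrow> b \<in> carrier L \<Longrightarrow> a \<squnion> b \<in> P \<Longrightarrow> a \<in> P \<or> b \<in> P"
  shows "P \<in> prime_filters L"
  using assms unfolding prime_filters_def by auto

context
  fixes P assumes P: "P \<in> prime_filters L"
begin

lemma pf_carrier: "a \<in> P \<Longrightarrow> a \<in> carrier L"
  using P unfolding prime_filters_def by blast

lemma pf_top: "\<top> \<in> P" and pf_bot: "\<bottom> \<notin> P"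
  using P unfolding prime_filters_def by auto

lemma pf_up: "a \<in> P \<Longrightarrow> b \<in> carrier L \<Longrightarrow> a \<sqsubseteq> b \<Longrightarrow> b \<in> P"
  using P unfolding prime_filters_def by blast

lemma pf_meet:
  assumes "a \<in> carrier L" "b \<in> carrier L"
  shows "a \<sqinter> b \<in> P \<longleftrightarrow> a \<in> P \<and> b \<in> P"
proof
  assume "a \<sqinter> b \<in> P"
  then show "a \<in> P \<and> b \<in> P"
    using pf_up[OF _ assms(1) meet_left[OF assms]] pf_up[OF _ assms(2) meet_right[OF assms]] by simp
next
  assume "a \<in> P \<and> b \<in> P"
  then show "a \<sqinter> b \<in> P"
    using P unfolding prime_filters_def by simp
qed

lemma pf_join:
  assumes "a \<in> carrier L" "b \<in> carrier L"
  shows "a \<squnion> b \<in> P \<longleftrightarrow> a \<in> P \<or> b \<in> P"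
proof
  assume "a \<squnion> b \<in> P"
  then show "a \<in> P \<or> b \<in> P"
    using P assms unfolding prime_filters_def by simp
next
  assume "a \<in> P \<or> b \<in> P"
  then show "a \<squnion> b \<in> P"
    using pf_up[OF _ join_closed[OF assms] join_left[OF assms]]
      pf_up[OF _ join_closed[OF assms] join_right[OF assms]] by blast
qed

end

text \<open>A filter that contains K and is maximal among those disjoint from I is prime: adjoining
  an outside element produces a filter meeting I, and distributivity combines two such failures into
  one. K and I are only directed, since they will be images such as \<nabla>[P], which need not be
  upward or downward closed.\<close>

theorem prime_filter_separation:
  assumes K: "K \<subseteq> carrier L" "K \<noteq> {}"
    and Kdir: "\<And>k k'. k \<in> K \<Longrightarrow> k' \<in> K \<Longrightarrow> \<exists>k''\<in>K. k'' \<sqsubseteq> k \<and> k'' \<sqsubseteq> k'"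
    and I: "I \<subseteq> carrier L" "I \<noteq> {}"
    and Idir: "\<And>i i'. i \<in> I \<Longrightarrow> i' \<in> I \<Longrightarrow> \<exists>i''\<in>I. i \<sqsubseteq> i'' \<and> i' \<sqsubseteq> i''"
    and sep: "\<And>k i. k \<in> K \<Longrightarrow> i \<in> I \<Longrightarrow> \<not> k \<sqsubseteq> i"
  obtains P where "P \<in> prime_filters L" "K \<subseteq> P" "P \<inter> I = {}"
proof -
  define filt where "filt F \<longleftrightarrow> F \<subseteq> carrier L \<and> F \<noteq> {} \<and>
     (\<forall>a\<in>F. \<forall>b\<in>carrier L. a \<sqsubseteq> b \<longrightarrow> b \<in> F) \<and> (\<forall>a\<in>F. \<forall>b\<in>F. a \<sqinter> b \<in> F)" for F
  define \<F> where "\<F> = {F. filt F \<and> K \<subseteq> F \<and> F \<inter> I = {}}"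
  define F0 where "F0 = {x \<in> carrier L. \<exists>k\<in>K. k \<sqsubseteq> x}"
  have F0: "F0 \<in> \<F>"
  proof -
    have F0c: "F0 \<subseteq> carrier L" by (auto simp: F0_def)
    have KF: "K \<subseteq> F0" using K le_refl unfolding F0_def by blast
    have "a \<sqinter> b \<in> F0" if ab: "a \<in> F0" "b \<in> F0" for a b
    proof -
      obtain k k' where k: "k \<in> K" "k' \<in> K" "k \<sqsubseteq> a" "k' \<sqsubseteq> b" "a \<in> carrier L" "b \<in> carrier L"
        using ab by (auto simp: F0_def)
      obtain k'' where "k'' \<in> K" "k'' \<sqsubseteq> k" "k'' \<sqsubseteq> k'" using Kdir k by blast
      then have "k'' \<sqsubseteq> a \<sqinter> b" using k K
        by (meson meet_le le_trans subsetD)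
      then show ?thesis using \<open>k'' \<in> K\<close> k by (auto simp: F0_def)
    qed
    moreover have "b \<in> F0" if "a \<in> F0" "b \<in> carrier L" "a \<sqsubseteq> b" for a b
      using that K le_trans unfolding F0_def by blast
    moreover have "F0 \<inter> I = {}" using sep by (auto simp: F0_def)
    ultimately show ?thesis using KF K F0c unfolding \<F>_def filt_def by blast
  qed
  have "\<exists>M\<in>\<F>. \<forall>X\<in>\<F>. M \<subseteq> X \<longrightarrow> X = M"
  proof (rule subset_Zorn_nonempty)
    show "\<F> \<noteq> {}" using F0 by blast
    fix \<C> assume ne: "\<C> \<noteq> {}" and ch: "subset.chain \<F> \<C>"
    have mem: "C \<in> \<F>" if "C \<in> \<C>" for C using ch that by (auto simp: subset_chain_def)
    have meet: "a \<sqinter> b \<in> \<Union>\<C>" if ab: "a \<in> \<Union>\<C>" "b \<in> \<Union>\<C>" for a b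
    proof -
      obtain C D where CD: "C \<in> \<C>" "a \<in> C" "D \<in> \<C>" "b \<in> D" using ab by auto
      then have "C \<subseteq> D \<or> D \<subseteq> C" using ch by (auto simp: subset_chain_def)
      then obtain E where "E \<in> \<C>" "a \<in> E" "b \<in> E" using CD by blast
      then have "a \<sqinter> b \<in> E" using mem[of E] by (simp add: \<F>_def filt_def)
      then show ?thesis using \<open>E \<in> \<C>\<close> by blast
    qed
    have "\<Union>\<C> \<subseteq> carrier L" using mem unfolding \<F>_def filt_def by blast
    moreover have "K \<subseteq> \<Union>\<C>" using mem ne unfolding \<F>_def by blast
    moreover have "\<Union>\<C> \<inter> I = {}" using mem unfolding \<F>_def by blast
    moreover have "b \<in> \<Union>\<C>" if "a \<in> \<Union>\<C>" "b \<in> carrier L" "a \<sqsubseteq> b" for a b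
      using that mem unfolding \<F>_def filt_def by blast
    ultimately show "\<Union>\<C> \<in> \<F>" using meet K unfolding \<F>_def filt_def by blast
  qed
  then obtain P where PF: "P \<in> \<F>" and Pmax: "\<And>X. X \<in> \<F> \<Longrightarrow> P \<subseteq> X \<Longrightarrow> X = P" by blast
  have Pc: "P \<subseteq> carrier L" and Pne: "P \<noteq> {}" and KP: "K \<subseteq> P" and PI: "P \<inter> I = {}"
    and Pup: "\<And>a b. a \<in> P \<Longrightarrow> b \<in> carrier L \<Longrightarrow> a \<sqsubseteq> b \<Longrightarrow> b \<in> P"
    and Pmeet: "\<And>a b. a \<in> P \<Longrightarrow> b \<in> P \<Longrightarrow> a \<sqinter> b \<in> P"
    using PF unfolding \<F>_def filt_def by blast+
  \<comment> \<open>Maximality in usable form: the filter generated by P and \<open>a\<close> is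
    strictly larger than P, so it must meet I.\<close>
  have ext: "\<exists>p\<in>P. \<exists>i\<in>I. p \<sqinter> a \<sqsubseteq> i" if a: "a \<in> carrier L" "a \<notin> P" for a
  proof (rule ccontr)
    assume no: "\<not> ?thesis"
    define G where "G = {x \<in> carrier L. \<exists>p\<in>P. p \<sqinter> a \<sqsubseteq> x}"
    have Gc: "G \<subseteq> carrier L" by (auto simp: G_def)
    have PG: "P \<subseteq> G" using Pc a meet_left unfolding G_def by blast
    have aG: "a \<in> G" using Pc Pne a meet_right unfolding G_def by blast
    have "x \<sqinter> y \<in> G" if xy: "x \<in> G" "y \<in> G" for x y
    proof -
      obtain p q where pq: "p \<in> P" "q \<in> P" "p \<sqinter> a \<sqsubseteq> x" "q \<sqinter> a \<sqsubseteq> y" "x \<in> carrier L" "y \<in> carrier L"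
        using xy by (auto simp: G_def)
      have pc: "p \<in> carrier L" "q \<in> carrier L" using pq Pc by auto
      have "(p \<sqinter> q) \<sqinter> a \<sqsubseteq> p \<sqinter> a" "(p \<sqinter> q) \<sqinter> a \<sqsubseteq> q \<sqinter> a"
        using pc a by (auto intro!: meet_mono meet_left meet_right)
      then have "(p \<sqinter> q) \<sqinter> a \<sqsubseteq> x" "(p \<sqinter> q) \<sqinter> a \<sqsubseteq> y"
        using pq pc a by (meson le_trans meet_closed)+
      then have "(p \<sqinter> q) \<sqinter> a \<sqsubseteq> x \<sqinter> y"
        using pq pc a by (simp add: meet_le)
      then show ?thesis using pq Pmeet by (auto simp: G_def)
    qed
    moreover have "y \<in> G" if "x \<in> G" "y \<in> carrier L" "x \<sqsubseteq> y" for x y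
      using that Pc a le_trans meet_closed unfolding G_def by blast
    moreover have "G \<inter> I = {}" using no by (auto simp: G_def)
    ultimately have "G \<in> \<F>" using PG KP aG Gc unfolding \<F>_def filt_def by blast
    then have "G = P" using Pmax PG by blast
    then show False using aG a by simp
  qed
  have "P \<in> prime_filters L"
  proof (rule prime_filterI)
    obtain p where "p \<in> P" using Pne by blast
    then show "\<top> \<in> P" using Pup Pc by blast
    obtain i where "i \<in> I" using I by blast
    then show "\<bottom> \<notin> P" using Pup[of \<bottom> i] I PI by blast
    fix a b assume ab: "a \<in> carrier L" "b \<in> carrier L" "a \<squnion> b \<in> P"
    show "a \<in> P \<or> b \<in> P"
    proof (rule ccontr)
      assume "\<not> ?thesis"
      then obtain p i q j where pq: "p \<in> P" "i \<in> I" "p \<sqinter> a \<sqsubseteq> i" "q \<in> P" "j \<in> I" "q \<sqinter> b \<sqsubseteq> j"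
        using ext ab by meson
      obtain l where l: "l \<in> I" "i \<sqsubseteq> l" "j \<sqsubseteq> l" using Idir pq by blast
      have c: "p \<in> carrier L" "q \<in> carrier L" "i \<in> carrier L" "j \<in> carrier L" "l \<in> carrier L"
        using pq l Pc I by auto
      let ?r = "p \<sqinter> q"
      have "?r \<sqinter> a \<sqsubseteq> p \<sqinter> a" "?r \<sqinter> b \<sqsubseteq> q \<sqinter> b"
        using c ab by (auto intro!: meet_mono meet_left meet_right)
      then have "?r \<sqinter> a \<sqsubseteq> l" "?r \<sqinter> b \<sqsubseteq> l"
        using c ab pq l by (meson le_trans meet_closed)+
      \<comment> \<open>Here distributivity enters: both joinands of the distributed meet lie below
        \<open>l\<close>, and the meet itself lies in P.\<close>
      then have "?r \<sqinter> (a \<squnion> b) \<sqsubseteq> l"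
        using c ab by (simp add: meet_distrib join_le)
      moreover have "?r \<sqinter> (a \<squnion> b) \<in> P" using Pmeet pq ab by blast
      ultimately have "l \<in> P" using Pup c by blast
      then show False using PI l by blast
    qed
  qed (use Pc Pup Pmeet in auto)
  then show thesis using that KP PI by blast
qed

lemma prime_filter_not_le:
  assumes "a \<in> carrier L" "b \<in> carrier L" "\<not> a \<sqsubseteq> b"
  obtains P where "P \<in> prime_filters L" "a \<in> P" "b \<notin> P"
  by (rule prime_filter_separation[of "{a}" "{b}"]) (use assms in auto)

end

section \<open>Spectral spaces and their lattices of compact opens\<close>

no_notation eq_closure_of ("closure'_of\<index>")

lemma CO_openin: "U \<in> CO X \<Longrightarrow> openin X U"
  and CO_compactin: "U \<in> CO X \<Longrightarrow> compactin X U"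
  and CO_subset: "U \<in> CO X \<Longrightarrow> U \<subseteq> topspace X"
  by (auto simp: CO_def dest: openin_subset)

lemma CO_empty: "{} \<in> CO X"
  by (simp add: CO_def)

lemma CO_Un: "U \<in> CO X \<Longrightarrow> V \<in> CO X \<Longrightarrow> U \<union> V \<in> CO X"
  by (simp add: CO_def compactin_Un openin_Un)

lemma CO_Union: "finite \<F> \<Longrightarrow> \<F> \<subseteq> CO X \<Longrightarrow> \<Union>\<F> \<in> CO X"
  by (induction rule: finite_induct) (auto simp: CO_empty CO_Un)

text \<open>Taken with K = U, this writes a compact open set as a finite union of basic sets. It is
  used in this way for the patch topology and for the spectrum.\<close>

lemma compactin_base_cover:
  assumes "compactin X K" "K \<subseteq> U" "openin X U"
    and base: "\<And>x. x \<in> U \<Longrightarrow> \<exists>V\<in>\<B>. x \<in> V \<and> V \<subseteq> U" and op: "\<And>V. V \<in> \<B> \<Longrightarrow> openin X V"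
  obtains \<F> where "finite \<F>" "\<F> \<subseteq> \<B>" "K \<subseteq> \<Union>\<F>" "\<Union>\<F> \<subseteq> U"
proof -
  define \<U> where "\<U> = {V \<in> \<B>. V \<subseteq> U}"
  have "K \<subseteq> \<Union>\<U>" using assms(2) base by (auto simp: \<U>_def) blast
  moreover have "\<forall>V\<in>\<U>. openin X V" using op by (auto simp: \<U>_def)
  ultimately obtain \<F> where "finite \<F>" "\<F> \<subseteq> \<U>" "K \<subseteq> \<Union>\<F>"
    using assms(1) unfolding compactin_def by meson
  then show thesis using that[of \<F>] by (auto simp: \<U>_def)
qed

text \<open>Otherwise F would be the union of the proper closed subsets F - U and F - V.\<close>

lemma irreducible_closedin_meets:
  assumes F: "irreducible_closedin X F" and "openin X U" "openin X V" "U \<inter> F \<noteq> {}" "V \<inter> F \<noteq> {}"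
  shows "U \<inter> V \<inter> F \<noteq> {}"
proof
  assume "U \<inter> V \<inter> F = {}"
  then have "F = (F - U) \<union> (F - V)" by blast
  moreover have "closedin X (F - U)" "closedin X (F - V)"
    using assms by (auto simp: irreducible_closedin_def intro: closedin_diff)
  ultimately have "F = F - U \<or> F = F - V"
    using F unfolding irreducible_closedin_def by blast
  then show False using assms(4,5) by blast
qed

lemma irreducible_closedinI:
  assumes "closedin X F" "F \<noteq> {}"
    and meets: "\<And>U V. openin X U \<Longrightarrow> openin X V \<Longrightarrow> U \<inter> F \<noteq> {} \<Longrightarrow> V \<inter> F \<noteq> {} \<Longrightarrow> U \<inter> V \<inter> F \<noteq> {}"
  shows "irreducible_closedin X F"
  unfolding irreducible_closedin_def
proof (intro conjI allI impI)
  fix G H assume GH: "closedin X G \<and> closedin X H \<and> F = G \<union> H"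
  show "F = G \<or> F = H"
  proof (rule ccontr)
    assume "\<not> ?thesis"
    then have "(topspace X - G) \<inter> F \<noteq> {}" "(topspace X - H) \<inter> F \<noteq> {}"
      using GH closedin_subset[OF assms(1)] by blast+
    then have "(topspace X - G) \<inter> (topspace X - H) \<inter> F \<noteq> {}"
      using GH by (intro meets) auto
    then show False using GH by blast
  qed
qed (use assms in auto)

text \<open>Sobriety splits into uniqueness, which is the T0 axiom, and existence of a generic
  point. A point of F is generic as soon as it lies in every open set that meets F, and this is the
  form in which compactness arguments deliver it.\<close>

lemma sober_spaceI:
  assumes T0: "\<And>x y. x \<in> topspace X \<Longrightarrow> y \<in> topspace X \<Longrightarrow>
      (\<And>U. openin X U \<Longrightarrow> x \<in> U \<longleftrightarrow> y \<in> U) \<Longrightarrow> x = y"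
    and gen: "\<And>F. irreducible_closedin X F \<Longrightarrow>
      \<exists>x\<in>F. \<forall>U. openin X U \<longrightarrow> U \<inter> F \<noteq> {} \<longrightarrow> x \<in> U"
  shows "sober_space X"
  unfolding sober_space_def
proof (intro allI impI)
  fix F assume F: "irreducible_closedin X F"
  have cl: "closedin X F" using F by (simp add: irreducible_closedin_def)
  obtain x where x: "x \<in> F" "\<And>U. openin X U \<Longrightarrow> U \<inter> F \<noteq> {} \<Longrightarrow> x \<in> U"
    using gen[OF F] by blast
  have xX: "x \<in> topspace X" using x cl closedin_subset by blast
  have "F = X closure_of {x}"
  proof
    show "F \<subseteq> X closure_of {x}"
    proof
      fix y assume y: "y \<in> F"
      then have "x \<in> T" if "y \<in> T" "openin X T" for T using that x(2)[of T] by blast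
      then show "y \<in> X closure_of {x}" using y closedin_subset[OF cl] by (simp add: in_closure_of subset_iff)
    qed
    show "X closure_of {x} \<subseteq> F" using x cl by (simp add: closure_of_minimal)
  qed
  moreover have "y = x" if y: "y \<in> topspace X" "F = X closure_of {y}" for y
  proof (rule T0)
    fix U assume U: "openin X U"
    have "y \<in> F" using y by (simp add: in_closure_of)
    moreover have "x \<in> X closure_of {y}" using x y by simp
    ultimately show "y \<in> U \<longleftrightarrow> x \<in> U" using x(2)[OF U] U by (auto simp: in_closure_of)
  qed (use y xX in auto)
  ultimately show "\<exists>!x. x \<in> topspace X \<and> F = X closure_of {x}" using xX by blast
qed

lemma closure_of_point_open:
  "y \<in> X closure_of {x} \<Longrightarrow> openin X U \<Longrightarrow> y \<in> U \<Longrightarrow> x \<in> U"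
  unfolding in_closure_of by blast

lemma point_in_closure_of: "x \<in> topspace X \<Longrightarrow> x \<in> X closure_of {x}"
  by (simp add: in_closure_of)

locale spectral =
  fixes X :: "'x topology"
  assumes spectral: "spectral_space X"
begin

lemma CO_Int: "U \<in> CO X \<Longrightarrow> V \<in> CO X \<Longrightarrow> U \<inter> V \<in> CO X"
  using spectral by (simp add: spectral_space_def)

lemma CO_topspace: "topspace X \<in> CO X"
  using spectral by (simp add: spectral_space_def CO_def compact_space_def)

lemma CO_base:
  assumes "openin X U" "x \<in> U"
  shows "\<exists>V\<in>CO X. x \<in> V \<and> V \<subseteq> U"
proof -
  obtain \<V> where "\<V> \<subseteq> CO X" "U = \<Union>\<V>"
    using spectral assms(1) unfolding spectral_space_def by meson
  then show ?thesis using assms(2) by blast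
qed

lemma CO_cover:
  assumes "compactin X K" "K \<subseteq> U" "openin X U"
  obtains W where "W \<in> CO X" "K \<subseteq> W" "W \<subseteq> U"
proof -
  obtain \<F> where "finite \<F>" "\<F> \<subseteq> CO X" "K \<subseteq> \<Union>\<F>" "\<Union>\<F> \<subseteq> U"
    by (rule compactin_base_cover[OF assms CO_base[OF assms(3)] CO_openin])
  then show thesis using that[of "\<Union>\<F>"] CO_Union[of \<F> X] by blast
qed

lemma in_closure_of_point:
  "x \<in> X closure_of {y} \<longleftrightarrow> x \<in> topspace X \<and> (\<forall>U\<in>CO X. x \<in> U \<longrightarrow> y \<in> U)"
proof
  assume "x \<in> X closure_of {y}"
  then show "x \<in> topspace X \<and> (\<forall>U\<in>CO X. x \<in> U \<longrightarrow> y \<in> U)"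
    using CO_openin by (auto simp: in_closure_of)
next
  assume a: "x \<in> topspace X \<and> (\<forall>U\<in>CO X. x \<in> U \<longrightarrow> y \<in> U)"
  have "y \<in> T" if T: "x \<in> T" "openin X T" for T
  proof -
    obtain V where "V \<in> CO X" "x \<in> V" "V \<subseteq> T" using CO_base T by blast
    then show ?thesis using a by blast
  qed
  then show "x \<in> X closure_of {y}" using a by (auto simp: in_closure_of)
qed

text \<open>The closure of a point is irreducible, and two points with the same compact open
  neighbourhoods have the same closure; sobriety allows it only one generic point.\<close>

lemma T0:
  assumes "x \<in> topspace X" "y \<in> topspace X" "\<And>U. U \<in> CO X \<Longrightarrow> x \<in> U \<longleftrightarrow> y \<in> U"
  shows "x = y"
proof -
  have eq: "X closure_of {x} = X closure_of {y}"
    using assms by (auto simp: in_closure_of_point)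
  have "irreducible_closedin X (X closure_of {x})"
  proof (rule irreducible_closedinI)
    show "X closure_of {x} \<noteq> {}" using assms(1) by (simp add: closure_of_eq_empty)
    fix U V assume UV: "openin X U" "openin X V" "U \<inter> X closure_of {x} \<noteq> {}" "V \<inter> X closure_of {x} \<noteq> {}"
    have "x \<in> U" using UV(1,3) by (auto dest: closure_of_point_open)
    moreover have "x \<in> V" using UV(2,4) by (auto dest: closure_of_point_open)
    moreover have "x \<in> X closure_of {x}" using assms(1) by (rule point_in_closure_of)
    ultimately show "U \<inter> V \<inter> X closure_of {x} \<noteq> {}" by blast
  qed simp
  then have "\<exists>!z. z \<in> topspace X \<and> X closure_of {x} = X closure_of {z}"
    using spectral unfolding spectral_space_def sober_space_def by simp
  then show ?thesis using assms(1,2) eq by metis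
qed

lemma irreducible_closedin_CO_I:
  assumes "closedin X F" "F \<noteq> {}"
    and meets: "\<And>U V. U \<in> CO X \<Longrightarrow> V \<in> CO X \<Longrightarrow> U \<inter> F \<noteq> {} \<Longrightarrow> V \<inter> F \<noteq> {} \<Longrightarrow> U \<inter> V \<inter> F \<noteq> {}"
  shows "irreducible_closedin X F"
proof (rule irreducible_closedinI)
  fix U V assume UV: "openin X U" "openin X V" "U \<inter> F \<noteq> {}" "V \<inter> F \<noteq> {}"
  then obtain x y where "x \<in> U" "x \<in> F" "y \<in> V" "y \<in> F" by blast
  moreover obtain U' where "U' \<in> CO X" "x \<in> U'" "U' \<subseteq> U" using CO_base UV(1) \<open>x \<in> U\<close> by blast
  moreover obtain V' where "V' \<in> CO X" "y \<in> V'" "V' \<subseteq> V" using CO_base UV(2) \<open>y \<in> V\<close> by blast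
  ultimately show "U \<inter> V \<inter> F \<noteq> {}" using meets[of U' V'] by blast
qed (use assms in auto)

end

section \<open>The lattice of compact opens and its prime filters\<close>

text \<open>\<open>L\<close> is any record whose carrier, equality and order are those of the
  compact opens. This covers the bare order built for patch compactness as well as both algebras
  attached to a nabla-spectral space.\<close>

locale CO_lattice = spectral X for X :: "'x topology" +
  fixes L :: "('x set, 'm) gorder_scheme"
  assumes carrier_L: "carrier L = CO X" and eq_L: "eq L = (=)" and le_L: "le L = (\<subseteq>)"
begin

lemma partial_order_CO: "partial_order L"
  by unfold_locales (auto simp: eq_L le_L)

lemma least_join: "U \<in> CO X \<Longrightarrow> V \<in> CO X \<Longrightarrow> least L (U \<union> V) (Upper L {U, V})"
  by (auto simp: least_def Upper_def carrier_L le_L CO_Un)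

lemma greatest_meet: "U \<in> CO X \<Longrightarrow> V \<in> CO X \<Longrightarrow> greatest L (U \<inter> V) (Lower L {U, V})"
  by (auto simp: greatest_def Lower_def carrier_L le_L CO_Int)

lemma greatest_top: "greatest L (topspace X) (carrier L)"
  using CO_subset by (auto simp: greatest_def carrier_L le_L CO_topspace)

lemma least_bottom: "least L {} (carrier L)"
  by (auto simp: least_def carrier_L le_L CO_empty)

lemma bounded_lattice_CO: "Lattice.bounded_lattice L"
proof -
  interpret partial_order L by (rule partial_order_CO)
  show ?thesis
  proof unfold_locales
    show "\<exists>s. least L s (Upper L {x, y})" if "x \<in> carrier L" "y \<in> carrier L" for x y
      using least_join that carrier_L by blast
    show "\<exists>s. greatest L s (Lower L {x, y})" if "x \<in> carrier L" "y \<in> carrier L" for x y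
      using greatest_meet that carrier_L by blast
    show "\<exists>x. least L x (carrier L)" using least_bottom by blast
    show "\<exists>x. greatest L x (carrier L)" using greatest_top by blast
  qed
qed

sublocale bl: Lattice.bounded_lattice L
  by (rule bounded_lattice_CO)

lemma meet_CO: "U \<in> CO X \<Longrightarrow> V \<in> CO X \<Longrightarrow> U \<sqinter>\<^bsub>L\<^esub> V = U \<inter> V"
  using bl.greatest_unique[OF greatest_meet] bl.inf_of_two_greatest[of U V]
  by (simp add: meet_def carrier_L)

lemma join_CO: "U \<in> CO X \<Longrightarrow> V \<in> CO X \<Longrightarrow> U \<squnion>\<^bsub>L\<^esub> V = U \<union> V"
  using bl.least_unique[OF least_join] bl.sup_of_two_least[of U V]
  by (simp add: join_def carrier_L)

lemma top_CO: "\<top>\<^bsub>L\<^esub> = topspace X"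
  using bl.greatest_unique[OF greatest_top bl.top_greatest] by simp

lemma bottom_CO: "\<bottom>\<^bsub>L\<^esub> = {}"
  using bl.least_unique[OF least_bottom bl.bottom_least] by simp

lemma distributive_CO: "distributive L"
  unfolding distributive_def carrier_L
  by (auto simp: meet_CO join_CO CO_Un CO_Int)

sublocale dist_lattice L
  by unfold_locales (rule distributive_CO)

lemma CO_point_prime_filter:
  assumes "x \<in> topspace X"
  shows "{U \<in> CO X. x \<in> U} \<in> prime_filters L"
  using assms
  by (intro prime_filterI)
    (auto simp: carrier_L le_L meet_CO join_CO top_CO bottom_CO CO_Int CO_topspace)

lemma CO_pf_Union:
  assumes P: "P \<in> prime_filters L" and "finite \<F>" "\<F> \<subseteq> CO X" "\<Union>\<F> \<in> P"
  shows "\<exists>U\<in>\<F>. U \<in> P"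
  using assms(2-)
proof (induction rule: finite_induct)
  case empty
  then show ?case using pf_bot[OF P] by (simp add: bottom_CO)
next
  case (insert U \<F>)
  then have "U \<squnion>\<^bsub>L\<^esub> \<Union>\<F> \<in> P" by (simp add: join_CO CO_Union)
  then have "U \<in> P \<or> \<Union>\<F> \<in> P" using pf_join[OF P] insert by (simp add: carrier_L CO_Union)
  then show ?case using insert by auto
qed

text \<open>Let F consist of the points all of whose compact open neighbourhoods belong to P. A
  compact open set belongs to P exactly when it meets F: if a member of P missed F, finitely many
  compact opens outside P would cover it, against primeness. As P is closed under meets, F is
  irreducible, and its generic point is the one wanted.\<close>

lemma CO_prime_filter_point:
  assumes P: "P \<in> prime_filters L"
  obtains x where "x \<in> topspace X" "P = {U \<in> CO X. x \<in> U}"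
proof -
  have PCO: "P \<subseteq> CO X" using pf_carrier[OF P] carrier_L by blast
  define F where "F = topspace X - \<Union>(CO X - P)"
  have clF: "closedin X F" unfolding F_def
    by (intro closedin_diff openin_Union) (auto intro: CO_openin)
  have meetF: "U \<inter> F \<noteq> {}" if U: "U \<in> P" for U
  proof
    assume "U \<inter> F = {}"
    then have "U \<subseteq> \<Union>(CO X - P)" using PCO U CO_subset unfolding F_def by blast
    moreover have "compactin X U" using U PCO CO_compactin by blast
    moreover have "\<forall>V\<in>CO X - P. openin X V" using CO_openin by blast
    ultimately obtain \<F> where \<F>: "finite \<F>" "\<F> \<subseteq> CO X - P" "U \<subseteq> \<Union>\<F>"
      unfolding compactin_def by meson
    then have "\<Union>\<F> \<in> P" using pf_up[OF P U] CO_Union[of \<F> X] by (auto simp: carrier_L le_L)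
    then show False using CO_pf_Union[OF P] \<F> by blast
  qed
  have inF: "U \<in> P" if "U \<in> CO X" "U \<inter> F \<noteq> {}" for U
    using that unfolding F_def by blast
  have "irreducible_closedin X F"
  proof (rule irreducible_closedin_CO_I[OF clF])
    show "F \<noteq> {}" using meetF[OF pf_top[OF P]] by blast
    fix U V assume "U \<in> CO X" "V \<in> CO X" "U \<inter> F \<noteq> {}" "V \<inter> F \<noteq> {}"
    then show "U \<inter> V \<inter> F \<noteq> {}"
      using pf_meet[OF P, of U V] meetF[of "U \<inter> V"] inF by (simp add: carrier_L meet_CO)
  qed
  then obtain x where x: "x \<in> topspace X" "F = X closure_of {x}"
    using spectral unfolding spectral_space_def sober_space_def by meson
  have xF: "x \<in> F" using x by (simp add: in_closure_of)
  have "P = {U \<in> CO X. x \<in> U}"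
  proof
    show "P \<subseteq> {U \<in> CO X. x \<in> U}"
    proof
      fix U assume U: "U \<in> P"
      then obtain y where y: "y \<in> U" "y \<in> X closure_of {x}" using meetF x(2) by blast
      have "U \<in> CO X" using U PCO by blast
      then show "U \<in> {U \<in> CO X. x \<in> U}"
        using closure_of_point_open[OF y(2) CO_openin y(1)] by simp
    qed
    show "{U \<in> CO X. x \<in> U} \<subseteq> P" using inF xF by blast
  qed
  then show thesis by (rule that[OF x(1)])
qed

end

section \<open>The patch topology\<close>

text \<open>The differences U - V are closed under intersection once the compact opens are closed
  under unions and intersections, so they can serve directly as a base. That the predicate is a
  topology is therefore shown only for spectral spaces, in \<open>openin_patch\<close>.\<close>

definition patch :: "'x topology \<Rightarrow> 'x topology" where
  "patch X = topology (\<lambda>S. \<forall>x\<in>S. \<exists>U\<in>CO X. \<exists>V\<in>CO X. x \<in> U - V \<and> U - V \<subseteq> S)"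

context spectral
begin

lemma openin_patch:
  "openin (patch X) S \<longleftrightarrow> (\<forall>x\<in>S. \<exists>U\<in>CO X. \<exists>V\<in>CO X. x \<in> U - V \<and> U - V \<subseteq> S)"
proof -
  let ?T = "\<lambda>S. \<forall>x\<in>S. \<exists>U\<in>CO X. \<exists>V\<in>CO X. x \<in> U - V \<and> U - V \<subseteq> S"
  have "istopology ?T"
    unfolding istopology_def
  proof (intro conjI allI impI ballI)
    fix S T x assume S: "?T S" and T: "?T T" and x: "x \<in> S \<inter> T"
    obtain U V where UV: "U \<in> CO X" "V \<in> CO X" "x \<in> U - V" "U - V \<subseteq> S" using S x by blast
    obtain U' V' where UV': "U' \<in> CO X" "V' \<in> CO X" "x \<in> U' - V'" "U' - V' \<subseteq> T" using T x by blast
    show "\<exists>U\<in>CO X. \<exists>V\<in>CO X. x \<in> U - V \<and> U - V \<subseteq> S \<inter> T"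
    proof (intro bexI conjI)
      show "x \<in> (U \<inter> U') - (V \<union> V')" "(U \<inter> U') - (V \<union> V') \<subseteq> S \<inter> T"
        using UV UV' by auto
    qed (use CO_Int CO_Un UV UV' in auto)
  next
    fix \<K> x assume K: "\<forall>K\<in>\<K>. ?T K" and "x \<in> \<Union>\<K>"
    then obtain K where "K \<in> \<K>" "x \<in> K" by blast
    then obtain U V where "U \<in> CO X" "V \<in> CO X" "x \<in> U - V" "U - V \<subseteq> K" using K by blast
    then show "\<exists>U\<in>CO X. \<exists>V\<in>CO X. x \<in> U - V \<and> U - V \<subseteq> \<Union>\<K>" using \<open>K \<in> \<K>\<close> by blast
  qed
  then show ?thesis unfolding patch_def by (simp add: topology_inverse')
qed

lemma openin_patch_Diff: "U \<in> CO X \<Longrightarrow> V \<in> CO X \<Longrightarrow> openin (patch X) (U - V)"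
  unfolding openin_patch by blast

lemma openin_patch_CO: "U \<in> CO X \<Longrightarrow> openin (patch X) U"
  using openin_patch_Diff[OF _ CO_empty] by simp

lemma topspace_patch [simp]: "topspace (patch X) = topspace X"
proof
  show "topspace (patch X) \<subseteq> topspace X"
  proof
    fix x assume "x \<in> topspace (patch X)"
    then obtain U where "U \<in> CO X" "x \<in> U" using openin_patch[of "topspace (patch X)"] by auto
    then show "x \<in> topspace X" using CO_subset by blast
  qed
  show "topspace X \<subseteq> topspace (patch X)"
    using openin_subset openin_patch_CO CO_topspace by blast
qed

lemma closedin_patch_CO: "U \<in> CO X \<Longrightarrow> closedin (patch X) U"
  using openin_patch_Diff[OF CO_topspace, of U] CO_subset[of U X] by (simp add: closedin_def)

lemma openin_imp_patch:
  assumes "openin X S" shows "openin (patch X) S"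
  unfolding openin_patch
proof
  fix x assume "x \<in> S"
  then obtain V where "V \<in> CO X" "x \<in> V" "V \<subseteq> S" using CO_base assms by blast
  then show "\<exists>U\<in>CO X. \<exists>V\<in>CO X. x \<in> U - V \<and> U - V \<subseteq> S" using CO_empty by blast
qed

lemma closedin_imp_patch: "closedin X S \<Longrightarrow> closedin (patch X) S"
  using openin_imp_patch by (simp add: closedin_def)

lemma compactin_patch_imp: "compactin (patch X) K \<Longrightarrow> compactin X K"
  using openin_imp_patch by (simp add: compactin_def)

text \<open>Compact opens and their complements form a subbase. The statement has the shape in which
  Alexander's subbase theorem, applied next, expects its topology.\<close>

lemma patch_subbase:
  "topology (arbitrary union_of (finite intersection_of
      (\<lambda>S. S \<in> CO X \<union> (\<lambda>U. topspace X - U) ` CO X) relative_to topspace X)) = patch X"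
    (is "topology (arbitrary union_of (finite intersection_of ?B relative_to _)) = _")
  unfolding topology_eq
proof (intro allI iffI)
  fix S
  assume "openin (topology (arbitrary union_of (finite intersection_of ?B relative_to topspace X))) S"
  then have "(arbitrary union_of (finite intersection_of ?B relative_to topspace X)) S"
    by (simp add: openin_subbase)
  then obtain \<U> where \<U>: "S = \<Union>\<U>" "\<And>T. T \<in> \<U> \<Longrightarrow> (finite intersection_of ?B relative_to topspace X) T"
    unfolding union_of_def by auto
  have "openin (patch X) T" if T: "T \<in> \<U>" for T
  proof -
    obtain \<F> where \<F>: "finite \<F>" "\<F> \<subseteq> Collect ?B" "T = topspace X \<inter> \<Inter>\<F>"
      using \<U>(2)[OF T] unfolding relative_to_def intersection_of_def by auto
    have "openin (patch X) G" if "G \<in> \<F>" for G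
      using \<F>(2) that openin_patch_CO openin_patch_Diff[OF CO_topspace] by auto
    then have "openin (patch X) (topspace X \<inter> \<Inter>\<F>)"
      using \<F>(1) openin_Inter[of \<F> "patch X"] openin_patch_CO[OF CO_topspace]
      by (cases "\<F> = {}") (auto intro!: openin_Int)
    then show ?thesis using \<F>(3) by simp
  qed
  then show "openin (patch X) S" using \<U>(1) by blast
next
  fix S assume S: "openin (patch X) S"
  let ?P = "finite intersection_of ?B relative_to topspace X"
  let ?W = "{W. \<exists>U\<in>CO X. \<exists>V\<in>CO X. W = U - V \<and> W \<subseteq> S}"
  have "?P (U - V)" if "U \<in> CO X" "V \<in> CO X" for U V
    unfolding relative_to_def intersection_of_def
  proof (intro exI conjI)
    show "finite {U, topspace X - V}" by simp
    show "{U, topspace X - V} \<subseteq> Collect ?B" using that by auto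
    show "\<Inter>{U, topspace X - V} = \<Inter>{U, topspace X - V}" ..
    show "topspace X \<inter> \<Inter>{U, topspace X - V} = U - V" using that CO_subset by blast
  qed
  then have "?W \<subseteq> Collect ?P" by blast
  moreover have "\<Union>?W = S"
  proof
    show "S \<subseteq> \<Union>?W"
    proof
      fix x assume "x \<in> S"
      then obtain U V where "U \<in> CO X" "V \<in> CO X" "x \<in> U - V" "U - V \<subseteq> S"
        using S unfolding openin_patch by meson
      then show "x \<in> \<Union>?W" by blast
    qed
  qed blast
  ultimately have "(arbitrary union_of ?P) S"
    unfolding union_of_def arbitrary_def by blast
  then show "openin (topology (arbitrary union_of ?P)) S" by (simp add: openin_subbase)
qed

text \<open>Compactness of the patch topology is the prime filter theorem for the lattice of compact
  opens: an open cover without finite subcover yields a filter and a disjoint ideal.\<close>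

theorem compact_space_patch: "compact_space (patch X)"
proof (rule Alexander_subbase_alt[OF _ _ patch_subbase])
  let ?B = "CO X \<union> (\<lambda>U. topspace X - U) ` CO X"
  show "topspace X \<subseteq> \<Union>?B" using CO_topspace by blast
  fix C assume C: "C \<subseteq> ?B" "topspace X \<subseteq> \<Union>C"
  show "\<exists>C'. finite C' \<and> C' \<subseteq> C \<and> topspace X \<subseteq> \<Union>C'"
  proof (rule ccontr)
    assume no: "\<not> ?thesis"
    \<comment> \<open>The filter side K is generated by the compact opens whose complements belong
      to the cover, the ideal side I by the compact opens in the cover. An inclusion of a member of
      K in a member of I would be a finite subcover.\<close>
    define M where "M = {U \<in> CO X. topspace X - U \<in> C}"
    define K where "K = {topspace X \<inter> \<Inter>\<F> |\<F>. finite \<F> \<and> \<F> \<subseteq> M}"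
    define I where "I = {\<Union>\<F> |\<F>. finite \<F> \<and> \<F> \<subseteq> C \<inter> CO X}"
    define L :: "'x set gorder" where "L = \<lparr>carrier = CO X, eq = (=), le = (\<subseteq>)\<rparr>"
    interpret CO_lattice X L by unfold_locales (simp_all add: L_def)
    have KI: "topspace X \<in> K" "{} \<in> I"
      unfolding K_def I_def mem_Collect_eq
      by (rule exI[of _ "{}"], simp, rule exI[of _ "{}"], simp)
    have Inter_CO: "topspace X \<inter> \<Inter>\<F> \<in> CO X" if "finite \<F>" "\<F> \<subseteq> CO X" for \<F>
      using that
    proof (induction rule: finite_induct)
      case (insert U \<F>)
      have "topspace X \<inter> \<Inter>(insert U \<F>) = U \<inter> (topspace X \<inter> \<Inter>\<F>)" by auto
      then show ?case using insert CO_Int by simp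
    qed (simp add: CO_topspace)
    obtain P where P: "P \<in> prime_filters L" "K \<subseteq> P" "P \<inter> I = {}"
    proof (rule prime_filter_separation[of K I])
      show "K \<subseteq> carrier L" using Inter_CO by (auto simp: K_def M_def L_def subset_iff)
      show "I \<subseteq> carrier L" using CO_Union[of _ X] by (auto simp: I_def L_def)
      show "K \<noteq> {}" "I \<noteq> {}" using KI by blast+
      fix k k' assume "k \<in> K" "k' \<in> K"
      then obtain \<F> \<G> where "finite \<F>" "\<F> \<subseteq> M" "k = topspace X \<inter> \<Inter>\<F>"
        "finite \<G>" "\<G> \<subseteq> M" "k' = topspace X \<inter> \<Inter>\<G>" unfolding K_def by blast
      then have "topspace X \<inter> \<Inter>(\<F> \<union> \<G>) \<in> K" "topspace X \<inter> \<Inter>(\<F> \<union> \<G>) \<subseteq> k"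
        "topspace X \<inter> \<Inter>(\<F> \<union> \<G>) \<subseteq> k'"
        unfolding K_def mem_Collect_eq by (intro exI[of _ "\<F> \<union> \<G>"], simp_all) auto
      then show "\<exists>k''\<in>K. k'' \<sqsubseteq>\<^bsub>L\<^esub> k \<and> k'' \<sqsubseteq>\<^bsub>L\<^esub> k'" unfolding le_L by blast
    next
      fix i i' assume "i \<in> I" "i' \<in> I"
      then obtain \<F> \<G> where "finite \<F>" "\<F> \<subseteq> C \<inter> CO X" "i = \<Union>\<F>"
        "finite \<G>" "\<G> \<subseteq> C \<inter> CO X" "i' = \<Union>\<G>" unfolding I_def by blast
      then have "\<Union>(\<F> \<union> \<G>) \<in> I" "i \<subseteq> \<Union>(\<F> \<union> \<G>)" "i' \<subseteq> \<Union>(\<F> \<union> \<G>)"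
        unfolding I_def mem_Collect_eq by (intro exI[of _ "\<F> \<union> \<G>"], simp_all)
      then show "\<exists>i''\<in>I. i \<sqsubseteq>\<^bsub>L\<^esub> i'' \<and> i' \<sqsubseteq>\<^bsub>L\<^esub> i''" unfolding le_L by blast
    next
      fix k i assume "k \<in> K" "i \<in> I"
      then obtain \<F> \<G> where FG: "finite \<F>" "\<F> \<subseteq> M" "k = topspace X \<inter> \<Inter>\<F>"
        "finite \<G>" "\<G> \<subseteq> C \<inter> CO X" "i = \<Union>\<G>" unfolding K_def I_def by blast
      show "\<not> k \<sqsubseteq>\<^bsub>L\<^esub> i"
      proof
        assume "k \<sqsubseteq>\<^bsub>L\<^esub> i"
        then have ki: "topspace X \<inter> \<Inter>\<F> \<subseteq> \<Union>\<G>" using FG by (simp add: le_L)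
        let ?C = "(\<lambda>U. topspace X - U) ` \<F> \<union> \<G>"
        have "finite ?C" "?C \<subseteq> C" using FG by (auto simp: M_def)
        moreover have "topspace X \<subseteq> \<Union>?C" using ki by blast
        ultimately have "\<exists>C'. finite C' \<and> C' \<subseteq> C \<and> topspace X \<subseteq> \<Union>C'"
          by (intro exI[of _ ?C] conjI)
        then show False using no by (rule notE[rotated])
      qed
    qed
    \<comment> \<open>The prime filter is that of a point, and this point escapes every member of
      the cover: compact opens of \<open>C\<close> lie in I, complements in \<open>C\<close> come
      from elements of K.\<close>
    obtain x where x: "x \<in> topspace X" "P = {U \<in> CO X. x \<in> U}"
      using CO_prime_filter_point[OF P(1)] .
    obtain c where c: "c \<in> C" "x \<in> c" using C(2) x(1) by blast
    show False
    proof (cases "c \<in> CO X")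
      case True
      then have "c \<in> I" unfolding I_def mem_Collect_eq using c by (intro exI[of _ "{c}"]) simp
      then show False using P(3) x(2) c True by blast
    next
      case False
      then obtain U where U: "U \<in> CO X" "c = topspace X - U" using C(1) c by blast
      then have "U \<in> M" using c by (simp add: M_def)
      then have "U \<in> K" unfolding K_def mem_Collect_eq
        using CO_subset[OF U(1)] by (intro exI[of _ "{U}"]) auto
      then show False using P(2) x(2) c U by blast
    qed
  qed
qed

lemma Hausdorff_space_patch: "Hausdorff_space (patch X)"
  unfolding Hausdorff_space_def topspace_patch
proof (intro allI impI)
  fix x y assume xy: "x \<in> topspace X \<and> y \<in> topspace X \<and> x \<noteq> y"
  then obtain U where U: "U \<in> CO X" "x \<in> U \<longleftrightarrow> y \<notin> U" using T0[of x y] by blast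
  have op: "openin (patch X) U" "openin (patch X) (topspace X - U)"
    using U openin_patch_CO openin_patch_Diff CO_topspace by auto
  show "\<exists>U V. openin (patch X) U \<and> openin (patch X) V \<and> x \<in> U \<and> y \<in> V \<and> disjnt U V"
  proof (cases "x \<in> U")
    case True
    then show ?thesis using U xy op by (intro exI[of _ U] exI[of _ "topspace X - U"]) (auto simp: disjnt_def)
  next
    case False
    then show ?thesis using U xy op by (intro exI[of _ "topspace X - U"] exI[of _ U]) (auto simp: disjnt_def)
  qed
qed

lemma compactin_patch_closed: "closedin (patch X) K \<Longrightarrow> compactin (patch X) K"
  by (rule closedin_compact_space[OF compact_space_patch])

text \<open>Patch compactness in finite intersection form. It produces generic points of subspaces,
  and shrinks the family of all compact open neighbourhoods of a point to a single
  neighbourhood.\<close>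

lemma patch_closed_Inter_CO:
  assumes Y: "closedin (patch X) Y" and K: "K \<subseteq> CO X" and e: "Y \<inter> \<Inter>K = {}"
  obtains \<G> where "finite \<G>" "\<G> \<subseteq> K" "Y \<inter> \<Inter>\<G> = {}"
proof -
  let ?\<U> = "(\<lambda>U. topspace X - U) ` K"
  have "Y \<subseteq> \<Union>?\<U>" using e closedin_subset[OF Y] by auto
  moreover have "\<forall>W\<in>?\<U>. openin (patch X) W"
    using openin_patch_Diff[OF CO_topspace] K by auto
  ultimately obtain \<F> where \<F>: "finite \<F>" "\<F> \<subseteq> ?\<U>" "Y \<subseteq> \<Union>\<F>"
    using compactin_patch_closed[OF Y] unfolding compactin_def by meson
  obtain \<G> where \<G>: "finite \<G>" "\<G> \<subseteq> K" "\<F> = (\<lambda>U. topspace X - U) ` \<G>"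
    using finite_subset_image[OF \<F>(1,2)] by blast
  show thesis by (rule that[OF \<G>(1,2)]) (use \<F>(3) \<G>(3) in blast)
qed

text \<open>The whole space is inserted because the intersection of an empty \<G> is the universe of
  the type, which need not be open.\<close>

lemma openin_Inter_CO:
  "finite \<G> \<Longrightarrow> \<G> \<subseteq> CO X \<Longrightarrow> openin X (\<Inter>(insert (topspace X) \<G>))"
  using CO_openin by (intro openin_Inter) auto

section \<open>Spectral and doubly spectral subsets\<close>

text \<open>A trace of a compact open is patch-closed, hence compact. Conversely, a compact W of the
  form T \<inter> Y with T open fits inside a compact open U below T, and then W is the trace of
  U.\<close>

lemma CO_subspace_patch_closed:
  assumes Y: "closedin (patch X) Y"
  shows "CO (subtopology X Y) = (\<lambda>U. U \<inter> Y) ` CO X"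
proof
  show "(\<lambda>U. U \<inter> Y) ` CO X \<subseteq> CO (subtopology X Y)"
  proof
    fix W assume "W \<in> (\<lambda>U. U \<inter> Y) ` CO X"
    then obtain U where U: "U \<in> CO X" "W = U \<inter> Y" by blast
    have "closedin (patch X) W" using Y closedin_patch_CO[OF U(1)] U(2) by (simp add: closedin_Int)
    then have "compactin X W" by (intro compactin_patch_imp compactin_patch_closed)
    then show "W \<in> CO (subtopology X Y)"
      using U CO_openin[OF U(1)] by (auto simp: CO_def compactin_subtopology openin_subtopology)
  qed
  show "CO (subtopology X Y) \<subseteq> (\<lambda>U. U \<inter> Y) ` CO X"
  proof
    fix W assume W: "W \<in> CO (subtopology X Y)"
    then obtain T where T: "openin X T" "W = T \<inter> Y" by (auto simp: CO_def openin_subtopology)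
    have "compactin X W" using W by (auto simp: CO_def compactin_subtopology)
    then obtain U where "U \<in> CO X" "W \<subseteq> U" "U \<subseteq> T" using T by (elim CO_cover[of W T]) auto
    then show "W \<in> (\<lambda>U. U \<inter> Y) ` CO X" using T by blast
  qed
qed

text \<open>Sobriety is the substance. An irreducible closed F of the subspace is patch-closed in X,
  and irreducibility lets every finite family of compact opens meeting F have a common point in F;
  patch compactness then yields a point of F in all of them.\<close>

lemma spectral_space_patch_closed:
  assumes Y: "closedin (patch X) Y"
  shows "spectral_space (subtopology X Y)"
proof -
  let ?Y = "subtopology X Y"
  have YX: "Y \<subseteq> topspace X" using closedin_subset[OF Y] by simp
  then have tY: "topspace ?Y = Y" by auto
  note CO = CO_subspace_patch_closed[OF Y]
  have "sober_space ?Y"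
  proof (rule sober_spaceI)
    fix x y assume xy: "x \<in> topspace ?Y" "y \<in> topspace ?Y" and eq: "\<And>U. openin ?Y U \<Longrightarrow> x \<in> U \<longleftrightarrow> y \<in> U"
    show "x = y"
    proof (rule T0)
      fix U assume "U \<in> CO X"
      then have "openin ?Y (U \<inter> Y)" using CO_openin by (auto simp: openin_subtopology)
      then show "x \<in> U \<longleftrightarrow> y \<in> U" using eq[of "U \<inter> Y"] xy tY by auto
    qed (use xy YX in auto)
  next
    fix F assume F: "irreducible_closedin ?Y F"
    then have "closedin ?Y F" "F \<noteq> {}" by (auto simp: irreducible_closedin_def)
    then obtain G where G: "closedin X G" "F = G \<inter> Y" by (auto simp: closedin_subtopology)
    have cF: "closedin (patch X) F" using G Y closedin_imp_patch by (simp add: closedin_Int)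
    define K where "K = {U \<in> CO X. U \<inter> F \<noteq> {}}"
    have inter: "F \<inter> \<Inter>\<G> \<noteq> {}" if "finite \<G>" "\<G> \<subseteq> K" for \<G>
    proof -
      \<comment> \<open>Irreducibility speaks about sets open in the subspace, so the induction
        carries such a set with the same trace on F instead of the intersection itself.\<close>
      have "\<exists>U. openin ?Y U \<and> F \<inter> U = F \<inter> \<Inter>\<G> \<and> U \<inter> F \<noteq> {}" using that
      proof (induction rule: finite_induct)
        case empty
        then show ?case using \<open>F \<noteq> {}\<close> G(2) tY openin_topspace[of ?Y]
          by (intro exI[of _ Y]) auto
      next
        case (insert V \<G>)
        then obtain U where U: "openin ?Y U" "F \<inter> U = F \<inter> \<Inter>\<G>" "U \<inter> F \<noteq> {}" by auto
        have V: "V \<in> CO X" "V \<inter> F \<noteq> {}" using insert by (auto simp: K_def)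
        have V': "openin ?Y (V \<inter> Y)" using CO_openin[OF V(1)] by (auto simp: openin_subtopology)
        have "(V \<inter> Y) \<inter> U \<inter> F \<noteq> {}"
          using irreducible_closedin_meets[OF F V' U(1)] V(2) U(3) G(2) by blast
        then show ?case using U V' G(2) by (intro exI[of _ "(V \<inter> Y) \<inter> U"]) auto
      qed
      then show ?thesis by blast
    qed
    have "F \<inter> \<Inter>K \<noteq> {}"
    proof
      assume e: "F \<inter> \<Inter>K = {}"
      have "K \<subseteq> CO X" by (auto simp: K_def)
      then obtain \<G> where "finite \<G>" "\<G> \<subseteq> K" "F \<inter> \<Inter>\<G> = {}"
        using patch_closed_Inter_CO[OF cF _ e] by blast
      then show False using inter by blast
    qed
    then obtain x where x: "x \<in> F" "\<And>U. U \<in> K \<Longrightarrow> x \<in> U" by blast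
    have "x \<in> W" if W: "openin ?Y W" "W \<inter> F \<noteq> {}" for W
    proof -
      obtain T where T: "openin X T" "W = T \<inter> Y" using W(1) by (auto simp: openin_subtopology)
      obtain z where z: "z \<in> W" "z \<in> F" using W(2) by blast
      then obtain U where "U \<in> CO X" "z \<in> U" "U \<subseteq> T" using CO_base[OF T(1), of z] T(2) by blast
      then show ?thesis using x(1) x(2)[of U] z T(2) G(2) by (auto simp: K_def)
    qed
    then show "\<exists>x\<in>F. \<forall>U. openin ?Y U \<longrightarrow> U \<inter> F \<noteq> {} \<longrightarrow> x \<in> U" using x(1) by blast
  qed
  moreover have "compact_space ?Y"
    using compactin_patch_imp[OF compactin_patch_closed[OF Y]] by (simp add: compact_space_subtopology)
  moreover have "\<exists>\<V>. \<V> \<subseteq> CO ?Y \<and> W = \<Union>\<V>" if W: "openin ?Y W" for W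
  proof -
    obtain T where T: "openin X T" "W = T \<inter> Y" using W by (auto simp: openin_subtopology)
    then obtain \<V> where V: "\<V> \<subseteq> CO X" "T = \<Union>\<V>"
      using spectral unfolding spectral_space_def by meson
    show ?thesis
      by (rule exI[of _ "(\<lambda>U. U \<inter> Y) ` \<V>"]) (use V T CO in auto)
  qed
  moreover have "U \<inter> V \<in> CO ?Y" if "U \<in> CO ?Y" "V \<in> CO ?Y" for U V
  proof -
    from that obtain U' where U': "U' \<in> CO X" "U = U' \<inter> Y" unfolding CO by blast
    from that obtain V' where V': "V' \<in> CO X" "V = V' \<inter> Y" unfolding CO by blast
    have "U \<inter> V = (U' \<inter> V') \<inter> Y" using U' V' by auto
    then show ?thesis unfolding CO using CO_Int[OF U'(1) V'(1)] by (rule image_eqI)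
  qed
  ultimately show ?thesis unfolding spectral_space_def by blast
qed

theorem spectral_subset_iff_patch_closed: "spectral_subset X Y \<longleftrightarrow> closedin (patch X) Y"
proof
  assume Y: "closedin (patch X) Y"
  have YX: "Y \<subseteq> topspace X" using closedin_subset[OF Y] by simp
  then have tY: "topspace (subtopology X Y) = Y" by auto
  have "{x \<in> Y. id x \<in> V} = V \<inter> Y" for V by auto
  then show "spectral_subset X Y"
    unfolding spectral_subset_def spectral_map_def tY
    using YX spectral spectral_space_patch_closed[OF Y] CO_subspace_patch_closed[OF Y]
    by (auto simp: continuous_map_from_subtopology)
next
  assume "spectral_subset X Y"
  then have YX: "Y \<subseteq> topspace X" and sp: "spectral_space (subtopology X Y)"
    and pre: "\<And>V. V \<in> CO X \<Longrightarrow> {x \<in> topspace (subtopology X Y). id x \<in> V} \<in> CO (subtopology X Y)"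
    by (auto simp: spectral_subset_def spectral_map_def)
  interpret Y: spectral "subtopology X Y" by unfold_locales (rule sp)
  have tY: "topspace (subtopology X Y) = Y" using YX by auto
  have pre': "V \<inter> Y \<in> CO (subtopology X Y)" if "V \<in> CO X" for V
  proof -
    have "{x \<in> topspace (subtopology X Y). id x \<in> V} = V \<inter> Y" using tY by auto
    then show ?thesis using pre[OF that] by simp
  qed
  \<comment> \<open>A spectral inclusion pulls compact opens back to compact opens, hence is
    continuous for the patch topologies. So Y is a compact subset of a Hausdorff space.\<close>
  have "continuous_map (patch (subtopology X Y)) (patch X) id"
    unfolding continuous_map_def Y.topspace_patch topspace_patch tY
  proof (intro conjI allI impI)
    fix S assume S: "openin (patch X) S"
    show "openin (patch (subtopology X Y)) {x \<in> Y. id x \<in> S}"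
      unfolding Y.openin_patch
    proof
      fix x assume x: "x \<in> {x \<in> Y. id x \<in> S}"
      then obtain U V where "U \<in> CO X" "V \<in> CO X" "x \<in> U - V" "U - V \<subseteq> S"
        using S unfolding openin_patch by auto
      then show "\<exists>U\<in>CO (subtopology X Y). \<exists>V\<in>CO (subtopology X Y). x \<in> U - V \<and> U - V \<subseteq> {x \<in> Y. id x \<in> S}"
        using x by (intro bexI[of _ "U \<inter> Y"] bexI[of _ "V \<inter> Y"]) (auto intro: pre')
    qed
  qed (use YX in auto)
  then have "compactin (patch X) (id ` Y)"
    using Y.compact_space_patch unfolding compact_space_def Y.topspace_patch tY
    by (intro image_compactin)
  then show "closedin (patch X) Y"
    using compactin_imp_closedin[OF Hausdorff_space_patch] by simp
qed

corollary doubly_spectral_iff_patch_clopen: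
  "doubly_spectral X Y \<longleftrightarrow> closedin (patch X) Y \<and> openin (patch X) Y"
proof -
  have "closedin (patch X) (topspace X - Y) \<longleftrightarrow> openin (patch X) Y" if "Y \<subseteq> topspace X"
    using that by (simp add: openin_closedin_eq)
  moreover have "Y \<subseteq> topspace X" if "closedin (patch X) Y" using closedin_subset[OF that] by simp
  ultimately show ?thesis
    unfolding doubly_spectral_def spectral_subset_iff_patch_closed by blast
qed

lemma doubly_spectral_subset: "doubly_spectral X Y \<Longrightarrow> Y \<subseteq> topspace X"
  by (simp add: doubly_spectral_def spectral_subset_def)

lemma doubly_spectral_Diff_CO: "U \<in> CO X \<Longrightarrow> V \<in> CO X \<Longrightarrow> doubly_spectral X (U - V)"
  unfolding doubly_spectral_iff_patch_clopen
  by (simp add: openin_patch_Diff closedin_diff closedin_patch_CO openin_patch_CO)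

lemma doubly_spectral_compl: "doubly_spectral X Y \<Longrightarrow> doubly_spectral X (topspace X - Y)"
  using doubly_spectral_subset[of Y] by (auto simp: doubly_spectral_def double_diff)

lemma doubly_spectral_Union:
  "finite \<F> \<Longrightarrow> (\<And>Y. Y \<in> \<F> \<Longrightarrow> doubly_spectral X Y) \<Longrightarrow> doubly_spectral X (\<Union>\<F>)"
  unfolding doubly_spectral_iff_patch_clopen by (auto intro: closedin_Union)

text \<open>A patch-clopen set is both compact and open in the patch topology, so finitely many
  basic differences inside it already cover it.\<close>

lemma doubly_spectral_finite_Union:
  assumes "doubly_spectral X Y"
  obtains I where "finite I" "I \<subseteq> CO X \<times> CO X" "Y = (\<Union>(U, V)\<in>I. U - V)"
proof -
  have Y: "closedin (patch X) Y" "openin (patch X) Y"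
    using assms by (auto simp: doubly_spectral_iff_patch_clopen)
  let ?B = "(\<lambda>(U, V). U - V) ` (CO X \<times> CO X)"
  obtain \<F> where \<F>: "finite \<F>" "\<F> \<subseteq> ?B" "Y \<subseteq> \<Union>\<F>" "\<Union>\<F> \<subseteq> Y"
  proof (rule compactin_base_cover[OF compactin_patch_closed[OF Y(1)] subset_refl Y(2), of ?B])
    show "\<exists>V\<in>?B. x \<in> V \<and> V \<subseteq> Y" if x: "x \<in> Y" for x
    proof -
      obtain U V where UV: "U \<in> CO X" "V \<in> CO X" "x \<in> U - V" "U - V \<subseteq> Y"
        using Y(2) x unfolding openin_patch by meson
      show ?thesis by (rule bexI[of _ "U - V"]) (use UV in auto)
    qed
    show "openin (patch X) V" if "V \<in> ?B" for V using that openin_patch_Diff by auto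
  qed
  then obtain I where "finite I" "I \<subseteq> CO X \<times> CO X" "\<F> = (\<lambda>(U, V). U - V) ` I"
    using finite_subset_image[of \<F>] by metis
  then show thesis using \<F> that[of I] by auto
qed

text \<open>For y in Y, a point in all compact open neighbourhoods of y generalizes y and so lies in
  Y. The complement of Y is patch-closed, hence already misses a finite intersection of these
  neighbourhoods, which makes Y open. Compactness of Y comes from its being patch-closed.\<close>

lemma doubly_spectral_generalization_closed_CO:
  assumes Y: "doubly_spectral X Y"
    and gen: "\<And>x y. x \<in> Y \<Longrightarrow> y \<in> topspace X \<Longrightarrow> x \<in> X closure_of {y} \<Longrightarrow> y \<in> Y"
  shows "Y \<in> CO X"
proof -
  have clop: "closedin (patch X) Y" "openin (patch X) Y"
    using Y by (auto simp: doubly_spectral_iff_patch_clopen)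
  have YX: "Y \<subseteq> topspace X" using doubly_spectral_subset[OF Y] .
  have "openin X Y"
  proof (subst openin_subopen, intro ballI)
    fix y assume y: "y \<in> Y"
    let ?K = "{U \<in> CO X. y \<in> U}"
    have "(topspace X - Y) \<inter> \<Inter>?K = {}"
    proof (rule ccontr)
      assume "(topspace X - Y) \<inter> \<Inter>?K \<noteq> {}"
      then obtain x where x: "x \<in> topspace X" "x \<notin> Y" "x \<in> \<Inter>?K" by auto
      then have "y \<in> X closure_of {x}" using y YX by (auto simp: in_closure_of_point)
      then show False using gen[OF y x(1)] x(2) by simp
    qed
    moreover have "closedin (patch X) (topspace X - Y)"
      using clop(2) by (simp add: closedin_def double_diff YX)
    ultimately obtain \<G> where \<G>: "finite \<G>" "\<G> \<subseteq> ?K" "(topspace X - Y) \<inter> \<Inter>\<G> = {}"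
      using patch_closed_Inter_CO[of "topspace X - Y" ?K] by blast
    have "openin X (\<Inter>(insert (topspace X) \<G>))"
      using \<G> by (intro openin_Inter_CO) auto
    moreover have "y \<in> \<Inter>(insert (topspace X) \<G>)" using \<G> y YX by auto
    moreover have "\<Inter>(insert (topspace X) \<G>) \<subseteq> Y" using \<G>(3) by auto
    ultimately show "\<exists>T. openin X T \<and> y \<in> T \<and> T \<subseteq> Y" by blast
  qed
  then show ?thesis
    using compactin_patch_imp[OF compactin_patch_closed[OF clop(1)]] by (simp add: CO_def)
qed

lemma doubly_spectral_openin_CO: "doubly_spectral X Y \<Longrightarrow> openin X Y \<Longrightarrow> Y \<in> CO X"
  by (rule doubly_spectral_generalization_closed_CO) (auto dest: closure_of_point_open)

end

section \<open>The spectrum of a distributive lattice\<close>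

definition stone :: "('a, 'm) gorder_scheme \<Rightarrow> 'a \<Rightarrow> 'a set set" where
  "stone L a = {P \<in> prime_filters L. a \<in> P}"

text \<open>This is the topology of \<open>spec_obj\<close>, separated from it because it depends on
  the lattice alone.\<close>

definition spectrum :: "('a, 'm) gorder_scheme \<Rightarrow> 'a set topology" where
  "spectrum L = topology_generated_by (stone L ` carrier L)"

context dist_lattice
begin

lemma mem_stone: "P \<in> stone L a \<longleftrightarrow> P \<in> prime_filters L \<and> a \<in> P"
  by (simp add: stone_def)

lemma stone_top: "stone L \<top> = prime_filters L"
  using pf_top by (auto simp: stone_def)

lemma stone_bottom: "stone L \<bottom> = {}"
  using pf_bot by (auto simp: stone_def)

lemma stone_meet: "a \<in> carrier L \<Longrightarrow> b \<in> carrier L \<Longrightarrow> stone L (a \<sqinter> b) = stone L a \<inter> stone L b"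
  using pf_meet by (auto simp: stone_def)

lemma stone_join: "a \<in> carrier L \<Longrightarrow> b \<in> carrier L \<Longrightarrow> stone L (a \<squnion> b) = stone L a \<union> stone L b"
  using pf_join by (auto simp: stone_def)

text \<open>Separating \<open>a\<close> from \<open>b\<close> by a prime filter makes the map to the
  compact opens an order embedding.\<close>

lemma stone_subset_iff:
  assumes "a \<in> carrier L" "b \<in> carrier L"
  shows "stone L a \<subseteq> stone L b \<longleftrightarrow> a \<sqsubseteq> b"
proof
  assume sub: "stone L a \<subseteq> stone L b"
  show "a \<sqsubseteq> b"
  proof (rule ccontr)
    assume "\<not> a \<sqsubseteq> b"
    then obtain P where "P \<in> prime_filters L" "a \<in> P" "b \<notin> P"
      by (rule prime_filter_not_le[OF assms])
    then show False using sub by (auto simp: stone_def)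
  qed
next
  assume "a \<sqsubseteq> b"
  then show "stone L a \<subseteq> stone L b" using pf_up assms by (auto simp: stone_def)
qed

lemma stone_inj: "inj_on (stone L) (carrier L)"
proof (rule inj_onI)
  fix a b assume ab: "a \<in> carrier L" "b \<in> carrier L" "stone L a = stone L b"
  show "a = b"
    by (rule le_antisym) (use ab stone_subset_iff in auto)
qed

lemma stone_Union:
  assumes "finite \<F>" "\<F> \<subseteq> stone L ` carrier L"
  shows "\<Union>\<F> \<in> stone L ` carrier L"
  using assms
proof (induction rule: finite_induct)
  case empty
  then show ?case using stone_bottom bottom_closed by (metis Union_empty imageI)
next
  case (insert F \<F>)
  then obtain a b where ab: "a \<in> carrier L" "F = stone L a" "b \<in> carrier L" "\<Union>\<F> = stone L b" by auto
  then have "\<Union>(insert F \<F>) = stone L (a \<squnion> b)" by (simp add: stone_join)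
  then show ?case using join_closed[of a b] ab by (metis imageI)
qed

text \<open>The generating sets are closed under intersection, because prime filters respect meets,
  so they are a base of the topology they generate.\<close>

lemma openin_spectrum:
  "openin (spectrum L) S \<longleftrightarrow> (\<forall>P\<in>S. \<exists>a\<in>carrier L. P \<in> stone L a \<and> stone L a \<subseteq> S)"
proof
  assume "openin (spectrum L) S"
  then have "generate_topology_on (stone L ` carrier L) S"
    by (simp add: spectrum_def openin_topology_generated_by_iff)
  then show "\<forall>P\<in>S. \<exists>a\<in>carrier L. P \<in> stone L a \<and> stone L a \<subseteq> S"
  proof induction
    case (Int S T)
    show ?case
    proof
      fix P assume P: "P \<in> S \<inter> T"
      then obtain a b where "a \<in> carrier L" "P \<in> stone L a" "stone L a \<subseteq> S"
        "b \<in> carrier L" "P \<in> stone L b" "stone L b \<subseteq> T" using Int.IH by (meson IntD1 IntD2)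
      then show "\<exists>a\<in>carrier L. P \<in> stone L a \<and> stone L a \<subseteq> S \<inter> T"
        by (intro bexI[of _ "a \<sqinter> b"]) (auto simp: stone_meet)
    qed
  next
    case (UN \<K>)
    show ?case
    proof
      fix P assume "P \<in> \<Union>\<K>"
      then obtain K where K: "K \<in> \<K>" "P \<in> K" by blast
      then obtain a where "a \<in> carrier L" "P \<in> stone L a" "stone L a \<subseteq> K" using UN.IH by meson
      then show "\<exists>a\<in>carrier L. P \<in> stone L a \<and> stone L a \<subseteq> \<Union>\<K>" using K by (intro bexI[of _ a]) auto
    qed
  qed auto
next
  assume S: "\<forall>P\<in>S. \<exists>a\<in>carrier L. P \<in> stone L a \<and> stone L a \<subseteq> S"
  show "openin (spectrum L) S"
  proof (subst openin_subopen, intro ballI)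
    fix P assume "P \<in> S"
    then obtain a where a: "a \<in> carrier L" "P \<in> stone L a" "stone L a \<subseteq> S" using S by meson
    have "openin (spectrum L) (stone L a)"
      unfolding spectrum_def by (rule topology_generated_by_Basis) (use a in simp)
    then show "\<exists>T. openin (spectrum L) T \<and> P \<in> T \<and> T \<subseteq> S" using a by blast
  qed
qed

lemma openin_stone: "a \<in> carrier L \<Longrightarrow> openin (spectrum L) (stone L a)"
  unfolding openin_spectrum by blast

lemma topspace_spectrum [simp]: "topspace (spectrum L) = prime_filters L"
proof
  show "topspace (spectrum L) \<subseteq> prime_filters L"
    by (auto simp: spectrum_def stone_def)
  show "prime_filters L \<subseteq> topspace (spectrum L)"
    using openin_subset[OF openin_stone[OF top_closed]] by (simp add: stone_top)
qed

text \<open>The elements whose basic open set is finitely covered form an ideal. If \<open>a\<close>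
  were outside it, a prime filter containing \<open>a\<close> and avoiding the ideal would be an
  uncovered point.\<close>

lemma compactin_stone:
  assumes a: "a \<in> carrier L"
  shows "compactin (spectrum L) (stone L a)"
  unfolding compactin_def
proof (intro conjI allI impI)
  show "stone L a \<subseteq> topspace (spectrum L)" by (auto simp: stone_def)
  fix \<U> assume U: "(\<forall>U\<in>\<U>. openin (spectrum L) U) \<and> stone L a \<subseteq> \<Union>\<U>"
  define I where "I = {b \<in> carrier L. \<exists>\<F>. finite \<F> \<and> \<F> \<subseteq> \<U> \<and> stone L b \<subseteq> \<Union>\<F>}"
  show "\<exists>\<F>. finite \<F> \<and> \<F> \<subseteq> \<U> \<and> stone L a \<subseteq> \<Union>\<F>"
  proof (rule ccontr)
    assume "\<not> ?thesis"
    then have aI: "a \<notin> I" by (simp add: I_def)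
    obtain P where P: "P \<in> prime_filters L" "{a} \<subseteq> P" "P \<inter> I = {}"
    proof (rule prime_filter_separation[of "{a}" I])
      show "I \<subseteq> carrier L" by (auto simp: I_def)
      have "\<bottom> \<in> I" unfolding I_def using stone_bottom by (auto intro: exI[of _ "{}"])
      then show "I \<noteq> {}" by blast
      fix i i' assume "i \<in> I" "i' \<in> I"
      then obtain \<F> \<G> where "finite \<F>" "\<F> \<subseteq> \<U>" "stone L i \<subseteq> \<Union>\<F>" "i \<in> carrier L" "i' \<in> carrier L"
        "finite \<G>" "\<G> \<subseteq> \<U>" "stone L i' \<subseteq> \<Union>\<G>" unfolding I_def by blast
      then have "i \<squnion> i' \<in> I" "i \<sqsubseteq> i \<squnion> i'" "i' \<sqsubseteq> i \<squnion> i'"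
        unfolding I_def by (auto simp: stone_join join_left join_right intro!: exI[of _ "\<F> \<union> \<G>"])
      then show "\<exists>i''\<in>I. i \<sqsubseteq> i'' \<and> i' \<sqsubseteq> i''" by blast
    next
      fix k i assume k: "k \<in> {a}" and i: "i \<in> I"
      show "\<not> k \<sqsubseteq> i"
      proof
        assume "k \<sqsubseteq> i"
        then have "stone L a \<subseteq> stone L i" using k i a by (simp add: stone_subset_iff I_def)
        then have "a \<in> I" using i a unfolding I_def by blast
        then show False using aI by simp
      qed
    qed (use a in auto)
    then have "P \<in> stone L a" by (simp add: stone_def)
    then obtain U where "U \<in> \<U>" "P \<in> U" using U by blast
    then obtain b where b: "b \<in> carrier L" "P \<in> stone L b" "stone L b \<subseteq> U"
      using U unfolding openin_spectrum by meson
    then have "b \<in> I" unfolding I_def using \<open>U \<in> \<U>\<close> by (auto intro!: exI[of _ "{U}"])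
    then show False using b P(3) by (auto simp: stone_def)
  qed
qed

lemma CO_spectrum: "CO (spectrum L) = stone L ` carrier L"
proof
  show "stone L ` carrier L \<subseteq> CO (spectrum L)"
    by (auto simp: CO_def openin_stone compactin_stone)
  show "CO (spectrum L) \<subseteq> stone L ` carrier L"
  proof
    fix W assume W: "W \<in> CO (spectrum L)"
    obtain \<F> where \<F>: "finite \<F>" "\<F> \<subseteq> stone L ` carrier L" "W \<subseteq> \<Union>\<F>" "\<Union>\<F> \<subseteq> W"
    proof (rule compactin_base_cover[OF CO_compactin[OF W] subset_refl CO_openin[OF W], of "stone L ` carrier L"])
      show "\<exists>V\<in>stone L ` carrier L. P \<in> V \<and> V \<subseteq> W" if "P \<in> W" for P
        using CO_openin[OF W] that unfolding openin_spectrum by (metis imageI)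
    qed (auto intro: openin_stone)
    then have "W = \<Union>\<F>" by (intro equalityI)
    then show "W \<in> stone L ` carrier L" using stone_Union[OF \<F>(1,2)] by simp
  qed
qed

lemma spectral_space_spectrum: "spectral_space (spectrum L)"
  unfolding spectral_space_def
proof (intro conjI allI impI ballI)
  show "sober_space (spectrum L)"
  proof (rule sober_spaceI)
    fix P Q assume PQ: "P \<in> topspace (spectrum L)" "Q \<in> topspace (spectrum L)"
      "\<And>U. openin (spectrum L) U \<Longrightarrow> P \<in> U \<longleftrightarrow> Q \<in> U"
    have "a \<in> P \<longleftrightarrow> a \<in> Q" if "a \<in> carrier L" for a
      using PQ(3)[OF openin_stone[OF that]] PQ(1,2) by (simp add: stone_def)
    moreover have "P \<subseteq> carrier L" "Q \<subseteq> carrier L" using PQ(1,2) pf_carrier by auto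
    ultimately show "P = Q" by blast
  next
    fix F assume F: "irreducible_closedin (spectrum L) F"
    have cl: "closedin (spectrum L) F" and ne: "F \<noteq> {}" using F by (auto simp: irreducible_closedin_def)
    have FX: "F \<subseteq> prime_filters L" using closedin_subset[OF cl] by simp
    \<comment> \<open>The generic point is forced: it must contain exactly the elements whose basic
      open set meets F. Irreducibility of F makes this set closed under meets.\<close>
    define P where "P = {a \<in> carrier L. stone L a \<inter> F \<noteq> {}}"
    have P: "P \<in> prime_filters L"
    proof (rule prime_filterI)
      show "P \<subseteq> carrier L" by (auto simp: P_def)
      show "\<top> \<in> P" using ne FX by (auto simp: P_def stone_top)
      show "\<bottom> \<notin> P" by (auto simp: P_def stone_bottom)
      show "b \<in> P" if "a \<in> P" "b \<in> carrier L" "a \<sqsubseteq> b" for a b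
        using that stone_subset_iff[of a b] unfolding P_def by blast
      show "a \<sqinter> b \<in> P" if "a \<in> P" "b \<in> P" for a b
        using irreducible_closedin_meets[OF F, of "stone L a" "stone L b"] that openin_stone
        by (auto simp: P_def stone_meet)
      show "a \<in> P \<or> b \<in> P" if "a \<in> carrier L" "b \<in> carrier L" "a \<squnion> b \<in> P" for a b
        using that by (auto simp: P_def stone_join)
    qed
    have meets: "P \<in> U" if U: "openin (spectrum L) U" "U \<inter> F \<noteq> {}" for U
    proof -
      obtain Q where Q: "Q \<in> U" "Q \<in> F" using U(2) by blast
      then obtain a where a: "a \<in> carrier L" "Q \<in> stone L a" "stone L a \<subseteq> U"
        using U(1) unfolding openin_spectrum by meson
      then have "a \<in> P" using Q by (auto simp: P_def)
      then show ?thesis using a(3) P by (auto simp: stone_def)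
    qed
    have "P \<in> F"
    proof (rule ccontr)
      assume "P \<notin> F"
      moreover have "openin (spectrum L) (prime_filters L - F)" using cl by (simp add: closedin_def)
      ultimately obtain a where a: "a \<in> carrier L" "P \<in> stone L a" "stone L a \<subseteq> prime_filters L - F"
        using P unfolding openin_spectrum by (meson DiffI)
      then show False by (auto simp: P_def stone_def)
    qed
    then show "\<exists>x\<in>F. \<forall>U. openin (spectrum L) U \<longrightarrow> U \<inter> F \<noteq> {} \<longrightarrow> x \<in> U" using meets by blast
  qed
  show "compact_space (spectrum L)"
    using compactin_stone[OF top_closed] by (simp add: compact_space_def stone_top)
  fix U assume U: "openin (spectrum L) U"
  show "\<exists>\<V>. \<V> \<subseteq> CO (spectrum L) \<and> U = \<Union>\<V>"
  proof (intro exI conjI)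
    show "{V \<in> CO (spectrum L). V \<subseteq> U} \<subseteq> CO (spectrum L)" by blast
    show "U = \<Union>{V \<in> CO (spectrum L). V \<subseteq> U}"
    proof
      show "U \<subseteq> \<Union>{V \<in> CO (spectrum L). V \<subseteq> U}"
      proof
        fix P assume "P \<in> U"
        then obtain a where "a \<in> carrier L" "P \<in> stone L a" "stone L a \<subseteq> U"
          using U unfolding openin_spectrum by meson
        then show "P \<in> \<Union>{V \<in> CO (spectrum L). V \<subseteq> U}" by (auto simp: CO_spectrum)
      qed
    qed blast
  qed
next
  fix U V assume "U \<in> CO (spectrum L)" "V \<in> CO (spectrum L)"
  then obtain a b where ab: "a \<in> carrier L" "b \<in> carrier L" "U = stone L a" "V = stone L b"
    by (auto simp: CO_spectrum)
  then have "U \<inter> V = stone L (a \<sqinter> b)" by (simp add: stone_meet)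
  then show "U \<inter> V \<in> CO (spectrum L)" using ab meet_closed[of a b] by (auto simp: CO_spectrum)
qed

sublocale spectrum: spectral "spectrum L"
  by unfold_locales (rule spectral_space_spectrum)

lemma in_closure_of_prime_filter:
  assumes "Q \<in> prime_filters L"
  shows "P \<in> spectrum L closure_of {Q} \<longleftrightarrow> P \<in> prime_filters L \<and> P \<subseteq> Q"
  unfolding spectrum.in_closure_of_point CO_spectrum topspace_spectrum
  using assms pf_carrier by (auto simp: stone_def)

lemma Sat_spectrum:
  assumes P: "P \<in> prime_filters L"
  shows "Sat (spectrum L) P = {Q \<in> prime_filters L. P \<subseteq> Q}" (is "?L = ?R")
proof
  show "?L \<subseteq> ?R"
  proof
    fix Q assume Q: "Q \<in> ?L"
    have inU: "Q \<in> U" if "openin (spectrum L) U" "P \<in> U" for U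
      using Q that by (auto simp: Sat_def)
    have "a \<in> Q" if "a \<in> P" for a
      using inU[OF openin_stone[OF pf_carrier[OF P that]]] P that by (simp add: stone_def)
    moreover have "Q \<in> prime_filters L" using inU[OF openin_topspace] P by simp
    ultimately show "Q \<in> ?R" by blast
  qed
  show "?R \<subseteq> ?L"
  proof
    fix Q assume Q: "Q \<in> ?R"
    have "Q \<in> U" if U: "openin (spectrum L) U" "P \<in> U" for U
    proof -
      obtain a where "P \<in> stone L a" "stone L a \<subseteq> U" using U unfolding openin_spectrum by meson
      then show ?thesis using Q by (auto simp: stone_def)
    qed
    then show "Q \<in> ?L" by (simp add: Sat_def)
  qed
qed

lemma doubly_spectral_stone_Diff:
  "a \<in> carrier L \<Longrightarrow> b \<in> carrier L \<Longrightarrow> doubly_spectral (spectrum L) (stone L a - stone L b)"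
  by (rule spectrum.doubly_spectral_Diff_CO) (auto simp: CO_spectrum)

text \<open>Additive operators that turn basic differences into complements of basic opens preserve
  doubly spectral sets; both the relational diamond and the closure operator are of this form.\<close>

lemma doubly_spectral_additive_image:
  assumes Y: "doubly_spectral (spectrum L) Y"
    and add: "\<And>\<F>. finite \<F> \<Longrightarrow> (\<And>Z. Z \<in> \<F> \<Longrightarrow> Z \<subseteq> prime_filters L) \<Longrightarrow> h (\<Union>\<F>) = \<Union>(h ` \<F>)"
    and diff: "\<And>a b. a \<in> carrier L \<Longrightarrow> b \<in> carrier L \<Longrightarrow>
        \<exists>c\<in>carrier L. h (stone L a - stone L b) = prime_filters L - stone L c"
  shows "doubly_spectral (spectrum L) (h Y)"
proof -
  obtain I where I: "finite I" "I \<subseteq> CO (spectrum L) \<times> CO (spectrum L)" "Y = (\<Union>(U, V)\<in>I. U - V)"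
    using spectrum.doubly_spectral_finite_Union[OF Y] .
  let ?\<F> = "(\<lambda>(U, V). U - V) ` I"
  have sub: "Z \<subseteq> prime_filters L" if "Z \<in> ?\<F>" for Z
    using that I(2) by (auto simp: CO_spectrum stone_def)
  have "h Y = \<Union>(h ` ?\<F>)" using add[of ?\<F>] I(1,3) sub by simp
  moreover have "doubly_spectral (spectrum L) (h Z)" if Z: "Z \<in> ?\<F>" for Z
  proof -
    obtain a b where ab: "a \<in> carrier L" "b \<in> carrier L" "Z = stone L a - stone L b"
      using Z I(2) by (auto simp: CO_spectrum)
    then obtain c where "c \<in> carrier L" "h Z = stone L \<top> - stone L c"
      using diff[of a b] by (auto simp: stone_top)
    then show ?thesis using doubly_spectral_stone_Diff[OF top_closed] by simp
  qed
  ultimately show ?thesis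
    using spectrum.doubly_spectral_Union[of "h ` ?\<F>"] I(1) by auto
qed

section \<open>Prime filters with prescribed members and non-members\<close>

text \<open>M is the part inherited from a given prime filter (itself or its image under \<nabla>),
  K the elements to be added. Keeping them apart leaves the disjointness hypothesis in the form m
  \<sqinter> k \<le> i, to which a residuation law applies directly.\<close>

lemma prime_filter_extension:
  assumes M: "M \<subseteq> carrier L" "M \<noteq> {}"
    and Mdir: "\<And>m m'. m \<in> M \<Longrightarrow> m' \<in> M \<Longrightarrow> \<exists>m''\<in>M. m'' \<sqsubseteq> m \<and> m'' \<sqsubseteq> m'"
    and K: "K \<subseteq> carrier L" "K \<noteq> {}"
    and Kdir: "\<And>k k'. k \<in> K \<Longrightarrow> k' \<in> K \<Longrightarrow> \<exists>k''\<in>K. k'' \<sqsubseteq> k \<and> k'' \<sqsubseteq> k'"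
    and I: "I \<subseteq> carrier L" "I \<noteq> {}"
    and Idir: "\<And>i i'. i \<in> I \<Longrightarrow> i' \<in> I \<Longrightarrow> \<exists>i''\<in>I. i \<sqsubseteq> i'' \<and> i' \<sqsubseteq> i''"
    and sep: "\<And>m k i. m \<in> M \<Longrightarrow> k \<in> K \<Longrightarrow> i \<in> I \<Longrightarrow> \<not> m \<sqinter> k \<sqsubseteq> i"
  obtains Q where "Q \<in> prime_filters L" "M \<subseteq> Q" "K \<subseteq> Q" "Q \<inter> I = {}"
proof -
  define N where "N = {m \<sqinter> k | m k. m \<in> M \<and> k \<in> K}"
  have N: "N \<subseteq> carrier L" using M K unfolding N_def by (auto intro!: meet_closed)
  obtain Q where Q: "Q \<in> prime_filters L" "N \<subseteq> Q" "Q \<inter> I = {}"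
  proof (rule prime_filter_separation[of N I])
    show "N \<noteq> {}" using M(2) K(2) by (auto simp: N_def)
    show "\<not> n \<sqsubseteq> i" if "n \<in> N" "i \<in> I" for n i using that sep by (auto simp: N_def)
    fix n n' assume "n \<in> N" "n' \<in> N"
    then obtain m k m' k' where mk: "m \<in> M" "k \<in> K" "n = m \<sqinter> k" "m' \<in> M" "k' \<in> K" "n' = m' \<sqinter> k'"
      by (auto simp: N_def)
    obtain m'' where m'': "m'' \<in> M" "m'' \<sqsubseteq> m" "m'' \<sqsubseteq> m'" using Mdir mk by meson
    obtain k'' where k'': "k'' \<in> K" "k'' \<sqsubseteq> k" "k'' \<sqsubseteq> k'" using Kdir mk by meson
    have c: "m \<in> carrier L" "m' \<in> carrier L" "m'' \<in> carrier L"
      "k \<in> carrier L" "k' \<in> carrier L" "k'' \<in> carrier L" using mk m'' k'' M K by blast+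
    have "m'' \<sqinter> k'' \<in> N" using m'' k'' by (auto simp: N_def)
    moreover have "m'' \<sqinter> k'' \<sqsubseteq> n" "m'' \<sqinter> k'' \<sqsubseteq> n'"
      unfolding mk(3,6) by (intro meet_mono m'' k'' c)+
    ultimately show "\<exists>n''\<in>N. n'' \<sqsubseteq> n \<and> n'' \<sqsubseteq> n'" by blast
  qed (use N I Idir in auto)
  have MQ: "m \<in> Q \<and> k \<in> Q" if "m \<in> M" "k \<in> K" for m k
  proof -
    have "m \<sqinter> k \<in> Q" using Q(2) that by (auto simp: N_def)
    then show ?thesis using pf_meet[OF Q(1), of m k] that M K by blast
  qed
  have "M \<subseteq> Q" "K \<subseteq> Q" using MQ M(2) K(2) by blast+
  then show thesis using that Q(1,3) by simp
qed

lemma pf_directed: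
  assumes "P \<in> prime_filters L"
  shows "P \<subseteq> carrier L" "P \<noteq> {}"
    "\<And>m m'. m \<in> P \<Longrightarrow> m' \<in> P \<Longrightarrow> \<exists>m''\<in>P. m'' \<sqsubseteq> m \<and> m'' \<sqsubseteq> m'"
proof -
  show "P \<subseteq> carrier L" "P \<noteq> {}" using pf_carrier[OF assms] pf_top[OF assms] by auto
  fix m m' assume m: "m \<in> P" "m' \<in> P"
  then have "m \<in> carrier L" "m' \<in> carrier L" using pf_carrier[OF assms] by auto
  then show "\<exists>m''\<in>P. m'' \<sqsubseteq> m \<and> m'' \<sqsubseteq> m'"
    using m pf_meet[OF assms] meet_left meet_right by (intro bexI[of _ "m \<sqinter> m'"]) auto
qed

text \<open>The target structure M is free because \<open>h\<close> will be a homomorphism into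
  another algebra as well as \<nabla> or \<box>.\<close>

lemma pf_image_directed:
  assumes P: "P \<in> prime_filters L"
    and mono: "\<And>a b. a \<in> carrier L \<Longrightarrow> b \<in> carrier L \<Longrightarrow> a \<sqsubseteq> b \<Longrightarrow> h a \<sqsubseteq>\<^bsub>M\<^esub> h b"
    and k: "k \<in> h ` P" "k' \<in> h ` P"
  shows "\<exists>k''\<in>h ` P. k'' \<sqsubseteq>\<^bsub>M\<^esub> k \<and> k'' \<sqsubseteq>\<^bsub>M\<^esub> k'"
proof -
  from k obtain p where p: "p \<in> P" "k = h p" by blast
  from k obtain p' where p': "p' \<in> P" "k' = h p'" by blast
  obtain p'' where p'': "p'' \<in> P" "p'' \<sqsubseteq> p" "p'' \<sqsubseteq> p'"
    using pf_directed(3)[OF P p(1) p'(1)] by blast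
  show ?thesis
    by (rule bexI[of _ "h p''"]) (use p p' p'' pf_carrier[OF P] mono in auto)
qed

text \<open>Dual to the previous lemma: primeness makes the complement of P closed under
  joins.\<close>

lemma pf_compl_image_directed:
  assumes P: "P \<in> prime_filters L"
    and mono: "\<And>a b. a \<in> carrier L \<Longrightarrow> b \<in> carrier L \<Longrightarrow> a \<sqsubseteq> b \<Longrightarrow> h a \<sqsubseteq>\<^bsub>M\<^esub> h b"
    and i: "i \<in> h ` (carrier L - P)" "i' \<in> h ` (carrier L - P)"
  shows "\<exists>i''\<in>h ` (carrier L - P). i \<sqsubseteq>\<^bsub>M\<^esub> i'' \<and> i' \<sqsubseteq>\<^bsub>M\<^esub> i''"
proof -
  from i obtain b where b: "b \<in> carrier L" "b \<notin> P" "i = h b" by blast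
  from i obtain b' where b': "b' \<in> carrier L" "b' \<notin> P" "i' = h b'" by blast
  show ?thesis
  proof (rule bexI[of _ "h (b \<squnion> b')"])
    show "i \<sqsubseteq>\<^bsub>M\<^esub> h (b \<squnion> b') \<and> i' \<sqsubseteq>\<^bsub>M\<^esub> h (b \<squnion> b')"
      using b b' by (simp add: mono join_left join_right)
    show "h (b \<squnion> b') \<in> h ` (carrier L - P)"
      using b b' pf_join[OF P] by (intro imageI) simp
  qed
qed

text \<open>If \<open>c\<close> is not in P, then no p in P satisfies p \<sqinter> a \<le> b, since
  that would mean p \<le> c. Hence P extends to a prime filter containing \<open>a\<close> but not
  \<open>b\<close>, and P lies in the closure of this extension.\<close>

lemma closure_of_stone_Diff:
  assumes a: "a \<in> carrier L" and b: "b \<in> carrier L" and c: "is_heyting_imp L a b c"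
  shows "spectrum L closure_of (stone L a - stone L b) = prime_filters L - stone L c"
    (is "?L = ?R")
proof
  have cc: "c \<in> carrier L" and imp: "\<And>x. x \<in> carrier L \<Longrightarrow> x \<sqinter> a \<sqsubseteq> b \<longleftrightarrow> x \<sqsubseteq> c"
    using c by (auto simp: is_heyting_imp_def)
  have "c \<sqinter> a \<sqsubseteq> b" using imp[OF cc] cc by simp
  then have "stone L (c \<sqinter> a) \<subseteq> stone L b" using stone_subset_iff[of "c \<sqinter> a" b] a b cc by simp
  then have "stone L a - stone L b \<subseteq> ?R"
    unfolding stone_meet[OF cc a] by (auto simp: mem_stone)
  moreover have "closedin (spectrum L) (?R)"
    using closedin_diff[OF closedin_topspace openin_stone[OF cc]] by simp
  ultimately show "?L \<subseteq> ?R"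
    by (rule closure_of_minimal)
  show "?R \<subseteq> ?L"
  proof
    fix P assume "P \<in> ?R"
    then have P: "P \<in> prime_filters L" "c \<notin> P" by (auto simp: stone_def)
    obtain Q where Q: "Q \<in> prime_filters L" "P \<subseteq> Q" "{a} \<subseteq> Q" "Q \<inter> {b} = {}"
    proof (rule prime_filter_extension[OF pf_directed[OF P(1)], of "{a}" "{b}"])
      fix m k i assume "m \<in> P" "k \<in> {a}" "i \<in> {b}"
      then show "\<not> m \<sqinter> k \<sqsubseteq> i"
        using imp[of m] pf_carrier[OF P(1)] pf_up[OF P(1) _ cc] P(2) by blast
    qed (use a b in auto)
    have "P \<in> spectrum L closure_of {Q}" using P Q by (simp add: in_closure_of_prime_filter)
    moreover have "Q \<in> stone L a - stone L b" using Q by (auto simp: stone_def)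
    then have "spectrum L closure_of {Q} \<subseteq> ?L"
      by (intro closure_of_mono) simp
    ultimately show "P \<in> ?L" by blast
  qed
qed

lemma heyting_spectral_spectrum:
  assumes "heyting_algebra L"
  shows "heyting_spectral_space (spectrum L)"
  unfolding heyting_spectral_space_def
proof (intro conjI allI impI)
  fix Y assume Y: "doubly_spectral (spectrum L) Y"
  show "doubly_spectral (spectrum L) (spectrum L closure_of Y)"
  proof (rule doubly_spectral_additive_image[OF Y])
    fix \<F> :: "'a set set set" assume "finite \<F>"
    then show "spectrum L closure_of \<Union>\<F> = \<Union>((closure_of) (spectrum L) ` \<F>)"
      by (rule closure_of_Union)
  next
    fix a b assume ab: "a \<in> carrier L" "b \<in> carrier L"
    then obtain c where c: "is_heyting_imp L a b c"
      using assms unfolding heyting_algebra_def by meson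
    then show "\<exists>c\<in>carrier L. spectrum L closure_of (stone L a - stone L b) = prime_filters L - stone L c"
      using closure_of_stone_Diff[OF ab c] by (auto simp: is_heyting_imp_def)
  qed
qed (rule spectral_space_spectrum)

end

section \<open>The space of a nabla-algebra\<close>

locale nabla_lattice = dist_lattice A for A :: "('a, 'm) nabla_alg_scheme" (structure) +
  assumes nabla_algebra: "nabla_algebra A"
begin

lemma nab_closed [simp]: "a \<in> carrier A \<Longrightarrow> nab A a \<in> carrier A"
  using nabla_algebra by (simp add: nabla_algebra_def)

lemma arr_closed [simp]: "a \<in> carrier A \<Longrightarrow> b \<in> carrier A \<Longrightarrow> arr A a b \<in> carrier A"
  using nabla_algebra by (simp add: nabla_algebra_def)

lemma nab_arr:
  "a \<in> carrier A \<Longrightarrow> b \<in> carrier A \<Longrightarrow> c \<in> carrier A \<Longrightarrow> nab A c \<sqinter> a \<sqsubseteq> b \<longleftrightarrow> c \<sqsubseteq> arr A a b"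
  using nabla_algebra by (simp add: nabla_algebra_def)

lemma box_closed [simp]: "a \<in> carrier A \<Longrightarrow> box A a \<in> carrier A"
  by (simp add: box_def)

lemma nab_box: "b \<in> carrier A \<Longrightarrow> c \<in> carrier A \<Longrightarrow> nab A c \<sqsubseteq> b \<longleftrightarrow> c \<sqsubseteq> box A b"
  using nab_arr[of \<top> b c] by (simp add: meet_top_eq box_def)

lemma nab_arr_meet: "a \<in> carrier A \<Longrightarrow> b \<in> carrier A \<Longrightarrow> nab A (arr A a b) \<sqinter> a \<sqsubseteq> b"
  by (simp add: nab_arr)

lemma nab_box_le: "b \<in> carrier A \<Longrightarrow> nab A (box A b) \<sqsubseteq> b"
  by (simp add: nab_box)

lemma le_box_nab: "c \<in> carrier A \<Longrightarrow> c \<sqsubseteq> box A (nab A c)"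
  using nab_box[of "nab A c" c] by simp

lemma nab_mono:
  assumes "a \<in> carrier A" "b \<in> carrier A" "a \<sqsubseteq> b"
  shows "nab A a \<sqsubseteq> nab A b"
proof -
  have "a \<sqsubseteq> box A (nab A b)" by (rule le_trans[OF assms(3) le_box_nab]) (use assms in auto)
  then show ?thesis using nab_box assms by simp
qed

lemma box_mono:
  assumes "a \<in> carrier A" "b \<in> carrier A" "a \<sqsubseteq> b"
  shows "box A a \<sqsubseteq> box A b"
proof -
  have "nab A (box A a) \<sqsubseteq> b" by (rule le_trans[OF nab_box_le assms(3)]) (use assms in auto)
  then show ?thesis using nab_box assms by simp
qed

lemma nab_bottom: "nab A \<bottom> = \<bottom>"
proof (rule le_antisym)
  show "nab A \<bottom> \<sqsubseteq> \<bottom>" by (simp add: nab_box)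
qed auto

text \<open>A left adjoint preserves joins; \<box> is the right adjoint.\<close>

lemma nab_join:
  assumes a: "a \<in> carrier A" and b: "b \<in> carrier A"
  shows "nab A (a \<squnion> b) = nab A a \<squnion> nab A b"
proof (rule le_antisym)
  have "a \<sqsubseteq> box A (nab A a \<squnion> nab A b)" "b \<sqsubseteq> box A (nab A a \<squnion> nab A b)"
    using assms join_left join_right by (simp_all flip: nab_box)
  then have "a \<squnion> b \<sqsubseteq> box A (nab A a \<squnion> nab A b)"
    using assms by (intro join_le) auto
  then show "nab A (a \<squnion> b) \<sqsubseteq> nab A a \<squnion> nab A b" using assms by (simp add: nab_box)
  show "nab A a \<squnion> nab A b \<sqsubseteq> nab A (a \<squnion> b)"
    using assms join_left join_right by (intro join_le nab_mono) auto
qed (use assms in auto)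

text \<open>P has to avoid exactly the elements that \<nabla> sends outside Q. They form an ideal
  because \<nabla> preserves joins and bottom, and monotonicity of \<nabla> keeps K away from
  it.\<close>

lemma prime_filter_nab_preimage:
  assumes Q: "Q \<in> prime_filters A"
    and K: "K \<subseteq> carrier A" "K \<noteq> {}"
    and Kdir: "\<And>k k'. k \<in> K \<Longrightarrow> k' \<in> K \<Longrightarrow> \<exists>k''\<in>K. k'' \<sqsubseteq> k \<and> k'' \<sqsubseteq> k'"
    and nabK: "\<And>k. k \<in> K \<Longrightarrow> nab A k \<in> Q"
  obtains P where "P \<in> prime_filters A" "K \<subseteq> P" "nab A ` P \<subseteq> Q"
proof -
  define I where "I = {b \<in> carrier A. nab A b \<notin> Q}"
  obtain P where P: "P \<in> prime_filters A" "K \<subseteq> P" "P \<inter> I = {}"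
  proof (rule prime_filter_separation[OF K Kdir, of I])
    show "I \<subseteq> carrier A" by (auto simp: I_def)
    have "\<bottom> \<in> I" using pf_bot[OF Q] by (simp add: I_def nab_bottom)
    then show "I \<noteq> {}" by blast
    show "\<exists>i''\<in>I. i \<sqsubseteq> i'' \<and> i' \<sqsubseteq> i''" if "i \<in> I" "i' \<in> I" for i i'
      using that pf_join[OF Q] join_left join_right
      by (intro bexI[of _ "i \<squnion> i'"]) (auto simp: I_def nab_join)
    fix k i assume ki: "k \<in> K" "i \<in> I"
    then have c: "k \<in> carrier A" "i \<in> carrier A" using K by (auto simp: I_def)
    show "\<not> k \<sqsubseteq> i"
      using pf_up[OF Q nabK[OF ki(1)], of "nab A i"] nab_mono[OF c] ki(2) c by (auto simp: I_def)
  qed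
  have "nab A ` P \<subseteq> Q" using P(3) pf_carrier[OF P(1)] by (auto simp: I_def)
  then show thesis using that P by blast
qed

text \<open>By the adjunction, \<nabla>p \<sqinter> k \<le> i means p \<le> k \<rightarrow> i, so
  the disjointness that the extension requires reduces to k \<rightarrow> i staying outside
  P.\<close>

lemma prime_filter_nab_extension:
  assumes P: "P \<in> prime_filters A"
    and K: "K \<subseteq> carrier A" "K \<noteq> {}"
    and Kdir: "\<And>k k'. k \<in> K \<Longrightarrow> k' \<in> K \<Longrightarrow> \<exists>k''\<in>K. k'' \<sqsubseteq> k \<and> k'' \<sqsubseteq> k'"
    and I: "I \<subseteq> carrier A" "I \<noteq> {}"
    and Idir: "\<And>i i'. i \<in> I \<Longrightarrow> i' \<in> I \<Longrightarrow> \<exists>i''\<in>I. i \<sqsubseteq> i'' \<and> i' \<sqsubseteq> i''"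
    and sep: "\<And>k i. k \<in> K \<Longrightarrow> i \<in> I \<Longrightarrow> arr A k i \<notin> P"
  obtains Q where "Q \<in> prime_filters A" "nab A ` P \<subseteq> Q" "K \<subseteq> Q" "Q \<inter> I = {}"
proof (rule prime_filter_extension[of "nab A ` P" K I])
  note c = pf_carrier[OF P]
  show "nab A ` P \<subseteq> carrier A" "nab A ` P \<noteq> {}" using c pf_top[OF P] by auto
  show "\<exists>m''\<in>nab A ` P. m'' \<sqsubseteq> m \<and> m'' \<sqsubseteq> m'" if "m \<in> nab A ` P" "m' \<in> nab A ` P" for m m'
    using pf_image_directed[OF P nab_mono that] .
  fix m k i assume "m \<in> nab A ` P" and ki: "k \<in> K" "i \<in> I"
  then obtain p where p: "p \<in> P" "m = nab A p" by blast
  have kic: "k \<in> carrier A" "i \<in> carrier A" using ki K I by auto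
  show "\<not> m \<sqinter> k \<sqsubseteq> i"
    using nab_arr[OF kic c[OF p(1)]] pf_up[OF P p(1) arr_closed[OF kic]] sep[OF ki] p(2) by blast
qed (use assms that in simp_all)

lemma Top_spec_obj: "Top (spec_obj A) = spectrum A"
proof -
  have "{{P \<in> prime_filters A. a \<in> P} |a. a \<in> carrier A} = stone A ` carrier A"
    by (auto simp: stone_def)
  then show ?thesis by (simp add: spec_obj_def spectrum_def)
qed

lemma pts_spec_obj: "pts (spec_obj A) = prime_filters A"
  by (simp add: Top_spec_obj)

lemma Rel_spec_obj:
  "(P, Q) \<in> Rel (spec_obj A) \<longleftrightarrow> P \<in> prime_filters A \<and> Q \<in> prime_filters A \<and> nab A ` P \<subseteq> Q"
  by (simp add: spec_obj_def)

lemma alpha_eq: "a \<in> carrier A \<Longrightarrow> alpha A a = stone A a"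
  by (simp add: alpha_def stone_def)

lemma nabla_rel_stone:
  assumes a: "a \<in> carrier A"
  shows "nabla_rel (Rel (spec_obj A)) (stone A a) = stone A (nab A a)" (is "?L = ?R")
proof
  show "?L \<subseteq> ?R"
    by (auto simp: nabla_rel_def Rel_spec_obj stone_def)
  show "?R \<subseteq> ?L"
  proof
    fix Q assume "Q \<in> ?R"
    then have Q: "Q \<in> prime_filters A" "nab A a \<in> Q" by (auto simp: stone_def)
    obtain P where "P \<in> prime_filters A" "{a} \<subseteq> P" "nab A ` P \<subseteq> Q"
      by (rule prime_filter_nab_preimage[OF Q(1), of "{a}"]) (use a Q in auto)
    then show "Q \<in> ?L"
      using Q(1) by (auto simp: nabla_rel_def Rel_spec_obj stone_def)
  qed
qed

text \<open>This one computation serves twice: it shows that \<open>alpha\<close> preserves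
  \<rightarrow>, and it makes \<lozenge> an additive operator of the kind that preserves doubly
  spectral sets.\<close>

lemma lozenge_rel_stone_Diff:
  assumes a: "a \<in> carrier A" and b: "b \<in> carrier A"
  shows "lozenge_rel (Rel (spec_obj A)) (stone A a - stone A b) = prime_filters A - stone A (arr A a b)"
    (is "?L = ?R")
proof
  show "?L \<subseteq> ?R"
  proof
    fix P assume "P \<in> ?L"
    then obtain Q where PQ: "P \<in> prime_filters A" "Q \<in> prime_filters A" "nab A ` P \<subseteq> Q" "a \<in> Q" "b \<notin> Q"
      by (auto simp: lozenge_rel_def Rel_spec_obj stone_def)
    have "arr A a b \<notin> P"
    proof
      assume "arr A a b \<in> P"
      then have "nab A (arr A a b) \<sqinter> a \<in> Q" using pf_meet[OF PQ(2)] PQ(3,4) a b by auto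
      then show False using pf_up[OF PQ(2) _ b nab_arr_meet[OF a b]] PQ(5) by simp
    qed
    then show "P \<in> ?R" using PQ(1) by (simp add: stone_def)
  qed
  show "?R \<subseteq> ?L"
  proof
    fix P assume "P \<in> ?R"
    then have P: "P \<in> prime_filters A" "arr A a b \<notin> P" by (auto simp: stone_def)
    obtain Q where "Q \<in> prime_filters A" "nab A ` P \<subseteq> Q" "{a} \<subseteq> Q" "Q \<inter> {b} = {}"
      by (rule prime_filter_nab_extension[OF P(1), of "{a}" "{b}"]) (use a b P(2) in auto)
    then show "P \<in> ?L"
      using P(1) by (auto simp: lozenge_rel_def Rel_spec_obj stone_def)
  qed
qed

lemma arrow_rel_stone:
  assumes "a \<in> carrier A" "b \<in> carrier A"
  shows "arrow_rel (spec_obj A) (stone A a) (stone A b) = stone A (arr A a b)"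
proof -
  have "arrow_rel (spec_obj A) (stone A a) (stone A b) =
      prime_filters A - lozenge_rel (Rel (spec_obj A)) (stone A a - stone A b)"
    unfolding arrow_rel_def lozenge_rel_def pts_spec_obj by blast
  then show ?thesis
    unfolding lozenge_rel_stone_Diff[OF assms] by (auto simp: stone_def)
qed

theorem nabla_spectral_space_spec_obj: "nabla_spectral_space (spec_obj A)"
  unfolding nabla_spectral_space_def Top_spec_obj topspace_spectrum
proof (intro conjI ballI allI impI)
  show "spectral_space (spectrum A)" by (rule spectral_space_spectrum)
  show "Rel (spec_obj A) \<subseteq> prime_filters A \<times> prime_filters A"
    using Rel_spec_obj by auto
  show "nabla_rel (Rel (spec_obj A)) V \<in> CO (spectrum A)" if "V \<in> CO (spectrum A)" for V
    using that by (auto simp: CO_spectrum nabla_rel_stone)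
  show "doubly_spectral (spectrum A) (lozenge_rel (Rel (spec_obj A)) Y)"
    if "doubly_spectral (spectrum A) Y" for Y
  proof (rule doubly_spectral_additive_image[OF that])
    show "lozenge_rel (Rel (spec_obj A)) (\<Union>\<F>) = \<Union>(lozenge_rel (Rel (spec_obj A)) ` \<F>)" for \<F>
      by (auto simp: lozenge_rel_def)
    show "\<exists>c\<in>carrier A. lozenge_rel (Rel (spec_obj A)) (stone A a - stone A b) = prime_filters A - stone A c"
      if "a \<in> carrier A" "b \<in> carrier A" for a b
      by (rule bexI[of _ "arr A a b"]) (use that in \<open>simp_all add: lozenge_rel_stone_Diff\<close>)
  qed
next
  fix P assume P: "P \<in> prime_filters A"
  let ?N = "(\<lambda>a. stone A (nab A a)) ` P" and ?RP = "{Q. (P, Q) \<in> Rel (spec_obj A)}"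
  \<comment> \<open>As an intersection of basic opens, R[P] is saturated; as an intersection of
    patch-closed sets, it is compact.\<close>
  have RP: "?RP = topspace (spectrum A) \<inter> \<Inter>?N"
    using P by (auto simp: Rel_spec_obj stone_def)
  have c: "stone A (nab A a) \<in> CO (spectrum A)" if "a \<in> P" for a
    using pf_carrier[OF P that] by (simp add: CO_spectrum)
  show "saturated_in (spectrum A) ?RP"
    unfolding saturated_in_def
    by (rule exI[of _ "?N"]) (use RP CO_openin[OF c] in auto)
  have "closedin (patch (spectrum A)) (\<Inter>(insert (topspace (spectrum A)) ?N))"
    by (intro closedin_Inter) (use c spectrum.closedin_patch_CO spectrum.CO_topspace in auto)
  then have "closedin (patch (spectrum A)) ?RP"
    unfolding RP by simp
  then show "compactin (spectrum A) ?RP"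
    by (intro spectrum.compactin_patch_imp spectrum.compactin_patch_closed)
next
  fix Q assume Q: "Q \<in> prime_filters A"
  let ?S = "{P. (P, Q) \<in> Rel (spec_obj A)}"
  let ?C = "(\<lambda>P. spectrum A closure_of {P}) ` ?S"
  \<comment> \<open>The predecessors of Q are closed under smaller prime filters, that is, under
    specialization, so they are the union of the closures of their points.\<close>
  have "?S = \<Union>?C"
  proof
    show "?S \<subseteq> \<Union>?C"
      by (auto simp: Rel_spec_obj in_closure_of_prime_filter)
    show "\<Union>?C \<subseteq> ?S"
    proof
      fix P' assume "P' \<in> \<Union>?C"
      then obtain P where P: "(P, Q) \<in> Rel (spec_obj A)" "P' \<in> spectrum A closure_of {P}" by blast
      then have "P' \<in> prime_filters A" "nab A ` P' \<subseteq> nab A ` P"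
        by (auto simp: Rel_spec_obj in_closure_of_prime_filter)
      then show "P' \<in> ?S" using P(1) by (auto simp: Rel_spec_obj)
    qed
  qed
  then show "co_saturated_in (spectrum A) ?S"
    unfolding co_saturated_in_def by (intro exI[of _ "?C"]) auto
qed

text \<open>On an element \<nabla>c, the unit c \<le> \<box>\<nabla>c gives \<nabla>c \<le>
  \<nabla>\<box>\<nabla>c; the other inequality is the counit.\<close>

lemma nab_box_eq:
  assumes "nab A ` carrier A = carrier A" "a \<in> carrier A"
  shows "nab A (box A a) = a"
proof -
  obtain c where c: "c \<in> carrier A" "a = nab A c" using assms by blast
  show ?thesis
    by (rule le_antisym) (use c assms(2) nab_box_le nab_mono[OF c(1) _ le_box_nab[OF c(1)]] in auto)
qed

lemma box_nab_eq:
  assumes "box A ` carrier A = carrier A" "a \<in> carrier A"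
  shows "box A (nab A a) = a"
proof -
  obtain c where c: "c \<in> carrier A" "a = box A c" using assms by blast
  show ?thesis
    by (rule le_antisym) (use c assms(2) le_box_nab box_mono[OF _ c(1) nab_box_le[OF c(1)]] in auto)
qed

lemma space_satisfies_spec_obj:
  assumes "alg_satisfies A c"
  shows "space_satisfies (spec_obj A) c"
proof (cases c)
  case CN
  have top: "nab A \<top> = \<top>"
    and meet: "\<And>a b. a \<in> carrier A \<Longrightarrow> b \<in> carrier A \<Longrightarrow> nab A (a \<sqinter> b) = nab A a \<sqinter> nab A b"
    using assms CN by auto
  \<comment> \<open>Under (N), \<nabla> is a bounded lattice homomorphism, so preimages of prime
    filters under it are prime. The inclusion of \<nabla>[P] in Q then says that P is contained in
    \<pi> Q.\<close>
  define \<pi> where "\<pi> Q = {a \<in> carrier A. nab A a \<in> Q}" for Q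
  have \<pi>: "\<pi> Q \<in> prime_filters A" if Q: "Q \<in> prime_filters A" for Q
  proof (rule prime_filterI)
    show "\<pi> Q \<subseteq> carrier A" "\<top> \<in> \<pi> Q" "\<bottom> \<notin> \<pi> Q"
      using pf_top[OF Q] pf_bot[OF Q] by (auto simp: \<pi>_def top nab_bottom)
    show "b \<in> \<pi> Q" if "a \<in> \<pi> Q" "b \<in> carrier A" "a \<sqsubseteq> b" for a b
      using that pf_up[OF Q, of "nab A a" "nab A b"] nab_mono by (auto simp: \<pi>_def)
    show "a \<sqinter> b \<in> \<pi> Q" if "a \<in> \<pi> Q" "b \<in> \<pi> Q" for a b
      using that pf_meet[OF Q] by (auto simp: \<pi>_def meet)
    show "a \<in> \<pi> Q \<or> b \<in> \<pi> Q" if "a \<in> carrier A" "b \<in> carrier A" "a \<squnion> b \<in> \<pi> Q" for a b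
      using that pf_join[OF Q] by (auto simp: \<pi>_def nab_join)
  qed
  have "continuous_map (spectrum A) (spectrum A) \<pi>"
    unfolding continuous_map_def topspace_spectrum
  proof (intro conjI allI impI)
    show "\<pi> \<in> prime_filters A \<rightarrow> prime_filters A" using \<pi> by blast
    fix U assume U: "openin (spectrum A) U"
    show "openin (spectrum A) {Q \<in> prime_filters A. \<pi> Q \<in> U}"
      unfolding openin_spectrum
    proof
      fix Q assume "Q \<in> {Q \<in> prime_filters A. \<pi> Q \<in> U}"
      then have Q: "Q \<in> prime_filters A" "\<pi> Q \<in> U" by auto
      then obtain a where a: "a \<in> carrier A" "\<pi> Q \<in> stone A a" "stone A a \<subseteq> U"
        using U unfolding openin_spectrum by meson
      show "\<exists>a\<in>carrier A. Q \<in> stone A a \<and> stone A a \<subseteq> {Q \<in> prime_filters A. \<pi> Q \<in> U}"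
      proof (intro bexI conjI)
        show "Q \<in> stone A (nab A a)" using a Q by (simp add: stone_def \<pi>_def)
        show "stone A (nab A a) \<subseteq> {Q \<in> prime_filters A. \<pi> Q \<in> U}"
        proof
          fix R assume "R \<in> stone A (nab A a)"
          then have R: "R \<in> prime_filters A" "nab A a \<in> R" by (auto simp: stone_def)
          then have "\<pi> R \<in> stone A a" using \<pi> a by (simp add: stone_def \<pi>_def)
          then show "R \<in> {Q \<in> prime_filters A. \<pi> Q \<in> U}" using R a(3) by blast
        qed
      qed (use a in simp)
    qed
  qed
  moreover have "(P, Q) \<in> Rel (spec_obj A) \<longleftrightarrow> P \<in> spectrum A closure_of {\<pi> Q}"
    if "P \<in> prime_filters A" "Q \<in> prime_filters A" for P Q
    using that \<pi> pf_carrier[OF that(1)]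
    by (auto simp: Rel_spec_obj in_closure_of_prime_filter \<pi>_def)
  ultimately show ?thesis
    unfolding CN space_satisfies.simps Top_spec_obj topspace_spectrum by blast
next
  case CH
  then show ?thesis using assms heyting_spectral_spectrum by (simp add: Top_spec_obj)
next
  case CR
  have "(P, P) \<in> Rel (spec_obj A)" if P: "P \<in> prime_filters A" for P
  proof -
    have "nab A a \<in> P" if a: "a \<in> P" for a
      using pf_up[OF P a nab_closed] pf_carrier[OF P a] assms CR by simp
    then show ?thesis using P by (auto simp: Rel_spec_obj)
  qed
  then show ?thesis unfolding CR by (simp add: pts_spec_obj)
next
  case CL
  have "P \<in> spectrum A closure_of {Q}" if "(P, Q) \<in> Rel (spec_obj A)" for P Q
  proof -
    have PQ: "P \<in> prime_filters A" "Q \<in> prime_filters A" "nab A ` P \<subseteq> Q"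
      using that by (auto simp: Rel_spec_obj)
    have "a \<in> Q" if "a \<in> P" for a
      using pf_up[OF PQ(2), of "nab A a" a] pf_carrier[OF PQ(1) that] PQ(3) that assms CL by auto
    then show ?thesis using PQ by (auto simp: in_closure_of_prime_filter)
  qed
  then show ?thesis unfolding CL by (auto simp: Top_spec_obj)
next
  case CFa
  then have surj: "nab A ` carrier A = carrier A" using assms by simp
  show ?thesis
    unfolding CFa space_satisfies.simps Top_spec_obj topspace_spectrum
  proof
    fix P assume P: "P \<in> prime_filters A"
    note c = pf_carrier[OF P]
    \<comment> \<open>Q is made to contain \<box>[P]: every successor of Q then contains
      \<nabla>\<box>a = a for all a in P.\<close>
    obtain Q where Q: "Q \<in> prime_filters A" "box A ` P \<subseteq> Q" "nab A ` Q \<subseteq> P"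
    proof (rule prime_filter_nab_preimage[OF P, of "box A ` P"])
      show "box A ` P \<subseteq> carrier A" "box A ` P \<noteq> {}" using c pf_top[OF P] by auto
      show "nab A k \<in> P" if "k \<in> box A ` P" for k using that nab_box_eq[OF surj] c by auto
      show "\<exists>k''\<in>box A ` P. k'' \<sqsubseteq> k \<and> k'' \<sqsubseteq> k'" if "k \<in> box A ` P" "k' \<in> box A ` P" for k k'
        using pf_image_directed[OF P box_mono that] .
    qed
    have "P \<in> spectrum A closure_of {Z}" if "(Q, Z) \<in> Rel (spec_obj A)" for Z
    proof -
      have Z: "Z \<in> prime_filters A" "nab A ` Q \<subseteq> Z" using that by (auto simp: Rel_spec_obj)
      have "a \<in> Z" if a: "a \<in> P" for a
      proof -
        have "nab A (box A a) \<in> Z" using Q(2) Z(2) a by blast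
        then show ?thesis using nab_box_eq[OF surj c[OF a]] by simp
      qed
      then show ?thesis using P Z by (auto simp: in_closure_of_prime_filter)
    qed
    then show "\<exists>Q. (Q, P) \<in> Rel (spec_obj A) \<and> (\<forall>Z. (Q, Z) \<in> Rel (spec_obj A) \<longrightarrow> P \<in> spectrum A closure_of {Z})"
      using P Q by (intro exI[of _ Q]) (simp add: Rel_spec_obj)
  qed
next
  case CFu
  then have surj: "box A ` carrier A = carrier A" using assms by simp
  show ?thesis
    unfolding CFu space_satisfies.simps Top_spec_obj topspace_spectrum
  proof
    fix P assume P: "P \<in> prime_filters A"
    \<comment> \<open>Q avoids \<nabla>b for each b outside P, so all its predecessors lie inside P.
      With K reduced to the top element, the condition to check becomes that \<box>\<nabla>b = b is
      outside P.\<close>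
    obtain Q where Q: "Q \<in> prime_filters A" "nab A ` P \<subseteq> Q" "{\<top>} \<subseteq> Q" "Q \<inter> nab A ` (carrier A - P) = {}"
    proof (rule prime_filter_nab_extension[OF P, of "{\<top>}" "nab A ` (carrier A - P)"])
      show "nab A ` (carrier A - P) \<subseteq> carrier A" by auto
      show "nab A ` (carrier A - P) \<noteq> {}" using pf_bot[OF P] bottom_closed by blast
      show "\<exists>i''\<in>nab A ` (carrier A - P). i \<sqsubseteq> i'' \<and> i' \<sqsubseteq> i''"
        if "i \<in> nab A ` (carrier A - P)" "i' \<in> nab A ` (carrier A - P)" for i i'
        using pf_compl_image_directed[OF P nab_mono that] .
      show "arr A k i \<notin> P" if "k \<in> {\<top>}" "i \<in> nab A ` (carrier A - P)" for k i
        using that box_nab_eq[OF surj] by (auto simp: box_def)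
    qed auto
    have "Z \<in> spectrum A closure_of {P}" if "(Z, Q) \<in> Rel (spec_obj A)" for Z
    proof -
      have Z: "Z \<in> prime_filters A" "nab A ` Z \<subseteq> Q" using that by (auto simp: Rel_spec_obj)
      have "Z \<subseteq> P" using Z(2) Q(4) pf_carrier[OF Z(1)] by blast
      then show ?thesis using P Z by (simp add: in_closure_of_prime_filter)
    qed
    then show "\<exists>Q. (P, Q) \<in> Rel (spec_obj A) \<and> (\<forall>Z. (Z, Q) \<in> Rel (spec_obj A) \<longrightarrow> Z \<in> spectrum A closure_of {P})"
      using P Q by (intro exI[of _ Q]) (simp add: Rel_spec_obj)
  qed
qed

end

section \<open>The algebra of a nabla-spectral space\<close>

context spectral
begin

lemma mem_Sat_iff:
  assumes "x \<in> topspace X"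
  shows "y \<in> Sat X x \<longleftrightarrow> y \<in> topspace X \<and> (\<forall>U\<in>CO X. x \<in> U \<longrightarrow> y \<in> U)"
proof
  assume y: "y \<in> Sat X x"
  have inU: "y \<in> U" if "openin X U" "x \<in> U" for U using y that by (auto simp: Sat_def)
  show "y \<in> topspace X \<and> (\<forall>U\<in>CO X. x \<in> U \<longrightarrow> y \<in> U)"
    using inU[OF openin_topspace assms] inU[OF CO_openin] by blast
next
  assume y: "y \<in> topspace X \<and> (\<forall>U\<in>CO X. x \<in> U \<longrightarrow> y \<in> U)"
  have "y \<in> U" if U: "openin X U" "x \<in> U" for U
  proof -
    obtain V where "V \<in> CO X" "x \<in> V" "V \<subseteq> U" using CO_base[OF U] by blast
    then show ?thesis using y by blast
  qed
  then show "y \<in> Sat X x" by (simp add: Sat_def)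
qed

lemma Sat_closure_of:
  "x \<in> topspace X \<Longrightarrow> y \<in> topspace X \<Longrightarrow> y \<in> Sat X x \<longleftrightarrow> x \<in> X closure_of {y}"
  by (simp add: mem_Sat_iff in_closure_of_point)

text \<open>A point of the closure is a specialization of an actual point of Y. Otherwise the
  compact open neighbourhoods of x have no common point in Y, and by patch compactness finitely many
  of them already form a neighbourhood of x disjoint from Y.\<close>

lemma closure_of_doubly_spectral:
  assumes Y: "doubly_spectral X Y" and x: "x \<in> X closure_of Y"
  shows "Sat X x \<inter> Y \<noteq> {}"
proof
  assume e: "Sat X x \<inter> Y = {}"
  have xX: "x \<in> topspace X" using x by (simp add: in_closure_of)
  let ?K = "{U \<in> CO X. x \<in> U}"
  have "Y \<inter> \<Inter>?K = {}"
    using e doubly_spectral_subset[OF Y] by (auto simp: mem_Sat_iff[OF xX] disjoint_iff)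
  moreover have "closedin (patch X) Y" using Y by (simp add: doubly_spectral_iff_patch_clopen)
  ultimately obtain \<G> where \<G>: "finite \<G>" "\<G> \<subseteq> ?K" "Y \<inter> \<Inter>\<G> = {}"
    using patch_closed_Inter_CO[of Y ?K] by blast
  have "openin X (\<Inter>(insert (topspace X) \<G>))"
    using \<G> by (intro openin_Inter_CO) auto
  moreover have "x \<in> \<Inter>(insert (topspace X) \<G>)" using \<G> xX by auto
  ultimately have "\<exists>y. y \<in> Y \<and> y \<in> \<Inter>(insert (topspace X) \<G>)"
    using x unfolding in_closure_of by blast
  then show False using \<G>(3) by auto
qed

end

locale nabla_spectral =
  fixes S :: "'x nabla_space"
  assumes nabla_spectral_space: "nabla_spectral_space S"
begin

sublocale spectral "Top S"
  by unfold_locales (use nabla_spectral_space in \<open>simp add: nabla_spectral_space_def\<close>)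

lemma Rel_pts: "(x, y) \<in> Rel S \<Longrightarrow> x \<in> pts S \<and> y \<in> pts S"
  using nabla_spectral_space unfolding nabla_spectral_space_def by blast

lemma compactin_Rel: "x \<in> pts S \<Longrightarrow> compactin (Top S) {y. (x, y) \<in> Rel S}"
  using nabla_spectral_space by (simp add: nabla_spectral_space_def)

lemma saturated_Rel: "x \<in> pts S \<Longrightarrow> saturated_in (Top S) {y. (x, y) \<in> Rel S}"
  using nabla_spectral_space by (simp add: nabla_spectral_space_def)

lemma nabla_rel_CO: "V \<in> CO (Top S) \<Longrightarrow> nabla_rel (Rel S) V \<in> CO (Top S)"
  using nabla_spectral_space by (simp add: nabla_spectral_space_def)

text \<open>Co-saturation of the predecessor sets, read as closure under specialization.\<close>

lemma Rel_closure_left: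
  assumes "(x, y) \<in> Rel S" "x' \<in> Top S closure_of {x}"
  shows "(x', y) \<in> Rel S"
proof -
  have "co_saturated_in (Top S) {x. (x, y) \<in> Rel S}"
    using nabla_spectral_space Rel_pts[OF assms(1)] by (simp add: nabla_spectral_space_def)
  then obtain \<F> where \<F>: "\<forall>F\<in>\<F>. closedin (Top S) F" "{x. (x, y) \<in> Rel S} = \<Union>\<F>"
    unfolding co_saturated_in_def by meson
  then obtain F where F: "F \<in> \<F>" "x \<in> F" using assms(1) by blast
  then have "Top S closure_of {x} \<subseteq> F" using \<F>(1) by (simp add: closure_of_minimal)
  then show ?thesis using F \<F>(2) assms(2) by blast
qed

text \<open>The complement \<lozenge>(U - V) is doubly spectral by assumption and closed under
  specialization because R is so in its first argument; hence the set itself is closed under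
  generalization.\<close>

lemma arrow_rel_CO:
  assumes "U \<in> CO (Top S)" "V \<in> CO (Top S)"
  shows "arrow_rel S U V \<in> CO (Top S)"
proof -
  have eq: "arrow_rel S U V = pts S - lozenge_rel (Rel S) (U - V)"
    unfolding arrow_rel_def lozenge_rel_def by blast
  have "doubly_spectral (Top S) (lozenge_rel (Rel S) (U - V))"
    using nabla_spectral_space doubly_spectral_Diff_CO[OF assms]
    unfolding nabla_spectral_space_def by blast
  then have "doubly_spectral (Top S) (arrow_rel S U V)"
    unfolding eq by (rule doubly_spectral_compl)
  then show ?thesis
  proof (rule doubly_spectral_generalization_closed_CO)
    fix x y assume x: "x \<in> arrow_rel S U V" and y: "y \<in> pts S" "x \<in> Top S closure_of {y}"
    have "x \<in> lozenge_rel (Rel S) (U - V)" if yl: "y \<in> lozenge_rel (Rel S) (U - V)"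
    proof -
      obtain z where "z \<in> U - V" "(y, z) \<in> Rel S" using yl by (auto simp: lozenge_rel_def)
      then show ?thesis using Rel_closure_left[OF _ y(2)] by (auto simp: lozenge_rel_def)
    qed
    then show "y \<in> arrow_rel S U V" using x y(1) unfolding eq by blast
  qed
qed

lemma nabla_rel_arrow_rel:
  "W \<subseteq> pts S \<Longrightarrow> nabla_rel (Rel S) W \<inter> U \<subseteq> V \<longleftrightarrow> W \<subseteq> arrow_rel S U V"
  unfolding nabla_rel_def arrow_rel_def by blast

lemma Rel_iff_CO:
  assumes x: "x \<in> pts S" and y: "y \<in> pts S"
  shows "(x, y) \<in> Rel S \<longleftrightarrow> (\<forall>U\<in>CO (Top S). x \<in> U \<longrightarrow> y \<in> nabla_rel (Rel S) U)"
proof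
  assume "(x, y) \<in> Rel S"
  then show "\<forall>U\<in>CO (Top S). x \<in> U \<longrightarrow> y \<in> nabla_rel (Rel S) U" by (auto simp: nabla_rel_def)
next
  assume all: "\<forall>U\<in>CO (Top S). x \<in> U \<longrightarrow> y \<in> nabla_rel (Rel S) U"
  show "(x, y) \<in> Rel S"
  proof (rule ccontr)
    assume n: "(x, y) \<notin> Rel S"
    obtain \<U> where \<U>: "\<forall>U\<in>\<U>. openin (Top S) U" "{y. (x, y) \<in> Rel S} = pts S \<inter> \<Inter>\<U>"
      using saturated_Rel[OF x] unfolding saturated_in_def by meson
    have "y \<notin> {y. (x, y) \<in> Rel S}" using n by simp
    then obtain G where "G \<in> \<U>" and yG: "y \<notin> G" using y unfolding \<U>(2) by blast
    then have G: "openin (Top S) G" "{y. (x, y) \<in> Rel S} \<subseteq> G" using \<U>(1) unfolding \<U>(2) by auto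
    obtain W where W: "W \<in> CO (Top S)" "{y. (x, y) \<in> Rel S} \<subseteq> W" "W \<subseteq> G"
      using CO_cover[OF compactin_Rel[OF x] G(2,1)] .
    let ?U = "arrow_rel S (pts S) W"
    have U: "?U \<in> CO (Top S)" by (rule arrow_rel_CO[OF CO_topspace W(1)])
    have "x \<in> ?U" using x W(2) by (auto simp: arrow_rel_def)
    then have "y \<in> nabla_rel (Rel S) ?U" using all U by blast
    moreover have "nabla_rel (Rel S) ?U \<inter> pts S \<subseteq> W"
      using nabla_rel_arrow_rel[OF CO_subset[OF U]] by blast
    ultimately show False using y W(3) yG by blast
  qed
qed

end

locale CO_nabla = nabla_spectral S + CO_lattice "Top S" A
  for S :: "'x nabla_space" and A :: "('x set, 'm) nabla_alg_scheme" +
  assumes nab_A: "nab A = nabla_rel (Rel S)" and arr_A: "arr A = arrow_rel S"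
begin

lemma nabla_algebra_CO: "nabla_algebra A"
  unfolding nabla_algebra_def carrier_L nab_A arr_A le_L
proof (intro conjI ballI)
  show "Lattice.bounded_lattice A" by (rule bounded_lattice_CO)
  fix U V W assume "U \<in> CO (Top S)" "V \<in> CO (Top S)" "W \<in> CO (Top S)"
  then show "nabla_rel (Rel S) W \<sqinter>\<^bsub>A\<^esub> U \<subseteq> V \<longleftrightarrow> W \<subseteq> arrow_rel S U V"
    using nabla_rel_arrow_rel[of W U V] CO_subset[of W "Top S"] by (simp add: meet_CO nabla_rel_CO)
qed (auto intro: nabla_rel_CO arrow_rel_CO)

sublocale nabla_lattice A
  by unfold_locales (rule nabla_algebra_CO)

text \<open>An open W misses the closure of U - V as soon as it misses U - V itself, which says that
  W \<inter> U is contained in V. The Heyting condition on the space makes the complement of this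
  closure compact.\<close>

lemma is_heyting_imp_CO:
  assumes H: "heyting_spectral_space (Top S)" and U: "U \<in> CO (Top S)" and V: "V \<in> CO (Top S)"
  shows "is_heyting_imp A U V (pts S - Top S closure_of (U - V))"
  unfolding is_heyting_imp_def
proof
  let ?Z = "pts S - Top S closure_of (U - V)"
  have "doubly_spectral (Top S) (Top S closure_of (U - V))"
    using H doubly_spectral_Diff_CO[OF U V] unfolding heyting_spectral_space_def by blast
  then have "doubly_spectral (Top S) ?Z" by (rule doubly_spectral_compl)
  moreover have "openin (Top S) ?Z" by (intro openin_diff) auto
  ultimately show "?Z \<in> carrier A" unfolding carrier_L by (rule doubly_spectral_openin_CO)
  show "\<forall>W\<in>carrier A. W \<sqinter>\<^bsub>A\<^esub> U \<sqsubseteq>\<^bsub>A\<^esub> V \<longleftrightarrow> W \<sqsubseteq>\<^bsub>A\<^esub> ?Z"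
  proof
    fix W assume "W \<in> carrier A"
    then have W: "W \<in> CO (Top S)" by (simp add: carrier_L)
    have "U - V \<subseteq> Top S closure_of (U - V)" using CO_subset[OF U] by (intro closure_of_subset) blast
    moreover have "W \<inter> Top S closure_of (U - V) = {}" if "W \<inter> (U - V) = {}"
      using openin_Int_closure_of_eq_empty[OF CO_openin[OF W]] that by blast
    ultimately have "W \<inter> U \<subseteq> V \<longleftrightarrow> W \<subseteq> ?Z" using CO_subset[OF W] by blast
    then show "W \<sqinter>\<^bsub>A\<^esub> U \<sqsubseteq>\<^bsub>A\<^esub> V \<longleftrightarrow> W \<sqsubseteq>\<^bsub>A\<^esub> ?Z" using W U by (simp add: meet_CO le_L)
  qed
qed

lemma heyting_algebra_CO:
  assumes "heyting_spectral_space (Top S)"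
  shows "heyting_algebra A"
  unfolding heyting_algebra_def
  using bounded_lattice_CO is_heyting_imp_CO[OF assms] carrier_L by blast

lemma alg_satisfies_CO:
  assumes "space_satisfies S c"
  shows "alg_satisfies A c"
proof (cases c)
  case CN
  then obtain \<pi> where \<pi>: "continuous_map (Top S) (Top S) \<pi>"
    and R: "\<And>x y. x \<in> pts S \<Longrightarrow> y \<in> pts S \<Longrightarrow> (x, y) \<in> Rel S \<longleftrightarrow> x \<in> Top S closure_of {\<pi> y}"
    using assms by auto
  have \<pi>_pts: "\<pi> y \<in> pts S" if "y \<in> pts S" for y
    using \<pi> that by (auto simp: continuous_map_def)
  \<comment> \<open>Under (N), \<nabla> is taking preimages along \<pi>, which commutes with
    intersections.\<close>
  have nab: "nabla_rel (Rel S) U = {y \<in> pts S. \<pi> y \<in> U}" if U: "U \<in> CO (Top S)" for U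
  proof
    show "nabla_rel (Rel S) U \<subseteq> {y \<in> pts S. \<pi> y \<in> U}"
    proof
      fix y assume "y \<in> nabla_rel (Rel S) U"
      then obtain x where x: "x \<in> U" "(x, y) \<in> Rel S" by (auto simp: nabla_rel_def)
      then have "x \<in> pts S" "y \<in> pts S" using Rel_pts by auto
      then have "x \<in> Top S closure_of {\<pi> y}" using R x(2) by simp
      then show "y \<in> {y \<in> pts S. \<pi> y \<in> U}"
        using closure_of_point_open[OF _ CO_openin[OF U] x(1)] \<open>y \<in> pts S\<close> by simp
    qed
    show "{y \<in> pts S. \<pi> y \<in> U} \<subseteq> nabla_rel (Rel S) U"
    proof
      fix y assume "y \<in> {y \<in> pts S. \<pi> y \<in> U}"
      then have y: "y \<in> pts S" "\<pi> y \<in> U" by auto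
      then have "(\<pi> y, y) \<in> Rel S" 
        using R[OF \<pi>_pts y(1)] point_in_closure_of[OF \<pi>_pts] by simp
      then show "y \<in> nabla_rel (Rel S) U" using y(2) by (auto simp: nabla_rel_def)
    qed
  qed
  show ?thesis
    unfolding CN alg_satisfies.simps carrier_L nab_A top_CO
  proof (intro conjI ballI)
    show "nabla_rel (Rel S) (pts S) = pts S" using \<pi>_pts by (auto simp: nab[OF CO_topspace])
    fix U V assume UV: "U \<in> CO (Top S)" "V \<in> CO (Top S)"
    have "nabla_rel (Rel S) (U \<inter> V) = nabla_rel (Rel S) U \<inter> nabla_rel (Rel S) V"
      unfolding nab[OF UV(1)] nab[OF UV(2)] nab[OF CO_Int[OF UV]] by blast
    then show "nabla_rel (Rel S) (U \<sqinter>\<^bsub>A\<^esub> V) = nabla_rel (Rel S) U \<sqinter>\<^bsub>A\<^esub> nabla_rel (Rel S) V"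
      using UV by (simp add: meet_CO nabla_rel_CO)
  qed
next
  case CH
  then show ?thesis using assms heyting_algebra_CO by simp
next
  case CR
  then show ?thesis using assms CO_subset
    by (fastforce simp: carrier_L le_L nab_A nabla_rel_def)
next
  case CL
  show ?thesis unfolding CL alg_satisfies.simps carrier_L le_L nab_A
  proof (intro ballI subsetI)
    fix U y assume U: "U \<in> CO (Top S)" and "y \<in> nabla_rel (Rel S) U"
    then obtain x where "x \<in> U" "(x, y) \<in> Rel S" by (auto simp: nabla_rel_def)
    moreover have "x \<in> Top S closure_of {y}" using assms CL \<open>(x, y) \<in> Rel S\<close> by auto
    ultimately show "y \<in> U" using closure_of_point_open CO_openin[OF U] by metis
  qed
next
  case CFa
  have fa: "\<exists>y. (y, x) \<in> Rel S \<and> (\<forall>z. (y, z) \<in> Rel S \<longrightarrow> x \<in> Top S closure_of {z})" if "x \<in> pts S" for x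
    using assms CFa that by simp
  have "U \<in> nab A ` carrier A" if U: "U \<in> CO (Top S)" for U
  proof
    show "box A U \<in> carrier A" using U box_closed[of U] by (simp add: carrier_L)
    \<comment> \<open>For x in U, condition (Fa) gives a predecessor y of x all of whose successors
      generalize x and so lie in the open set U; thus y is in \<box>U.\<close>
    have Ub: "U \<subseteq> nab A (box A U)"
    proof
      fix x assume x: "x \<in> U"
      then obtain y where y: "(y, x) \<in> Rel S" "\<And>z. (y, z) \<in> Rel S \<Longrightarrow> x \<in> Top S closure_of {z}"
        using fa CO_subset[OF U] by blast
      have "z \<in> U" if "(y, z) \<in> Rel S" for z
        using closure_of_point_open[OF y(2)[OF that] CO_openin[OF U] x] .
      then have "y \<in> box A U" using Rel_pts[OF y(1)] by (auto simp: box_def arr_A top_CO arrow_rel_def)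
      then show "x \<in> nab A (box A U)" using y(1) by (auto simp: nab_A nabla_rel_def)
    qed
    have "nab A (box A U) \<subseteq> U" using nab_box_le[of U] U by (simp add: carrier_L le_L)
    then show "U = nab A (box A U)" using Ub by blast
  qed
  then show ?thesis unfolding CFa by (auto simp: carrier_L nab_A nabla_rel_CO)
next
  case CFu
  have fu: "\<exists>y. (x, y) \<in> Rel S \<and> (\<forall>z. (z, y) \<in> Rel S \<longrightarrow> z \<in> Top S closure_of {x})" if "x \<in> pts S" for x
    using assms CFu that by simp
  have "U \<in> box A ` carrier A" if U: "U \<in> CO (Top S)" for U
  proof
    show "nab A U \<in> carrier A" using U nab_closed[of U] by (simp add: carrier_L)
    \<comment> \<open>For x in \<box>\<nabla>U, condition (Fu) gives a successor y of x all of whose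
      predecessors are specializations of x. As y is in \<nabla>U, one of these predecessors lies in
      U, and then so does x.\<close>
    have bU: "box A (nab A U) \<subseteq> U"
    proof
      fix x assume x: "x \<in> box A (nab A U)"
      then have xp: "x \<in> pts S" by (auto simp: box_def arr_A arrow_rel_def)
      then obtain y where y: "(x, y) \<in> Rel S" "\<And>z. (z, y) \<in> Rel S \<Longrightarrow> z \<in> Top S closure_of {x}"
        using fu by blast
      have "y \<in> nab A U" using x y(1) Rel_pts[OF y(1)] by (auto simp: box_def arr_A top_CO arrow_rel_def)
      then obtain z where z: "z \<in> U" "(z, y) \<in> Rel S" by (auto simp: nab_A nabla_rel_def)
      show "x \<in> U" using closure_of_point_open[OF y(2)[OF z(2)] CO_openin[OF U] z(1)] .
    qed
    have "U \<subseteq> box A (nab A U)" using le_box_nab[of U] U by (simp add: carrier_L le_L)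
    then show "U = box A (nab A U)" using bU by blast
  qed
  moreover have "box A ` carrier A \<subseteq> carrier A" by auto
  ultimately show ?thesis unfolding CFu alg_satisfies.simps using carrier_L by blast
qed

lemma beta_prime_filter: "x \<in> pts S \<Longrightarrow> beta S x \<in> prime_filters A"
  using CO_point_prime_filter by (simp add: beta_def)

text \<open>Injectivity is T0; surjectivity says that every prime filter of compact opens is that of
  a point.\<close>

lemma bij_betw_beta: "bij_betw (beta S) (pts S) (prime_filters A)"
proof (rule bij_betw_imageI)
  show "inj_on (beta S) (pts S)"
  proof (rule inj_onI)
    fix x y assume xy: "x \<in> pts S" "y \<in> pts S" "beta S x = beta S y"
    show "x = y"
    proof (rule T0)
      fix U assume "U \<in> CO (Top S)"
      then show "x \<in> U \<longleftrightarrow> y \<in> U" using xy by (auto simp: beta_def)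
    qed (use xy in auto)
  qed
  show "beta S ` pts S = prime_filters A"
  proof
    show "beta S ` pts S \<subseteq> prime_filters A" using beta_prime_filter by blast
    show "prime_filters A \<subseteq> beta S ` pts S"
    proof
      fix P assume "P \<in> prime_filters A"
      then obtain x where "x \<in> pts S" "P = {U \<in> CO (Top S). x \<in> U}" by (rule CO_prime_filter_point)
      then show "P \<in> beta S ` pts S" by (auto simp: beta_def)
    qed
  qed
qed

lemma beta_vimage_stone: "U \<in> CO (Top S) \<Longrightarrow> {x \<in> pts S. beta S x \<in> stone A U} = U"
  using beta_prime_filter CO_subset[of U "Top S"] by (auto simp: stone_def beta_def)

lemma beta_image_CO:
  assumes "U \<in> CO (Top S)" shows "beta S ` U = stone A U"
proof
  show "beta S ` U \<subseteq> stone A U"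
    using beta_vimage_stone[OF assms] by blast
  show "stone A U \<subseteq> beta S ` U"
  proof
    fix P assume P: "P \<in> stone A U"
    then have "P \<in> prime_filters A" by (simp add: stone_def)
    then obtain x where x: "x \<in> pts S" "P = beta S x"
      using bij_betw_imp_surj_on[OF bij_betw_beta] by blast
    then have "x \<in> U" using P beta_vimage_stone[OF assms] by blast
    then show "P \<in> beta S ` U" using x by blast
  qed
qed

text \<open>By \<open>Rel_iff_CO\<close>, the relation between points is the inclusion of
  \<nabla>[\<beta> x] in \<beta> y.\<close>

lemma Rel_beta_iff:
  assumes "x \<in> pts S" "y \<in> pts S"
  shows "(beta S x, beta S y) \<in> Rel (spec_obj A) \<longleftrightarrow> (x, y) \<in> Rel S"
  unfolding Rel_spec_obj Rel_iff_CO[OF assms]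
  using assms beta_prime_filter nabla_rel_CO by (auto simp: beta_def nab_A)

end

section \<open>Morphisms\<close>

lemma is_heyting_imp_unique:
  assumes "partial_order L" "is_heyting_imp L a b c" "is_heyting_imp L a b d"
  shows "c = d"
proof -
  interpret partial_order L by (rule assms(1))
  have c: "c \<in> carrier L" "d \<in> carrier L" using assms by (auto simp: is_heyting_imp_def)
  moreover have "c \<sqsubseteq>\<^bsub>L\<^esub> d" "d \<sqsubseteq>\<^bsub>L\<^esub> c"
    using assms(2,3) c le_refl unfolding is_heyting_imp_def by metis+
  ultimately show ?thesis by (intro le_antisym)
qed

lemma (in nabla_lattice) alg_hom_id: "(\<lambda>a\<in>carrier A. a) \<in> alg_hom A A"
  by (simp add: alg_hom_def)

lemma alg_hom_comp:
  assumes "nabla_lattice A" and f: "f \<in> alg_hom A B" and g: "g \<in> alg_hom B D"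
  shows "compose (carrier A) g f \<in> alg_hom A D"
proof -
  interpret nabla_lattice A by fact
  have [simp]: "f a \<in> carrier B" if "a \<in> carrier A" for a using f that by (auto simp: alg_hom_def)
  have [simp]: "g b \<in> carrier D" if "b \<in> carrier B" for b using g that by (auto simp: alg_hom_def)
  show ?thesis using f g by (auto simp: alg_hom_def compose_def)
qed

locale alg_morphism = A: nabla_lattice A + B: nabla_lattice B
  for A :: "('a, 'm) nabla_alg_scheme" and B :: "('b, 'n) nabla_alg_scheme" +
  fixes f :: "'a \<Rightarrow> 'b"
  assumes hom: "f \<in> alg_hom A B"
begin

lemma hom_closed [simp]: "a \<in> carrier A \<Longrightarrow> f a \<in> carrier B"
  using hom by (auto simp: alg_hom_def)

lemma hom_top: "f \<top>\<^bsub>A\<^esub> = \<top>\<^bsub>B\<^esub>" and hom_bottom: "f \<bottom>\<^bsub>A\<^esub> = \<bottom>\<^bsub>B\<^esub>"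
  and hom_nab: "a \<in> carrier A \<Longrightarrow> f (nab A a) = nab B (f a)"
  and hom_meet: "a \<in> carrier A \<Longrightarrow> b \<in> carrier A \<Longrightarrow> f (a \<sqinter>\<^bsub>A\<^esub> b) = f a \<sqinter>\<^bsub>B\<^esub> f b"
  and hom_join: "a \<in> carrier A \<Longrightarrow> b \<in> carrier A \<Longrightarrow> f (a \<squnion>\<^bsub>A\<^esub> b) = f a \<squnion>\<^bsub>B\<^esub> f b"
  and hom_arr: "a \<in> carrier A \<Longrightarrow> b \<in> carrier A \<Longrightarrow> f (arr A a b) = arr B (f a) (f b)"
  using hom by (auto simp: alg_hom_def)

lemma hom_mono:
  assumes "a \<in> carrier A" "b \<in> carrier A" "a \<sqsubseteq>\<^bsub>A\<^esub> b"
  shows "f a \<sqsubseteq>\<^bsub>B\<^esub> f b"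
proof -
  have "a = a \<sqinter>\<^bsub>A\<^esub> b" using assms A.le_iff_join by simp
  then have "f a = f a \<sqinter>\<^bsub>B\<^esub> f b" using hom_meet[OF assms(1,2)] by simp
  then show ?thesis using B.le_iff_join assms by simp
qed

lemma prime_filter_vimage:
  assumes Q: "Q \<in> prime_filters B"
  shows "{a \<in> carrier A. f a \<in> Q} \<in> prime_filters A" (is "?P \<in> _")
proof (rule A.prime_filterI)
  show "\<top>\<^bsub>A\<^esub> \<in> ?P" "\<bottom>\<^bsub>A\<^esub> \<notin> ?P"
    using B.pf_top[OF Q] B.pf_bot[OF Q] by (auto simp: hom_top hom_bottom)
  show "b \<in> ?P"
    if "a \<in> ?P" "b \<in> carrier A" "a \<sqsubseteq>\<^bsub>A\<^esub> b" for a b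
    using that B.pf_up[OF Q, of "f a" "f b"] hom_mono by simp
  show "a \<sqinter>\<^bsub>A\<^esub> b \<in> ?P"
    if "a \<in> ?P" "b \<in> ?P" for a b
    using that B.pf_meet[OF Q] by (simp add: hom_meet)
  show "a \<in> ?P \<or> b \<in> ?P"
    if "a \<in> carrier A" "b \<in> carrier A" "a \<squnion>\<^bsub>A\<^esub> b \<in> ?P" for a b
    using that B.pf_join[OF Q] by (simp add: hom_join)
qed auto

lemma spec_mor_apply: "Q \<in> prime_filters B \<Longrightarrow> spec_mor A B f Q = {a \<in> carrier A. f a \<in> Q}"
  by (simp add: spec_mor_def)

lemma spec_mor_closed: "Q \<in> prime_filters B \<Longrightarrow> spec_mor A B f Q \<in> prime_filters A"
  using prime_filter_vimage by (simp add: spec_mor_apply)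

lemma spec_mor_vimage_stone:
  "a \<in> carrier A \<Longrightarrow> {Q \<in> prime_filters B. spec_mor A B f Q \<in> stone A a} = stone B (f a)"
  using spec_mor_closed by (auto simp: stone_def spec_mor_apply)

lemma hom_image_directed:
  assumes P: "P \<in> prime_filters A"
  shows "f ` P \<subseteq> carrier B" "f ` P \<noteq> {}"
    "\<And>k k'. k \<in> f ` P \<Longrightarrow> k' \<in> f ` P \<Longrightarrow> \<exists>k''\<in>f ` P. k'' \<sqsubseteq>\<^bsub>B\<^esub> k \<and> k'' \<sqsubseteq>\<^bsub>B\<^esub> k'"
proof -
  note c = A.pf_carrier[OF P]
  show "f ` P \<subseteq> carrier B" "f ` P \<noteq> {}" using c A.pf_top[OF P] by auto
  show "\<exists>k''\<in>f ` P. k'' \<sqsubseteq>\<^bsub>B\<^esub> k \<and> k'' \<sqsubseteq>\<^bsub>B\<^esub> k'" if "k \<in> f ` P" "k' \<in> f ` P" for k k'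
    using A.pf_image_directed[OF P hom_mono that] .
qed

lemma hom_image_compl_directed:
  assumes P: "P \<in> prime_filters A"
  shows "f ` (carrier A - P) \<subseteq> carrier B" "f ` (carrier A - P) \<noteq> {}"
    "\<And>i i'. i \<in> f ` (carrier A - P) \<Longrightarrow> i' \<in> f ` (carrier A - P) \<Longrightarrow>
      \<exists>i''\<in>f ` (carrier A - P). i \<sqsubseteq>\<^bsub>B\<^esub> i'' \<and> i' \<sqsubseteq>\<^bsub>B\<^esub> i''"
proof -
  show "f ` (carrier A - P) \<subseteq> carrier B" by auto
  show "f ` (carrier A - P) \<noteq> {}" using A.pf_bot[OF P] A.bottom_closed by blast
  show "\<exists>i''\<in>f ` (carrier A - P). i \<sqsubseteq>\<^bsub>B\<^esub> i'' \<and> i' \<sqsubseteq>\<^bsub>B\<^esub> i''"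
    if "i \<in> f ` (carrier A - P)" "i' \<in> f ` (carrier A - P)" for i i'
    using A.pf_compl_image_directed[OF P hom_mono that] .
qed

text \<open>An exact preimage is prescribed by elements to contain and elements to avoid, which is
  the form the extension lemmas can realise.\<close>

lemma spec_mor_eqI:
  assumes P: "P \<in> prime_filters A" and Q: "Q \<in> prime_filters B"
    and "f ` P \<subseteq> Q" "Q \<inter> f ` (carrier A - P) = {}"
  shows "spec_mor A B f Q = P"
  unfolding spec_mor_apply[OF Q] using assms(3,4) A.pf_carrier[OF P] by blast

end

lemma spectral_mapI:
  assumes X: "spectral_space X" and Y: "spectral_space Y" and f: "f \<in> topspace X \<rightarrow> topspace Y"
    and CO: "\<And>V. V \<in> CO Y \<Longrightarrow> {x \<in> topspace X. f x \<in> V} \<in> CO X"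
  shows "spectral_map X Y f"
proof -
  interpret Y: spectral Y by unfold_locales (rule Y)
  have "continuous_map X Y f"
    unfolding continuous_map_def
  proof (intro conjI allI impI)
    fix U assume U: "openin Y U"
    show "openin X {x \<in> topspace X. f x \<in> U}"
    proof (subst openin_subopen, intro ballI)
      fix x assume x: "x \<in> {x \<in> topspace X. f x \<in> U}"
      then obtain V where V: "V \<in> CO Y" "f x \<in> V" "V \<subseteq> U" using Y.CO_base[OF U, of "f x"] by blast
      show "\<exists>T. openin X T \<and> x \<in> T \<and> T \<subseteq> {x \<in> topspace X. f x \<in> U}"
        by (rule exI[of _ "{x \<in> topspace X. f x \<in> V}"]) (use x V CO_openin[OF CO[OF V(1)]] in auto)
    qed
  qed (rule f)
  then show ?thesis using X Y CO by (simp add: spectral_map_def)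
qed

context alg_morphism
begin

lemma spectral_map_spec_mor: "spectral_map (spectrum B) (spectrum A) (spec_mor A B f)"
proof (rule spectral_mapI)
  show "spec_mor A B f \<in> topspace (spectrum B) \<rightarrow> topspace (spectrum A)" using spec_mor_closed by auto
  fix V assume "V \<in> CO (spectrum A)"
  then obtain a where a: "a \<in> carrier A" "V = stone A a" by (auto simp: A.CO_spectrum)
  then show "{Q \<in> topspace (spectrum B). spec_mor A B f Q \<in> V} \<in> CO (spectrum B)"
    by (simp add: spec_mor_vimage_stone B.CO_spectrum)
qed (rule B.spectral_space_spectrum A.spectral_space_spectrum)+

theorem spec_mor_spec_hom: "spec_mor A B f \<in> spec_hom (spec_obj B) (spec_obj A)"
  unfolding spec_hom_def A.Top_spec_obj B.Top_spec_obj A.topspace_spectrum B.topspace_spectrum mem_Collect_eq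
proof (intro conjI ballI allI impI)
  show "spec_mor A B f \<in> prime_filters B \<rightarrow>\<^sub>E prime_filters A"
    using spec_mor_closed by (auto simp: spec_mor_def)
  show "spectral_map (spectrum B) (spectrum A) (spec_mor A B f)" by (rule spectral_map_spec_mor)
  show "(spec_mor A B f P, spec_mor A B f Q) \<in> Rel (spec_obj A)" if "(P, Q) \<in> Rel (spec_obj B)" for P Q
    using that spec_mor_closed by (auto simp: A.Rel_spec_obj B.Rel_spec_obj spec_mor_apply hom_nab)
next
  fix P Q' assume P: "P \<in> prime_filters B" and "(spec_mor A B f P, Q') \<in> Rel (spec_obj A)"
  then have Q': "Q' \<in> prime_filters A" and R: "\<And>a. a \<in> carrier A \<Longrightarrow> f a \<in> P \<Longrightarrow> nab A a \<in> Q'"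
    by (auto simp: A.Rel_spec_obj spec_mor_apply)
  obtain Q where Q: "Q \<in> prime_filters B" "nab B ` P \<subseteq> Q" "f ` Q' \<subseteq> Q" "Q \<inter> f ` (carrier A - Q') = {}"
  \<comment> \<open>Disjointness is pulled back to the source algebra: if f q \<rightarrow> f c,
    which is f (q \<rightarrow> c), were in P, then \<nabla>(q \<rightarrow> c) and q would both be
    in Q', and with them c.\<close>
  proof (rule B.prime_filter_nab_extension[OF P hom_image_directed[OF Q'] hom_image_compl_directed[OF Q']])
    fix k i assume "k \<in> f ` Q'" "i \<in> f ` (carrier A - Q')"
    then obtain q c where q: "q \<in> Q'" "k = f q" and c: "c \<in> carrier A" "c \<notin> Q'" "i = f c" by blast
    have qc: "q \<in> carrier A" using A.pf_carrier[OF Q' q(1)] .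
    show "arr B k i \<notin> P"
    proof
      assume "arr B k i \<in> P"
      then have "f (arr A q c) \<in> P" using q c qc by (simp add: hom_arr)
      then have "nab A (arr A q c) \<in> Q'" using R qc c by simp
      then have "nab A (arr A q c) \<sqinter>\<^bsub>A\<^esub> q \<in> Q'" using A.pf_meet[OF Q'] q qc c by simp
      then show False using A.pf_up[OF Q' _ c(1) A.nab_arr_meet[OF qc c(1)]] c(2) by simp
    qed
  qed
  have "spec_mor A B f Q = Q'" by (rule spec_mor_eqI[OF Q' Q(1,3,4)])
  then show "\<exists>Q. (P, Q) \<in> Rel (spec_obj B) \<and> spec_mor A B f Q = Q'"
    using P Q by (intro exI[of _ Q]) (simp add: B.Rel_spec_obj)
next
  fix Q P' assume Q: "Q \<in> prime_filters B" and "(P', spec_mor A B f Q) \<in> Rel (spec_obj A)"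
  then have P': "P' \<in> prime_filters A" and R: "\<And>a. a \<in> P' \<Longrightarrow> f (nab A a) \<in> Q"
    by (auto simp: A.Rel_spec_obj spec_mor_apply)
  obtain P where P: "P \<in> prime_filters B" "f ` P' \<subseteq> P" "nab B ` P \<subseteq> Q"
  \<comment> \<open>Containing f[P'] places P' inside the preimage of P, hence in the closure of
    that preimage, which is what this clause asks for.\<close>
  proof (rule B.prime_filter_nab_preimage[OF Q hom_image_directed[OF P']])
    show "nab B k \<in> Q" if "k \<in> f ` P'" for k using that R A.pf_carrier[OF P'] by (auto simp: hom_nab)
  qed
  have "P' \<subseteq> spec_mor A B f P" using P A.pf_carrier[OF P'] by (auto simp: spec_mor_apply)
  then have "P' \<in> spectrum A closure_of {spec_mor A B f P}"
    using P' spec_mor_closed[OF P(1)] by (simp add: A.in_closure_of_prime_filter)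
  then show "\<exists>P. (P, Q) \<in> Rel (spec_obj B) \<and> P' \<in> spectrum A closure_of {spec_mor A B f P}"
    using P Q by (intro exI[of _ P]) (simp add: B.Rel_spec_obj)
qed

text \<open>\<open>Sat\<close> of a prime filter is the set of its prime extensions, so a prime Q'
  above the preimage of P must be lifted to one above P. If p \<sqinter> f q \<le> f c with p in P,
  then f (q \<supset> c) is in P, which forces c into Q'. Preservation of implications is stated
  existentially so that the lemma does not mention the field \<open>himp\<close>.\<close>

lemma heyting_spectral_map_spec_mor:
  assumes "heyting_algebra A" "heyting_algebra B"
    and imp: "\<And>a b. a \<in> carrier A \<Longrightarrow> b \<in> carrier A \<Longrightarrow>
      \<exists>c. is_heyting_imp A a b c \<and> is_heyting_imp B (f a) (f b) (f c)"
  shows "heyting_spectral_map (spectrum B) (spectrum A) (spec_mor A B f)"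
  unfolding heyting_spectral_map_def
proof (intro conjI ballI)
  show "heyting_spectral_space (spectrum B)" "heyting_spectral_space (spectrum A)"
    using assms A.heyting_spectral_spectrum B.heyting_spectral_spectrum by auto
  show "spectral_map (spectrum B) (spectrum A) (spec_mor A B f)" by (rule spectral_map_spec_mor)
  fix P assume "P \<in> topspace (spectrum B)"
  then have P: "P \<in> prime_filters B" by simp
  show "spec_mor A B f ` Sat (spectrum B) P = Sat (spectrum A) (spec_mor A B f P)"
    unfolding B.Sat_spectrum[OF P] A.Sat_spectrum[OF spec_mor_closed[OF P]]
  proof
    show "spec_mor A B f ` {Q \<in> prime_filters B. P \<subseteq> Q} \<subseteq> {Q \<in> prime_filters A. spec_mor A B f P \<subseteq> Q}"
      using P spec_mor_closed by (auto simp: spec_mor_apply)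
    show "{Q \<in> prime_filters A. spec_mor A B f P \<subseteq> Q} \<subseteq> spec_mor A B f ` {Q \<in> prime_filters B. P \<subseteq> Q}"
    proof
      fix Q' assume "Q' \<in> {Q \<in> prime_filters A. spec_mor A B f P \<subseteq> Q}"
      then have Q': "Q' \<in> prime_filters A" and PQ': "\<And>a. a \<in> carrier A \<Longrightarrow> f a \<in> P \<Longrightarrow> a \<in> Q'"
        using P by (auto simp: spec_mor_apply)
      obtain Q where Q: "Q \<in> prime_filters B" "P \<subseteq> Q" "f ` Q' \<subseteq> Q" "Q \<inter> f ` (carrier A - Q') = {}"
      proof (rule B.prime_filter_extension[OF B.pf_directed[OF P] hom_image_directed[OF Q'] hom_image_compl_directed[OF Q']])
        fix m k i assume m: "m \<in> P" and "k \<in> f ` Q'" "i \<in> f ` (carrier A - Q')"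
        then obtain q c where q: "q \<in> Q'" "k = f q" and c: "c \<in> carrier A" "c \<notin> Q'" "i = f c" by blast
        have qc: "q \<in> carrier A" using A.pf_carrier[OF Q' q(1)] .
        obtain d where d: "is_heyting_imp A q c d" "is_heyting_imp B (f q) (f c) (f d)"
          using imp[OF qc c(1)] by blast
        have dA: "d \<in> carrier A" using d(1) by (simp add: is_heyting_imp_def)
        show "\<not> m \<sqinter>\<^bsub>B\<^esub> k \<sqsubseteq>\<^bsub>B\<^esub> i"
        proof
          assume "m \<sqinter>\<^bsub>B\<^esub> k \<sqsubseteq>\<^bsub>B\<^esub> i"
          then have "m \<sqsubseteq>\<^bsub>B\<^esub> f d" using d(2) q c B.pf_carrier[OF P m] by (simp add: is_heyting_imp_def)
          then have "f d \<in> P" using B.pf_up[OF P m] dA by simp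
          then have "d \<in> Q'" using PQ' dA by simp
          then have "d \<sqinter>\<^bsub>A\<^esub> q \<in> Q'" using A.pf_meet[OF Q' dA qc] q by simp
          moreover have "d \<sqinter>\<^bsub>A\<^esub> q \<sqsubseteq>\<^bsub>A\<^esub> c" using d(1) dA by (simp add: is_heyting_imp_def)
          ultimately show False using A.pf_up[OF Q' _ c(1)] c(2) by simp
        qed
      qed
      have "spec_mor A B f Q = Q'" by (rule spec_mor_eqI[OF Q' Q(1,3,4)])
      then show "Q' \<in> spec_mor A B f ` {Q \<in> prime_filters B. P \<subseteq> Q}" using Q by blast
    qed
  qed
qed

lemma hom_reflects_le:
  assumes inj: "inj_on f (carrier A)" and a: "a \<in> carrier A" and b: "b \<in> carrier A"
  shows "f a \<sqsubseteq>\<^bsub>B\<^esub> f b \<longleftrightarrow> a \<sqsubseteq>\<^bsub>A\<^esub> b"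
proof
  assume "f a \<sqsubseteq>\<^bsub>B\<^esub> f b"
  then have "f a = f a \<sqinter>\<^bsub>B\<^esub> f b" using B.le_iff_join a b by simp
  then have "f a = f (a \<sqinter>\<^bsub>A\<^esub> b)" using a b by (simp add: hom_meet)
  then have "a = a \<sqinter>\<^bsub>A\<^esub> b" using inj a b by (simp add: inj_on_eq_iff)
  then show "a \<sqsubseteq>\<^bsub>A\<^esub> b" using A.le_iff_join a b by simp
qed (rule hom_mono[OF a b])

lemma bij_hom_is_heyting_imp:
  assumes bij: "bij_betw f (carrier A) (carrier B)"
    and a: "a \<in> carrier A" and b: "b \<in> carrier A" and c: "is_heyting_imp A a b c"
  shows "is_heyting_imp B (f a) (f b) (f c)"
  unfolding is_heyting_imp_def
proof
  have cA: "c \<in> carrier A" using c by (simp add: is_heyting_imp_def)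
  then show "f c \<in> carrier B" by simp
  show "\<forall>y\<in>carrier B. y \<sqinter>\<^bsub>B\<^esub> f a \<sqsubseteq>\<^bsub>B\<^esub> f b \<longleftrightarrow> y \<sqsubseteq>\<^bsub>B\<^esub> f c"
  proof
    fix y assume "y \<in> carrier B"
    then obtain x where x: "x \<in> carrier A" "y = f x" using bij by (auto simp: bij_betw_def)
    note le = hom_reflects_le[OF bij_betw_imp_inj_on[OF bij]]
    have "x \<sqinter>\<^bsub>A\<^esub> a \<sqsubseteq>\<^bsub>A\<^esub> b \<longleftrightarrow> x \<sqsubseteq>\<^bsub>A\<^esub> c" using c x(1) by (simp add: is_heyting_imp_def)
    then show "y \<sqinter>\<^bsub>B\<^esub> f a \<sqsubseteq>\<^bsub>B\<^esub> f b \<longleftrightarrow> y \<sqsubseteq>\<^bsub>B\<^esub> f c"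
      using x a b cA by (simp add: le flip: hom_meet)
  qed
qed

lemma bij_hom_inverse:
  assumes bij: "bij_betw f (carrier A) (carrier B)"
  shows "restrict (inv_into (carrier A) f) (carrier B) \<in> alg_hom B A"
proof -
  let ?g = "inv_into (carrier A) f"
  have g: "?g b \<in> carrier A" "f (?g b) = b" if "b \<in> carrier B" for b
    using bij that by (auto simp: bij_betw_def inv_into_into f_inv_into_f)
  have gf: "?g (f a) = a" if "a \<in> carrier A" for a
    using bij that by (simp add: bij_betw_def)
  have "?g \<top>\<^bsub>B\<^esub> = \<top>\<^bsub>A\<^esub>" "?g \<bottom>\<^bsub>B\<^esub> = \<bottom>\<^bsub>A\<^esub>"
    using gf[OF A.top_closed] gf[OF A.bottom_closed] by (simp_all add: hom_top hom_bottom)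
  moreover have "?g (nab B b) = nab A (?g b)" if "b \<in> carrier B" for b
    using gf[of "nab A (?g b)"] g[OF that] by (simp add: hom_nab)
  moreover have "?g (b \<sqinter>\<^bsub>B\<^esub> d) = ?g b \<sqinter>\<^bsub>A\<^esub> ?g d" "?g (b \<squnion>\<^bsub>B\<^esub> d) = ?g b \<squnion>\<^bsub>A\<^esub> ?g d"
    "?g (arr B b d) = arr A (?g b) (?g d)" if "b \<in> carrier B" "d \<in> carrier B" for b d
    using gf[of "?g b \<sqinter>\<^bsub>A\<^esub> ?g d"] gf[of "?g b \<squnion>\<^bsub>A\<^esub> ?g d"] gf[of "arr A (?g b) (?g d)"]
      g[OF that(1)] g[OF that(2)] by (simp_all add: hom_meet hom_join hom_arr)
  ultimately show ?thesis using g by (simp add: alg_hom_def)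
qed

end

section \<open>Isomorphisms and composition of nabla-spectral maps\<close>

lemma iso_arrowI:
  assumes "f \<in> F" "bij_betw f A B" "restrict (inv_into A f) B \<in> G"
  shows "iso_arrow F G A B f"
  unfolding iso_arrow_def
proof (intro conjI bexI)
  show "compose A (restrict (inv_into A f) B) f = (\<lambda>x\<in>A. x)"
    using assms(2) by (auto simp: compose_def bij_betw_def intro!: restrict_ext)
  show "compose B f (restrict (inv_into A f) B) = (\<lambda>y\<in>B. y)"
    using assms(2) by (auto simp: compose_def bij_betw_def f_inv_into_f intro!: restrict_ext)
qed (use assms in auto)

lemma spec_hom_id:
  assumes "nabla_spectral_space S"
  shows "(\<lambda>x\<in>pts S. x) \<in> spec_hom S S"
proof -
  interpret nabla_spectral S by unfold_locales fact
  have "{x \<in> pts S. (\<lambda>x\<in>pts S. x) x \<in> V} = V" if "V \<in> CO (Top S)" for V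
    using CO_subset[OF that] by auto
  then have "spectral_map (Top S) (Top S) (\<lambda>x\<in>pts S. x)"
    by (intro spectral_mapI spectral) auto
  moreover have "\<exists>z. (z, x) \<in> Rel S \<and> y \<in> Top S closure_of {(\<lambda>x\<in>pts S. x) z}" if "(y, x) \<in> Rel S" for x y
    by (rule exI[of _ y]) (use that Rel_pts[OF that] in \<open>simp add: point_in_closure_of\<close>)
  moreover have "\<exists>z. (x, z) \<in> Rel S \<and> (\<lambda>x\<in>pts S. x) z = y" if "(x, y) \<in> Rel S" for x y
    by (rule exI[of _ y]) (use that Rel_pts[OF that] in simp)
  ultimately show ?thesis using Rel_pts by (auto simp: spec_hom_def)
qed

lemma spec_hom_pts: "f \<in> spec_hom S T \<Longrightarrow> x \<in> pts S \<Longrightarrow> f x \<in> pts T"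
  and spec_hom_CO: "f \<in> spec_hom S T \<Longrightarrow> V \<in> CO (Top T) \<Longrightarrow> {x \<in> pts S. f x \<in> V} \<in> CO (Top S)"
  and spec_hom_Rel: "f \<in> spec_hom S T \<Longrightarrow> (x, z) \<in> Rel S \<Longrightarrow> (f x, f z) \<in> Rel T"
  by (auto simp: spec_hom_def spectral_map_def)

lemma spec_hom_comp:
  assumes S: "nabla_spectral_space S" and T: "nabla_spectral_space T" and W: "nabla_spectral_space W"
    and f: "f \<in> spec_hom S T" and g: "g \<in> spec_hom T W"
  shows "compose (pts S) g f \<in> spec_hom S W"
proof -
  interpret S: nabla_spectral S by unfold_locales fact
  interpret T: nabla_spectral T by unfold_locales fact
  interpret W: nabla_spectral W by unfold_locales fact
  note fp = spec_hom_pts[OF f] and gp = spec_hom_pts[OF g] and fCO = spec_hom_CO[OF f]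
    and gCO = spec_hom_CO[OF g] and fR = spec_hom_Rel[OF f] and gR = spec_hom_Rel[OF g]
  let ?h = "compose (pts S) g f"
  have h: "?h x = g (f x)" if "x \<in> pts S" for x using that by (simp add: compose_def)
  have sp: "spectral_map (Top S) (Top W) ?h"
  proof (rule spectral_mapI)
    show "?h \<in> pts S \<rightarrow> pts W" using h fp gp by auto
    fix V assume "V \<in> CO (Top W)"
    then have "{x \<in> pts S. f x \<in> {y \<in> pts T. g y \<in> V}} \<in> CO (Top S)" by (intro fCO gCO)
    moreover have "{x \<in> pts S. f x \<in> {y \<in> pts T. g y \<in> V}} = {x \<in> pts S. ?h x \<in> V}"
      using h fp by auto
    ultimately show "{x \<in> pts S. ?h x \<in> V} \<in> CO (Top S)" by simp
  qed (rule S.spectral W.spectral)+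
  have R: "(?h x, ?h z) \<in> Rel W" if "(x, z) \<in> Rel S" for x z
    using gR[OF fR[OF that]] S.Rel_pts[OF that] h by simp
  have cond2: "\<exists>z. (x, z) \<in> Rel S \<and> ?h z = y" if x: "x \<in> pts S" and "(?h x, y) \<in> Rel W" for x y
  proof -
    have "(g (f x), y) \<in> Rel W" using that h by simp
    then obtain z where z: "(f x, z) \<in> Rel T" "g z = y" using g fp[OF x] unfolding spec_hom_def by blast
    then obtain w where w: "(x, w) \<in> Rel S" "f w = z" using f x unfolding spec_hom_def by blast
    show ?thesis by (rule exI[of _ w]) (use w z S.Rel_pts[OF w(1)] h in simp)
  qed
  have cond3: "\<exists>z. (z, x) \<in> Rel S \<and> y \<in> Top W closure_of {?h z}" if x: "x \<in> pts S" and "(y, ?h x) \<in> Rel W" for x y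
  proof -
    have "(y, g (f x)) \<in> Rel W" using that h by simp
    then obtain z where z: "(z, f x) \<in> Rel T" "y \<in> Top W closure_of {g z}"
      using g fp[OF x] unfolding spec_hom_def by blast
    then obtain w where w: "(w, x) \<in> Rel S" "z \<in> Top T closure_of {f w}"
      using f x unfolding spec_hom_def by blast
    have wp: "w \<in> pts S" using S.Rel_pts[OF w(1)] by simp
    \<comment> \<open>The backward clauses give only y in the closure of g z and z in the closure of
      f w. Continuity of g moves the second to the closure of g (f w), and specialization is
      transitive.\<close>
    have "y \<in> Top W closure_of {g (f w)}"
      unfolding W.in_closure_of_point
    proof (intro conjI ballI impI)
      show "y \<in> pts W" using z(2) W.in_closure_of_point by blast
      fix U assume U: "U \<in> CO (Top W)" "y \<in> U"
      then have "g z \<in> U" using z(2) W.in_closure_of_point by blast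
      then have "z \<in> {x \<in> pts T. g x \<in> U}" using T.Rel_pts[OF z(1)] by simp
      then have "f w \<in> {x \<in> pts T. g x \<in> U}"
        by (rule closure_of_point_open[OF w(2) CO_openin[OF gCO[OF U(1)]]])
      then show "g (f w) \<in> U" by simp
    qed
    then show ?thesis using w wp h by (intro exI[of _ w]) simp
  qed
  have "?h \<in> pts S \<rightarrow>\<^sub>E pts W" using h fp gp by (auto simp: compose_def)
  then show ?thesis unfolding spec_hom_def using sp R cond2 cond3 by blast
qed

text \<open>For a bijection that reflects the relation, both lifting clauses hold with the preimage
  of \<open>y\<close> as witness; in the backward one \<open>y\<close> is then equal to
  \<open>f z\<close>.\<close>

lemma spec_hom_isoI:
  assumes S: "nabla_spectral_space S" and T: "nabla_spectral_space T"
    and f: "f \<in> pts S \<rightarrow>\<^sub>E pts T" and bij: "bij_betw f (pts S) (pts T)"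
    and CO: "\<And>V. V \<in> CO (Top T) \<Longrightarrow> {x \<in> pts S. f x \<in> V} \<in> CO (Top S)"
    and R: "\<And>x y. x \<in> pts S \<Longrightarrow> y \<in> pts S \<Longrightarrow> (f x, f y) \<in> Rel T \<longleftrightarrow> (x, y) \<in> Rel S"
  shows "f \<in> spec_hom S T"
proof -
  interpret S: nabla_spectral S by unfold_locales fact
  interpret T: nabla_spectral T by unfold_locales fact
  have "spectral_map (Top S) (Top T) f"
    by (rule spectral_mapI[OF S.spectral T.spectral _ CO]) (use f in auto)
  moreover have surj: "\<exists>z\<in>pts S. f z = y" if "y \<in> pts T" for y
    using bij_betw_imp_surj_on[OF bij] that by (metis imageE)
  moreover have "\<exists>z. (x, z) \<in> Rel S \<and> f z = y" if "x \<in> pts S" "(f x, y) \<in> Rel T" for x y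
  proof -
    have "y \<in> pts T" using T.Rel_pts[OF that(2)] by simp
    then obtain z where z: "z \<in> pts S" "f z = y" using surj by blast
    then show ?thesis using R[OF that(1) z(1)] that(2) by (intro exI[of _ z]) simp
  qed
  moreover have "\<exists>z. (z, x) \<in> Rel S \<and> y \<in> Top T closure_of {f z}" if "x \<in> pts S" "(y, f x) \<in> Rel T" for x y
  proof -
    have y: "y \<in> pts T" using T.Rel_pts[OF that(2)] by simp
    then obtain z where z: "z \<in> pts S" "f z = y" using surj by blast
    then show ?thesis using R[OF z(1) that(1)] that(2) y
      by (intro exI[of _ z]) (simp add: point_in_closure_of)
  qed
  moreover have "(f x, f z) \<in> Rel T" if "(x, z) \<in> Rel S" for x z
    using R S.Rel_pts[OF that] that by simp
  ultimately show ?thesis unfolding spec_hom_def using f by blast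
qed

lemma spec_hom_iso_inverse:
  assumes S: "nabla_spectral_space S" and T: "nabla_spectral_space T"
    and bij: "bij_betw f (pts S) (pts T)"
    and CO: "\<And>U. U \<in> CO (Top S) \<Longrightarrow> f ` U \<in> CO (Top T)"
    and R: "\<And>x y. x \<in> pts S \<Longrightarrow> y \<in> pts S \<Longrightarrow> (f x, f y) \<in> Rel T \<longleftrightarrow> (x, y) \<in> Rel S"
  shows "restrict (inv_into (pts S) f) (pts T) \<in> spec_hom T S"
proof (rule spec_hom_isoI[OF T S])
  let ?g = "restrict (inv_into (pts S) f) (pts T)"
  have g: "?g y \<in> pts S" "f (?g y) = y" if "y \<in> pts T" for y
    using bij that by (auto simp: bij_betw_def inv_into_into f_inv_into_f)
  have gf: "?g (f x) = x" if "x \<in> pts S" for x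
    using bij that by (auto simp: bij_betw_def)
  show "?g \<in> pts T \<rightarrow>\<^sub>E pts S" using g by auto
  show "bij_betw ?g (pts T) (pts S)" using bij_betw_inv_into[OF bij] by simp
  show "(?g x, ?g y) \<in> Rel S \<longleftrightarrow> (x, y) \<in> Rel T" if "x \<in> pts T" "y \<in> pts T" for x y
    using R[OF g(1)[OF that(1)] g(1)[OF that(2)]] g(2) that by simp
  fix U assume U: "U \<in> CO (Top S)"
  have "{y \<in> pts T. ?g y \<in> U} = f ` U"
  proof
    show "{y \<in> pts T. ?g y \<in> U} \<subseteq> f ` U" using g(2) by force
    show "f ` U \<subseteq> {y \<in> pts T. ?g y \<in> U}"
    proof
      fix y assume "y \<in> f ` U"
      then obtain x where x: "x \<in> U" "y = f x" by blast
      then have "x \<in> pts S" using CO_subset[OF U] by blast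
      then show "y \<in> {y \<in> pts T. ?g y \<in> U}" using x gf bij_betwE[OF bij] by simp
    qed
  qed
  show "{y \<in> pts T. ?g y \<in> U} \<in> CO (Top T)" using CO[OF U] \<open>{y \<in> pts T. ?g y \<in> U} = f ` U\<close> by simp
qed

section \<open>Preimage maps between algebras of compact opens\<close>

text \<open>Preservation of the relation gives one inclusion for each operation. The converse
  inclusion for \<nabla> is the backward lifting clause, where a point in a closure suffices because
  V is open; for \<rightarrow> it is the forward clause.\<close>

lemma alg_mor_alg_hom:
  assumes "CO_nabla S A" "CO_nabla T B" and f: "f \<in> spec_hom S T"
  shows "alg_mor S T f \<in> alg_hom B A"
proof -
  let ?f = "\<lambda>V. {x \<in> pts S. f x \<in> V}"
  interpret A: CO_nabla S A by fact
  interpret B: CO_nabla T B by fact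
  note fp = spec_hom_pts[OF f] and fCO = spec_hom_CO[OF f] and fR = spec_hom_Rel[OF f]
  have h: "alg_mor S T f V = ?f V" if "V \<in> CO (Top T)" for V
    using that by (simp add: alg_mor_def)
  have nab: "?f (nabla_rel (Rel T) V) = nabla_rel (Rel S) (?f V)"
    if V: "V \<in> CO (Top T)" for V
  proof
    show "?f (nabla_rel (Rel T) V) \<subseteq> nabla_rel (Rel S) (?f V)"
    proof
      fix x assume "x \<in> ?f (nabla_rel (Rel T) V)"
      then obtain y where x: "x \<in> pts S" and y: "y \<in> V" "(y, f x) \<in> Rel T" by (auto simp: nabla_rel_def)
      then obtain z where z: "(z, x) \<in> Rel S" "y \<in> Top T closure_of {f z}"
        using f unfolding spec_hom_def by blast
      have "f z \<in> V" using closure_of_point_open[OF z(2) CO_openin[OF V] y(1)] .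
      then show "x \<in> nabla_rel (Rel S) (?f V)"
        using z(1) A.Rel_pts[OF z(1)] by (auto simp: nabla_rel_def)
    qed
    show "nabla_rel (Rel S) (?f V) \<subseteq> ?f (nabla_rel (Rel T) V)"
    proof
      fix x assume "x \<in> nabla_rel (Rel S) (?f V)"
      then obtain z where z: "f z \<in> V" "(z, x) \<in> Rel S" by (auto simp: nabla_rel_def)
      then have "(f z, f x) \<in> Rel T" "x \<in> pts S" using fR A.Rel_pts by auto
      then show "x \<in> ?f (nabla_rel (Rel T) V)" using z(1) by (auto simp: nabla_rel_def)
    qed
  qed
  have arr: "?f (arrow_rel T U V) = arrow_rel S (?f U) (?f V)" for U V
  proof
    show "?f (arrow_rel T U V) \<subseteq> arrow_rel S (?f U) (?f V)"
      using fR by (auto simp: arrow_rel_def)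
    show "arrow_rel S (?f U) (?f V) \<subseteq> ?f (arrow_rel T U V)"
    proof
      fix x assume "x \<in> arrow_rel S (?f U) (?f V)"
      then have x: "x \<in> pts S" "\<And>z. (x, z) \<in> Rel S \<Longrightarrow> z \<in> pts S \<Longrightarrow> f z \<in> U \<Longrightarrow> f z \<in> V"
        by (auto simp: arrow_rel_def)
      have "y \<in> V" if y: "(f x, y) \<in> Rel T" "y \<in> U" for y
      proof -
        obtain z where z: "(x, z) \<in> Rel S" "f z = y" using f x(1) y(1) unfolding spec_hom_def by blast
        then show ?thesis using x(2)[OF z(1)] A.Rel_pts[OF z(1)] y(2) by simp
      qed
      then show "x \<in> ?f (arrow_rel T U V)" using x(1) fp by (auto simp: arrow_rel_def)
    qed
  qed
  have [simp]: "alg_mor S T f \<in> CO (Top T) \<rightarrow>\<^sub>E CO (Top S)" using h fCO by (auto simp: alg_mor_def)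
  show ?thesis
    unfolding alg_hom_def mem_Collect_eq A.carrier_L B.carrier_L A.top_CO B.top_CO A.bottom_CO B.bottom_CO
      A.nab_A B.nab_A A.arr_A B.arr_A
  proof (intro conjI ballI)
    show "alg_mor S T f (pts T) = pts S" "alg_mor S T f {} = {}"
      using fp by (auto simp: h B.CO_topspace CO_empty)
    fix U assume U: "U \<in> CO (Top T)"
    then show "alg_mor S T f (nabla_rel (Rel T) U) = nabla_rel (Rel S) (alg_mor S T f U)"
      using nab by (simp add: h B.nabla_rel_CO)
    fix V assume V: "V \<in> CO (Top T)"
    show "alg_mor S T f (arrow_rel T U V) = arrow_rel S (alg_mor S T f U) (alg_mor S T f V)"
      using U V arr by (simp add: h B.arrow_rel_CO)
    show "alg_mor S T f (U \<sqinter>\<^bsub>B\<^esub> V) = alg_mor S T f U \<sqinter>\<^bsub>A\<^esub> alg_mor S T f V"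
      using U V fCO by (auto simp: h B.meet_CO A.meet_CO B.CO_Int)
    show "alg_mor S T f (U \<squnion>\<^bsub>B\<^esub> V) = alg_mor S T f U \<squnion>\<^bsub>A\<^esub> alg_mor S T f V"
      using U V fCO by (auto simp: h B.join_CO A.join_CO CO_Un)
  qed simp
qed

text \<open>One inclusion is continuity. For the other, a point f x in the closure of U - V has a
  generalization y in U - V, and the condition on \<open>Sat\<close> lifts y to a generalization z
  of x; then x lies in the closure of z.\<close>

lemma alg_mor_closure_of_Diff:
  assumes f: "heyting_spectral_map (Top S) (Top T) f"
    and U: "U \<in> CO (Top T)" and V: "V \<in> CO (Top T)"
  shows "{x \<in> pts S. f x \<in> pts T - Top T closure_of (U - V)} =
    pts S - Top S closure_of ({x \<in> pts S. f x \<in> U} - {x \<in> pts S. f x \<in> V})"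
proof -
  interpret S: spectral "Top S"
    by unfold_locales (use f in \<open>simp add: heyting_spectral_map_def spectral_map_def\<close>)
  interpret T: spectral "Top T"
    by unfold_locales (use f in \<open>simp add: heyting_spectral_map_def spectral_map_def\<close>)
  let ?W = "{x \<in> pts S. f x \<in> U} - {x \<in> pts S. f x \<in> V}"
  have cont: "continuous_map (Top S) (Top T) f"
    and sat: "\<And>x. x \<in> pts S \<Longrightarrow> f ` Sat (Top S) x = Sat (Top T) (f x)"
    using f by (auto simp: heyting_spectral_map_def spectral_map_def)
  have fp: "f x \<in> pts T" if "x \<in> pts S" for x using cont that by (auto simp: continuous_map_def)
  have "f x \<in> Top T closure_of (U - V) \<longleftrightarrow> x \<in> Top S closure_of ?W" if x: "x \<in> pts S" for x
  proof
    assume "x \<in> Top S closure_of ?W"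
    then have "f x \<in> Top T closure_of (f ` ?W)"
      using continuous_map_image_closure_subset[OF cont, of ?W] by blast
    moreover have "f ` ?W \<subseteq> U - V" by auto
    ultimately show "f x \<in> Top T closure_of (U - V)" using closure_of_mono by blast
  next
    assume "f x \<in> Top T closure_of (U - V)"
    then obtain y where y: "y \<in> Sat (Top T) (f x)" "y \<in> U - V"
      using T.closure_of_doubly_spectral[OF T.doubly_spectral_Diff_CO[OF U V]] by blast
    have "y \<in> f ` Sat (Top S) x" unfolding sat[OF x] by (rule y(1))
    then obtain z where z: "z \<in> Sat (Top S) x" "f z = y" by blast
    then have zp: "z \<in> pts S" using S.mem_Sat_iff[OF x] by blast
    then have "x \<in> Top S closure_of {z}" using S.Sat_closure_of[OF x] z(1) by simp
    moreover have "z \<in> ?W" using zp z(2) y(2) by auto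
    then have "Top S closure_of {z} \<subseteq> Top S closure_of ?W" by (intro closure_of_mono) simp
    ultimately show "x \<in> Top S closure_of ?W" by blast
  qed
  then show ?thesis using fp by blast
qed

text \<open>A bijection matching compact opens in both directions is an isomorphism of
  specialization orders, and \<open>Sat\<close> is determined by that order.\<close>

lemma heyting_spectral_map_isoI:
  assumes "heyting_spectral_space X" "heyting_spectral_space Y" "spectral_map X Y f"
    and bij: "bij_betw f (topspace X) (topspace Y)"
    and CO: "\<And>U. U \<in> CO X \<Longrightarrow> f ` U \<in> CO Y"
  shows "heyting_spectral_map X Y f"
  unfolding heyting_spectral_map_def
proof (intro conjI ballI)
  interpret X: spectral X by unfold_locales (use assms in \<open>simp add: heyting_spectral_space_def\<close>)
  interpret Y: spectral Y by unfold_locales (use assms in \<open>simp add: heyting_spectral_space_def\<close>)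
  fix x assume x: "x \<in> topspace X"
  have fp: "f z \<in> topspace Y" if "z \<in> topspace X" for z using bij_betwE[OF bij] that by blast
  have iff: "f z \<in> Sat Y (f x) \<longleftrightarrow> z \<in> Sat X x" if z: "z \<in> topspace X" for z
  proof
    assume a: "f z \<in> Sat Y (f x)"
    have "z \<in> U" if U: "U \<in> CO X" "x \<in> U" for U
    proof -
      have "f z \<in> f ` U" using a CO[OF U(1)] U(2) Y.mem_Sat_iff[OF fp[OF x]] by blast
      then show ?thesis
        using inj_on_image_mem_iff[OF bij_betw_imp_inj_on[OF bij] z CO_subset[OF U(1)]] by simp
    qed
    then show "z \<in> Sat X x" using X.mem_Sat_iff[OF x] z by blast
  next
    assume a: "z \<in> Sat X x"
    have "f z \<in> V" if V: "V \<in> CO Y" "f x \<in> V" for V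
    proof -
      have "{x \<in> topspace X. f x \<in> V} \<in> CO X" using assms(3) V(1) by (simp add: spectral_map_def)
      moreover have "x \<in> {x \<in> topspace X. f x \<in> V}" using x V(2) by simp
      ultimately have "z \<in> {x \<in> topspace X. f x \<in> V}" using a X.mem_Sat_iff[OF x] by meson
      then show ?thesis by simp
    qed
    then show "f z \<in> Sat Y (f x)" using Y.mem_Sat_iff[OF fp[OF x]] fp[OF z] by blast
  qed
  show "f ` Sat X x = Sat Y (f x)"
  proof
    show "f ` Sat X x \<subseteq> Sat Y (f x)" using iff X.mem_Sat_iff[OF x] by blast
    show "Sat Y (f x) \<subseteq> f ` Sat X x"
    proof
      fix y assume y: "y \<in> Sat Y (f x)"
      then have "y \<in> topspace Y" using Y.mem_Sat_iff[OF fp[OF x]] by simp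
      then have "y \<in> f ` topspace X" using bij_betw_imp_surj_on[OF bij] by simp
      then obtain z where "z \<in> topspace X" "y = f z" by blast
      then show "y \<in> f ` Sat X x" using iff y by blast
    qed
  qed
qed (use assms in auto)

lemma heyting_spectral_map_id:
  assumes "heyting_spectral_space X"
  shows "heyting_spectral_map X X (\<lambda>x\<in>topspace X. x)"
proof (rule heyting_spectral_map_isoI[OF assms assms])
  have X: "spectral_space X" using assms by (simp add: heyting_spectral_space_def)
  have "{x \<in> topspace X. (\<lambda>x\<in>topspace X. x) x \<in> V} = V" if "V \<in> CO X" for V
    using CO_subset[OF that] by auto
  then show "spectral_map X X (\<lambda>x\<in>topspace X. x)"
    by (intro spectral_mapI X) auto
  show "bij_betw (\<lambda>x\<in>topspace X. x) (topspace X) (topspace X)"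
    by (simp add: bij_betw_def inj_on_def)
  show "(\<lambda>x\<in>topspace X. x) ` U \<in> CO X" if "U \<in> CO X" for U
  proof -
    have "(\<lambda>x\<in>topspace X. x) ` U = U" using CO_subset[OF that] by force
    then show ?thesis using that by simp
  qed
qed

lemma heyting_spectral_map_comp:
  assumes f: "heyting_spectral_map X Y f" and g: "heyting_spectral_map Y Z g"
    and sp: "spectral_map X Z (compose (topspace X) g f)"
  shows "heyting_spectral_map X Z (compose (topspace X) g f)"
  unfolding heyting_spectral_map_def
proof (intro conjI ballI)
  fix x assume x: "x \<in> topspace X"
  interpret X: spectral X by unfold_locales (use f in \<open>simp add: heyting_spectral_map_def spectral_map_def\<close>)
  have fx: "f x \<in> topspace Y"
    using f x by (auto simp: heyting_spectral_map_def spectral_map_def continuous_map_def)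
  have "Sat X x \<subseteq> topspace X" using X.mem_Sat_iff[OF x] by blast
  then have "compose (topspace X) g f ` Sat X x = g ` f ` Sat X x"
    by (force simp: compose_def image_image)
  also have "\<dots> = Sat Z (compose (topspace X) g f x)"
    using f g x fx by (simp add: heyting_spectral_map_def compose_def)
  finally show "compose (topspace X) g f ` Sat X x = Sat Z (compose (topspace X) g f x)" .
qed (use f g sp in \<open>auto simp: heyting_spectral_map_def\<close>)

section \<open>The maps alpha and beta, functoriality and naturality\<close>

context nabla_lattice
begin

lemma alpha_alg_hom:
  assumes "CO_nabla (spec_obj A) B"
  shows "alpha A \<in> alg_hom A B"
proof -
  interpret B: CO_nabla "spec_obj A" B by fact
  have c: "stone A a \<in> CO (spectrum A)" if "a \<in> carrier A" for a using that by (simp add: CO_spectrum)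
  have cB: "carrier B = CO (spectrum A)" by (simp add: B.carrier_L Top_spec_obj)
  show ?thesis
    unfolding alg_hom_def mem_Collect_eq cB B.nab_A B.arr_A
  proof (intro conjI ballI)
    show "alpha A \<in> carrier A \<rightarrow>\<^sub>E CO (spectrum A)" 
      using c by (auto simp: alpha_def stone_def)
    show "alpha A \<top> = \<top>\<^bsub>B\<^esub>" "alpha A \<bottom> = \<bottom>\<^bsub>B\<^esub>"
      by (simp_all add: alpha_eq stone_top stone_bottom B.top_CO B.bottom_CO Top_spec_obj)
    fix a assume a: "a \<in> carrier A"
    then show "alpha A (nab A a) = nabla_rel (Rel (spec_obj A)) (alpha A a)"
      by (simp add: alpha_eq nabla_rel_stone)
    fix b assume b: "b \<in> carrier A"
    show "alpha A (a \<sqinter> b) = alpha A a \<sqinter>\<^bsub>B\<^esub> alpha A b"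
      using a b by (simp add: alpha_eq stone_meet B.meet_CO Top_spec_obj c)
    show "alpha A (a \<squnion> b) = alpha A a \<squnion>\<^bsub>B\<^esub> alpha A b"
      using a b by (simp add: alpha_eq stone_join B.join_CO Top_spec_obj c)
    show "alpha A (arr A a b) = arrow_rel (spec_obj A) (alpha A a) (alpha A b)"
      using a b by (simp add: alpha_eq arrow_rel_stone)
  qed
qed

lemma bij_betw_alpha: "bij_betw (alpha A) (carrier A) (CO (Top (spec_obj A)))"
proof -
  have "bij_betw (stone A) (carrier A) (CO (spectrum A))"
    using stone_inj CO_spectrum by (simp add: bij_betw_def)
  then show ?thesis using bij_betw_cong[of "carrier A" "alpha A" "stone A"] alpha_eq
    by (simp add: Top_spec_obj)
qed

lemma iso_arrow_alpha:
  assumes B: "CO_nabla (spec_obj A) B"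
  shows "iso_arrow (alg_hom A B) (alg_hom B A) (carrier A) (carrier B) (alpha A)"
proof -
  interpret B: CO_nabla "spec_obj A" B by fact
  interpret alg_morphism A B "alpha A" by unfold_locales (rule alpha_alg_hom[OF B])
  have "bij_betw (alpha A) (carrier A) (carrier B)" using bij_betw_alpha by (simp add: B.carrier_L)
  then show ?thesis by (intro iso_arrowI hom bij_hom_inverse)
qed

lemma spec_mor_id: "spec_mor A A (\<lambda>a\<in>carrier A. a) = (\<lambda>P\<in>pts (spec_obj A). P)"
  unfolding spec_mor_def pts_spec_obj
proof (rule restrict_ext)
  fix P assume "P \<in> prime_filters A"
  then show "{a \<in> carrier A. (\<lambda>a\<in>carrier A. a) a \<in> P} = P" using pf_carrier by auto
qed

end

lemma spec_mor_comp:
  assumes "alg_morphism A B f" "alg_morphism B D g"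
  shows "spec_mor A D (compose (carrier A) g f) = compose (pts (spec_obj D)) (spec_mor A B f) (spec_mor B D g)"
proof -
  interpret f: alg_morphism A B f by fact
  interpret g: alg_morphism B D g by fact
  show ?thesis
    unfolding spec_mor_def[of A D] g.B.pts_spec_obj compose_def[of "prime_filters D"]
  proof (rule restrict_ext)
    fix Q assume Q: "Q \<in> prime_filters D"
    show "{a \<in> carrier A. compose (carrier A) g f a \<in> Q} = spec_mor A B f (spec_mor B D g Q)"
      unfolding f.spec_mor_apply[OF g.spec_mor_closed[OF Q]]
      using g.spec_mor_apply[OF Q] by (auto simp: compose_def)
  qed
qed

lemma alg_mor_comp:
  assumes f: "f \<in> spec_hom S T" and g: "g \<in> spec_hom T W"
  shows "alg_mor S W (compose (pts S) g f) = compose (CO (Top W)) (alg_mor S T f) (alg_mor T W g)"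
  unfolding alg_mor_def[of S W] compose_def[of "CO (Top W)"]
proof (rule restrict_ext)
  fix V assume V: "V \<in> CO (Top W)"
  show "{x \<in> pts S. compose (pts S) g f x \<in> V} = alg_mor S T f (alg_mor T W g V)"
    using spec_hom_CO[OF g V] spec_hom_pts[OF f] V by (auto simp: alg_mor_def compose_def)
qed

lemma alg_mor_id: "alg_mor S S (\<lambda>x\<in>pts S. x) = (\<lambda>U\<in>CO (Top S). U)"
  unfolding alg_mor_def
proof (rule restrict_ext)
  fix U assume "U \<in> CO (Top S)"
  then show "{x \<in> pts S. (\<lambda>x\<in>pts S. x) x \<in> U} = U" using CO_subset by fastforce
qed

text \<open>Both sides send an element \<open>a\<close> to the set of prime filters of B that
  contain \<open>f a\<close>.\<close>

lemma (in alg_morphism) alpha_natural: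
  "compose (carrier A) (alpha B) f =
   compose (carrier A) (alg_mor (spec_obj B) (spec_obj A) (spec_mor A B f)) (alpha A)"
  unfolding compose_def
proof (rule restrict_ext)
  fix a assume a: "a \<in> carrier A"
  then show "alpha B (f a) = alg_mor (spec_obj B) (spec_obj A) (spec_mor A B f) (alpha A a)"
    by (simp add: A.alpha_eq B.alpha_eq alg_mor_def A.Top_spec_obj B.Top_spec_obj A.CO_spectrum
        spec_mor_vimage_stone)
qed

text \<open>Both sides send \<open>x\<close> to the compact opens of T that contain
  \<open>f x\<close>.\<close>

lemma beta_natural:
  assumes "CO_nabla S A" "CO_nabla T B" and f: "f \<in> spec_hom S T"
  shows "compose (pts S) (beta T) f = compose (pts S) (spec_mor B A (alg_mor S T f)) (beta S)"
  unfolding compose_def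
proof (rule restrict_ext)
  interpret A: CO_nabla S A by fact
  interpret B: CO_nabla T B by fact
  fix x assume x: "x \<in> pts S"
  show "beta T (f x) = spec_mor B A (alg_mor S T f) (beta S x)"
    using spec_hom_pts[OF f x] spec_hom_CO[OF f] x A.beta_prime_filter[OF x]
    by (auto simp: spec_mor_def B.carrier_L beta_def alg_mor_def)
qed

context CO_nabla
begin

lemma beta_extensional: "beta S \<in> pts S \<rightarrow>\<^sub>E pts (spec_obj A)"
  unfolding pts_spec_obj using beta_prime_filter by (intro PiE_I) (simp_all add: beta_def)

lemma beta_vimage_CO: "V \<in> CO (spectrum A) \<Longrightarrow> {x \<in> pts S. beta S x \<in> V} \<in> CO (Top S)"
  using beta_vimage_stone by (auto simp: CO_spectrum carrier_L)

lemma beta_image_CO_closed: "U \<in> CO (Top S) \<Longrightarrow> beta S ` U \<in> CO (spectrum A)"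
  using beta_image_CO by (auto simp: CO_spectrum carrier_L)

lemma beta_spec_hom: "beta S \<in> spec_hom S (spec_obj A)"
  by (rule spec_hom_isoI[OF nabla_spectral_space nabla_spectral_space_spec_obj beta_extensional])
    (use bij_betw_beta beta_vimage_CO Rel_beta_iff in \<open>auto simp: Top_spec_obj\<close>)

lemma beta_inverse_spec_hom:
  "restrict (inv_into (pts S) (beta S)) (pts (spec_obj A)) \<in> spec_hom (spec_obj A) S"
  by (rule spec_hom_iso_inverse[OF nabla_spectral_space nabla_spectral_space_spec_obj])
    (use bij_betw_beta beta_image_CO_closed Rel_beta_iff in \<open>auto simp: Top_spec_obj\<close>)

lemma iso_arrow_beta:
  "iso_arrow (spec_hom S (spec_obj A)) (spec_hom (spec_obj A) S) (pts S) (pts (spec_obj A)) (beta S)"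
  by (intro iso_arrowI beta_spec_hom beta_inverse_spec_hom) (use bij_betw_beta in \<open>simp add: pts_spec_obj\<close>)

text \<open>Needed to treat the inverse of \<open>beta\<close> itself as a Heyting map: it carries
  compact opens of the spectrum to preimages under \<open>beta\<close>, which are compact
  open.\<close>

lemma beta_inverse_image:
  assumes "V \<in> CO (spectrum A)"
  shows "restrict (inv_into (pts S) (beta S)) (pts (spec_obj A)) ` V = {x \<in> pts S. beta S x \<in> V}"
    (is "?g ` _ = ?W")
proof -
  have V: "V \<subseteq> prime_filters A" using CO_subset[OF assms] by simp
  have inj: "inj_on (beta S) (pts S)" and surj: "beta S ` pts S = prime_filters A"
    using bij_betw_beta by (auto simp: bij_betw_def)
  show ?thesis
  proof
    show "?g ` V \<subseteq> ?W"
      using V surj by (auto simp: pts_spec_obj inv_into_into f_inv_into_f subset_iff)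
    show "?W \<subseteq> ?g ` V"
    proof
      fix x assume x: "x \<in> ?W"
      then have "?g (beta S x) = x"
        using inj beta_prime_filter by (simp add: pts_spec_obj)
      then show "x \<in> ?g ` V"
        using x by (intro image_eqI[of _ _ "beta S x"]) auto
    qed
  qed
qed

lemma iso_arrow_beta_heyting:
  assumes H: "heyting_spectral_space (Top S)"
  shows "iso_arrow (specH_hom S (spec_obj A)) (specH_hom (spec_obj A) S) (pts S) (pts (spec_obj A)) (beta S)"
proof (rule iso_arrowI)
  have H': "heyting_spectral_space (spectrum A)"
    by (rule heyting_spectral_spectrum[OF heyting_algebra_CO[OF H]])
  show bij: "bij_betw (beta S) (pts S) (pts (spec_obj A))" using bij_betw_beta by (simp add: pts_spec_obj)
  have "heyting_spectral_map (Top S) (spectrum A) (beta S)"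
    by (rule heyting_spectral_map_isoI[OF H H'])
      (use beta_spec_hom bij_betw_beta beta_image_CO_closed in \<open>auto simp: spec_hom_def Top_spec_obj\<close>)
  then show "beta S \<in> specH_hom S (spec_obj A)"
    using beta_spec_hom by (simp add: specH_hom_def Top_spec_obj)
  let ?g = "restrict (inv_into (pts S) (beta S)) (pts (spec_obj A))"
  have "heyting_spectral_map (spectrum A) (Top S) ?g"
  proof (rule heyting_spectral_map_isoI[OF H' H])
    show "spectral_map (spectrum A) (Top S) ?g"
      using beta_inverse_spec_hom by (simp add: spec_hom_def Top_spec_obj)
    show "bij_betw ?g (topspace (spectrum A)) (pts S)"
      using bij_betw_inv_into[OF bij_betw_beta] by (simp add: pts_spec_obj)
    show "?g ` V \<in> CO (Top S)" if "V \<in> CO (spectrum A)" for V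
      using beta_inverse_image[OF that] beta_vimage_CO[OF that] by simp
  qed
  then show "?g \<in> specH_hom (spec_obj A) S"
    using beta_inverse_spec_hom by (simp add: specH_hom_def Top_spec_obj)
qed

end

section \<open>The duality\<close>

lemma Alg_nabla_lattice: "A \<in> Alg C \<Longrightarrow> nabla_lattice A"
  and AlgH_nabla_lattice: "B \<in> AlgH C \<Longrightarrow> nabla_lattice B"
  by (auto simp: Alg_def AlgH_def nabla_algebra_def nabla_lattice_def nabla_lattice_axioms_def
      dist_lattice_def dist_lattice_axioms_def)

lemma Alg_morphism: "A \<in> Alg C \<Longrightarrow> B \<in> Alg C \<Longrightarrow> f \<in> alg_hom A B \<Longrightarrow> alg_morphism A B f"
  by (simp add: alg_morphism_def alg_morphism_axioms_def Alg_nabla_lattice)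

lemma AlgH_morphism: "A \<in> AlgH C \<Longrightarrow> B \<in> AlgH C \<Longrightarrow> f \<in> algH_hom A B \<Longrightarrow> alg_morphism A B f"
  by (simp add: alg_morphism_def alg_morphism_axioms_def AlgH_nabla_lattice algH_hom_def)

lemma Spec_nabla_spectral: "S \<in> Spec C \<Longrightarrow> nabla_spectral_space S"
  by (simp add: Spec_def)

lemma CO_nabla_alg_obj: "nabla_spectral_space S \<Longrightarrow> CO_nabla S (alg_obj S)"
  by unfold_locales (auto simp: alg_obj_def nabla_spectral_space_def)

lemma CO_nabla_algH_obj: "nabla_spectral_space S \<Longrightarrow> CO_nabla S (algH_obj S)"
  by unfold_locales (auto simp: algH_obj_def nabla_spectral_space_def)

lemma AlgH_heyting_algebra: "A \<in> AlgH C \<Longrightarrow> heyting_algebra A"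
  unfolding AlgH_def heyting_algebra_def nabla_algebra_def by blast

lemma AlgH_is_heyting_imp:
  "A \<in> AlgH C \<Longrightarrow> a \<in> carrier A \<Longrightarrow> b \<in> carrier A \<Longrightarrow> is_heyting_imp A a b (himp A a b)"
  by (simp add: AlgH_def)

lemma AlgH_himp_closed:
  "A \<in> AlgH C \<Longrightarrow> a \<in> carrier A \<Longrightarrow> b \<in> carrier A \<Longrightarrow> himp A a b \<in> carrier A"
  using AlgH_is_heyting_imp by (fastforce simp: is_heyting_imp_def)

lemma spec_obj_Spec:
  assumes A: "A \<in> Alg C"
  shows "spec_obj A \<in> Spec C"
proof -
  interpret nabla_lattice A by (rule Alg_nabla_lattice[OF A])
  show ?thesis
    using A nabla_spectral_space_spec_obj space_satisfies_spec_obj by (auto simp: Spec_def Alg_def)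
qed

lemma spec_obj_SpecH:
  assumes A: "A \<in> AlgH C"
  shows "spec_obj A \<in> SpecH C"
proof -
  interpret nabla_lattice A by (rule AlgH_nabla_lattice[OF A])
  have "\<forall>c\<in>C. space_satisfies (spec_obj A) c"
    using A space_satisfies_spec_obj by (auto simp: AlgH_def)
  then show ?thesis
    using nabla_spectral_space_spec_obj heyting_spectral_spectrum[OF AlgH_heyting_algebra[OF A]]
    by (simp add: SpecH_def Spec_def Top_spec_obj)
qed

lemma alg_obj_Alg:
  assumes "S \<in> Spec C"
  shows "alg_obj S \<in> Alg C"
proof -
  interpret CO_nabla S "alg_obj S" by (rule CO_nabla_alg_obj[OF Spec_nabla_spectral[OF assms]])
  show ?thesis using assms nabla_algebra_CO distributive_CO alg_satisfies_CO by (auto simp: Alg_def Spec_def)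
qed

text \<open>Replaces the definite description behind \<open>heyting_imp\<close> by an explicit set;
  the description is meaningful because implications are unique.\<close>

lemma himp_algH_obj:
  assumes S: "S \<in> SpecH C" and UV: "U \<in> CO (Top S)" "V \<in> CO (Top S)"
  shows "himp (algH_obj S) U V = pts S - Top S closure_of (U - V)"
proof -
  interpret CO_nabla S "alg_obj S"
    using S by (intro CO_nabla_alg_obj) (simp add: SpecH_def Spec_def)
  have "heyting_imp (alg_obj S) U V = pts S - Top S closure_of (U - V)"
    unfolding heyting_imp_def
    using is_heyting_imp_CO[OF _ UV] is_heyting_imp_unique[OF partial_order_CO] S
    by (intro the_equality) (auto simp: SpecH_def)
  then show ?thesis by (simp add: algH_obj_def)
qed

lemma algH_obj_AlgH:
  assumes S: "S \<in> SpecH C"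
  shows "algH_obj S \<in> AlgH C"
proof -
  have S': "nabla_spectral_space S" "heyting_spectral_space (Top S)" "\<forall>c\<in>C. space_satisfies S c"
    using S by (auto simp: SpecH_def Spec_def)
  interpret CO_nabla S "algH_obj S" by (rule CO_nabla_algH_obj[OF S'(1)])
  have "is_heyting_imp (algH_obj S) U V (himp (algH_obj S) U V)"
    if "U \<in> carrier (algH_obj S)" "V \<in> carrier (algH_obj S)" for U V
    using is_heyting_imp_CO[OF S'(2)] himp_algH_obj[OF S] that by (simp add: carrier_L)
  then show ?thesis
    using S' nabla_algebra_CO distributive_CO alg_satisfies_CO by (auto simp: AlgH_def)
qed

lemma spec_mor_specH_hom:
  assumes A: "A \<in> AlgH C" and B: "B \<in> AlgH C" and f: "f \<in> algH_hom A B"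
  shows "spec_mor A B f \<in> specH_hom (spec_obj B) (spec_obj A)"
proof -
  interpret alg_morphism A B f by (rule AlgH_morphism[OF A B f])
  have "heyting_spectral_map (spectrum B) (spectrum A) (spec_mor A B f)"
  proof (rule heyting_spectral_map_spec_mor[OF AlgH_heyting_algebra[OF A] AlgH_heyting_algebra[OF B]])
    fix a b assume ab: "a \<in> carrier A" "b \<in> carrier A"
    have "f (himp A a b) = himp B (f a) (f b)" using f ab by (simp add: algH_hom_def)
    then show "\<exists>c. is_heyting_imp A a b c \<and> is_heyting_imp B (f a) (f b) (f c)"
      using AlgH_is_heyting_imp[OF A ab] AlgH_is_heyting_imp[OF B, of "f a" "f b"] ab
      by (intro exI[of _ "himp A a b"]) simp
  qed
  then show ?thesis using spec_mor_spec_hom by (simp add: specH_hom_def A.Top_spec_obj B.Top_spec_obj)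
qed

lemma alg_mor_algH_hom:
  assumes S: "S \<in> SpecH C" and T: "T \<in> SpecH C" and f: "f \<in> specH_hom S T"
  shows "alg_mor S T f \<in> algH_hom (algH_obj T) (algH_obj S)"
proof -
  have f': "f \<in> spec_hom S T" "heyting_spectral_map (Top S) (Top T) f" using f by (auto simp: specH_hom_def)
  have S': "nabla_spectral_space S" and T': "nabla_spectral_space T" using S T by (auto simp: SpecH_def Spec_def)
  interpret A: CO_nabla S "algH_obj S" by (rule CO_nabla_algH_obj[OF S'])
  interpret B: CO_nabla T "algH_obj T" by (rule CO_nabla_algH_obj[OF T'])
  have hom: "alg_mor S T f \<in> alg_hom (algH_obj T) (algH_obj S)"
    by (rule alg_mor_alg_hom[OF A.CO_nabla_axioms B.CO_nabla_axioms f'(1)])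
  note fCO = spec_hom_CO[OF f'(1)]
  have "alg_mor S T f (himp (algH_obj T) U V) = himp (algH_obj S) (alg_mor S T f U) (alg_mor S T f V)"
    if UV: "U \<in> CO (Top T)" "V \<in> CO (Top T)" for U V
  proof -
    \<comment> \<open>\<open>alg_mor\<close> is restricted to compact opens, so it can be evaluated
      at the implication only after this membership is known.\<close>
    have "himp (algH_obj T) U V \<in> CO (Top T)"
      using AlgH_himp_closed[OF algH_obj_AlgH[OF T], of U V] UV by (simp add: B.carrier_L)
    then have "pts T - Top T closure_of (U - V) \<in> CO (Top T)" by (simp add: himp_algH_obj[OF T UV])
    then show ?thesis
      unfolding himp_algH_obj[OF T UV] using UV fCO alg_mor_closure_of_Diff[OF f'(2) UV]
      by (simp add: alg_mor_def himp_algH_obj[OF S])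
  qed
  then show ?thesis using hom by (simp add: algH_hom_def B.carrier_L)
qed

text \<open>A bijective homomorphism is an order isomorphism, and implications are unique in the
  order. So \<open>alpha\<close> and its inverse preserve \<open>himp\<close> without any
  computation in the spectrum.\<close>

lemma bij_alg_hom_algH_hom:
  assumes A: "A \<in> AlgH C" and B: "B \<in> AlgH C" and f: "f \<in> alg_hom A B"
    and bij: "bij_betw f (carrier A) (carrier B)"
  shows "f \<in> algH_hom A B"
proof -
  interpret alg_morphism A B f
    using f by (simp add: alg_morphism_def alg_morphism_axioms_def AlgH_nabla_lattice[OF A] AlgH_nabla_lattice[OF B])
  have "f (himp A a b) = himp B (f a) (f b)" if ab: "a \<in> carrier A" "b \<in> carrier A" for a b
    using is_heyting_imp_unique[OF B.partial_order_axioms bij_hom_is_heyting_imp[OF bij ab]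
        AlgH_is_heyting_imp[OF B]] AlgH_is_heyting_imp[OF A ab] ab by simp
  then show ?thesis using f by (simp add: algH_hom_def)
qed

lemma iso_arrow_alpha_heyting:
  assumes A: "A \<in> AlgH C"
  shows "iso_arrow (algH_hom A (algH_obj (spec_obj A))) (algH_hom (algH_obj (spec_obj A)) A)
    (carrier A) (carrier (algH_obj (spec_obj A))) (alpha A)"
proof -
  let ?B = "algH_obj (spec_obj A)"
  have B: "?B \<in> AlgH C" by (rule algH_obj_AlgH[OF spec_obj_SpecH[OF A]])
  interpret A: nabla_lattice A by (rule AlgH_nabla_lattice[OF A])
  interpret B: CO_nabla "spec_obj A" ?B by (rule CO_nabla_algH_obj[OF A.nabla_spectral_space_spec_obj])
  interpret alg_morphism A ?B "alpha A"
    by unfold_locales (rule A.alpha_alg_hom[OF B.CO_nabla_axioms])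
  have bij: "bij_betw (alpha A) (carrier A) (carrier ?B)" using A.bij_betw_alpha by (simp add: B.carrier_L)
  have bij': "bij_betw (restrict (inv_into (carrier A) (alpha A)) (carrier ?B)) (carrier ?B) (carrier A)"
    using bij_betw_inv_into[OF bij] by simp
  show ?thesis
    by (intro iso_arrowI bij bij_alg_hom_algH_hom[OF A B hom bij]
        bij_alg_hom_algH_hom[OF B A bij_hom_inverse[OF bij] bij'])
qed

lemma algH_hom_id:
  assumes A: "A \<in> AlgH C"
  shows "(\<lambda>a\<in>carrier A. a) \<in> algH_hom A A"
  using nabla_lattice.alg_hom_id[OF AlgH_nabla_lattice[OF A]] AlgH_himp_closed[OF A]
  by (simp add: algH_hom_def)

lemma algH_hom_comp:
  assumes A: "A \<in> AlgH C" and B: "B \<in> AlgH C" and f: "f \<in> algH_hom A B" and g: "g \<in> algH_hom B D"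
  shows "compose (carrier A) g f \<in> algH_hom A D"
proof -
  have "compose (carrier A) g f \<in> alg_hom A D"
    by (rule alg_hom_comp[OF AlgH_nabla_lattice[OF A]]) (use f g in \<open>auto simp: algH_hom_def\<close>)
  moreover have "f a \<in> carrier B" if "a \<in> carrier A" for a
    using f that by (auto simp: algH_hom_def alg_hom_def)
  ultimately show ?thesis
    using f g AlgH_himp_closed[OF A] by (simp add: algH_hom_def compose_def)
qed

lemma specH_hom_id: "S \<in> SpecH C \<Longrightarrow> (\<lambda>x\<in>pts S. x) \<in> specH_hom S S"
  by (auto simp: SpecH_def Spec_def specH_hom_def intro: spec_hom_id heyting_spectral_map_id)

lemma specH_hom_comp:
  assumes "S \<in> SpecH C" "T \<in> SpecH C" "W \<in> SpecH C" and f: "f \<in> specH_hom S T" and g: "g \<in> specH_hom T W"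
  shows "compose (pts S) g f \<in> specH_hom S W"
proof -
  have sp: "compose (pts S) g f \<in> spec_hom S W"
    by (rule spec_hom_comp[of S T W]) (use assms in \<open>auto simp: SpecH_def Spec_def specH_hom_def\<close>)
  then have "heyting_spectral_map (Top S) (Top W) (compose (pts S) g f)"
    using f g by (intro heyting_spectral_map_comp[of _ "Top T"]) (auto simp: specH_hom_def spec_hom_def)
  then show ?thesis using sp by (simp add: specH_hom_def)
qed

theorem theorem4p11:
  fixes C :: "nabla_cond set"
  shows "(
      \<comment> \<open>the algebras form a category\<close>
      (\<forall>A\<in>(Alg C :: 'a nabla_alg set). (\<lambda>a\<in>carrier A. a) \<in> alg_hom A A) \<and>
      (\<forall>A\<in>(Alg C :: 'a nabla_alg set). \<forall>B\<in>(Alg C :: 'b nabla_alg set). \<forall>D\<in>(Alg C :: 'c nabla_alg set).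
        \<forall>f\<in>alg_hom A B. \<forall>g\<in>alg_hom B D. compose (carrier A) g f \<in> alg_hom A D) \<and>
      \<comment> \<open>the spaces form a category\<close>
      (\<forall>S\<in>(Spec C :: 'x nabla_space set). (\<lambda>x\<in>pts S. x) \<in> spec_hom S S) \<and>
      (\<forall>S\<in>(Spec C :: 'x nabla_space set). \<forall>T\<in>(Spec C :: 'y nabla_space set). \<forall>W\<in>(Spec C :: 'z nabla_space set).
        \<forall>f\<in>spec_hom S T. \<forall>g\<in>spec_hom T W. compose (pts S) g f \<in> spec_hom S W) \<and>
      \<comment> \<open>contravariant functor from algebras to spaces\<close>
      (\<forall>A\<in>(Alg C :: 'a nabla_alg set). spec_obj A \<in> Spec C) \<and>
      (\<forall>A\<in>(Alg C :: 'a nabla_alg set). \<forall>B\<in>(Alg C :: 'b nabla_alg set).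
        \<forall>f\<in>alg_hom A B. spec_mor A B f \<in> spec_hom (spec_obj B) (spec_obj A)) \<and>
      (\<forall>A\<in>(Alg C :: 'a nabla_alg set). spec_mor A A (\<lambda>a\<in>carrier A. a) = (\<lambda>P\<in>pts (spec_obj A). P)) \<and>
      (\<forall>A\<in>(Alg C :: 'a nabla_alg set). \<forall>B\<in>(Alg C :: 'b nabla_alg set). \<forall>D\<in>(Alg C :: 'c nabla_alg set).
        \<forall>f\<in>alg_hom A B. \<forall>g\<in>alg_hom B D.
          spec_mor A D (compose (carrier A) g f) =
          compose (pts (spec_obj D)) (spec_mor A B f) (spec_mor B D g)) \<and>
      \<comment> \<open>contravariant functor from spaces to algebras\<close>
      (\<forall>S\<in>(Spec C :: 'x nabla_space set). alg_obj S \<in> Alg C) \<and>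
      (\<forall>S\<in>(Spec C :: 'x nabla_space set). \<forall>T\<in>(Spec C :: 'y nabla_space set).
        \<forall>f\<in>spec_hom S T. alg_mor S T f \<in> alg_hom (alg_obj T) (alg_obj S)) \<and>
      (\<forall>S\<in>(Spec C :: 'x nabla_space set). alg_mor S S (\<lambda>x\<in>pts S. x) = (\<lambda>U\<in>carrier (alg_obj S). U)) \<and>
      (\<forall>S\<in>(Spec C :: 'x nabla_space set). \<forall>T\<in>(Spec C :: 'y nabla_space set). \<forall>W\<in>(Spec C :: 'z nabla_space set).
        \<forall>f\<in>spec_hom S T. \<forall>g\<in>spec_hom T W.
          alg_mor S W (compose (pts S) g f) =
          compose (carrier (alg_obj W)) (alg_mor S T f) (alg_mor T W g)) \<and>
      \<comment> \<open>alpha is a natural isomorphism\<close>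
      (\<forall>A\<in>(Alg C :: 'a nabla_alg set). iso_arrow (alg_hom A (alg_obj (spec_obj A))) (alg_hom (alg_obj (spec_obj A)) A)
        (carrier A) (carrier (alg_obj (spec_obj A))) (alpha A)) \<and>
      (\<forall>A\<in>(Alg C :: 'a nabla_alg set). \<forall>B\<in>(Alg C :: 'b nabla_alg set).
        \<forall>f\<in>alg_hom A B.
          compose (carrier A) (alpha B) f =
          compose (carrier A) (alg_mor (spec_obj B) (spec_obj A) (spec_mor A B f)) (alpha A)) \<and>
      \<comment> \<open>beta is a natural isomorphism\<close>
      (\<forall>S\<in>(Spec C :: 'x nabla_space set). iso_arrow (spec_hom S (spec_obj (alg_obj S))) (spec_hom (spec_obj (alg_obj S)) S)
        (pts S) (pts (spec_obj (alg_obj S))) (beta S)) \<and>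
      (\<forall>S\<in>(Spec C :: 'x nabla_space set). \<forall>T\<in>(Spec C :: 'y nabla_space set).
        \<forall>f\<in>spec_hom S T.
          compose (pts S) (beta T) f =
          compose (pts S) (spec_mor (alg_obj T) (alg_obj S) (alg_mor S T f)) (beta S)))
    \<and> (
      \<comment> \<open>the algebras form a category\<close>
      (\<forall>A\<in>(AlgH C :: 'a heyting_nabla_alg set). (\<lambda>a\<in>carrier A. a) \<in> algH_hom A A) \<and>
      (\<forall>A\<in>(AlgH C :: 'a heyting_nabla_alg set). \<forall>B\<in>(AlgH C :: 'b heyting_nabla_alg set). \<forall>D\<in>(AlgH C :: 'c heyting_nabla_alg set).
        \<forall>f\<in>algH_hom A B. \<forall>g\<in>algH_hom B D. compose (carrier A) g f \<in> algH_hom A D) \<and>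
      \<comment> \<open>the spaces form a category\<close>
      (\<forall>S\<in>(SpecH C :: 'x nabla_space set). (\<lambda>x\<in>pts S. x) \<in> specH_hom S S) \<and>
      (\<forall>S\<in>(SpecH C :: 'x nabla_space set). \<forall>T\<in>(SpecH C :: 'y nabla_space set). \<forall>W\<in>(SpecH C :: 'z nabla_space set).
        \<forall>f\<in>specH_hom S T. \<forall>g\<in>specH_hom T W. compose (pts S) g f \<in> specH_hom S W) \<and>
      \<comment> \<open>contravariant functor from algebras to spaces\<close>
      (\<forall>A\<in>(AlgH C :: 'a heyting_nabla_alg set). spec_obj A \<in> SpecH C) \<and>
      (\<forall>A\<in>(AlgH C :: 'a heyting_nabla_alg set). \<forall>B\<in>(AlgH C :: 'b heyting_nabla_alg set).
        \<forall>f\<in>algH_hom A B. spec_mor A B f \<in> specH_hom (spec_obj B) (spec_obj A)) \<and>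
      (\<forall>A\<in>(AlgH C :: 'a heyting_nabla_alg set). spec_mor A A (\<lambda>a\<in>carrier A. a) = (\<lambda>P\<in>pts (spec_obj A). P)) \<and>
      (\<forall>A\<in>(AlgH C :: 'a heyting_nabla_alg set). \<forall>B\<in>(AlgH C :: 'b heyting_nabla_alg set). \<forall>D\<in>(AlgH C :: 'c heyting_nabla_alg set).
        \<forall>f\<in>algH_hom A B. \<forall>g\<in>algH_hom B D.
          spec_mor A D (compose (carrier A) g f) =
          compose (pts (spec_obj D)) (spec_mor A B f) (spec_mor B D g)) \<and>
      \<comment> \<open>contravariant functor from spaces to algebras\<close>
      (\<forall>S\<in>(SpecH C :: 'x nabla_space set). algH_obj S \<in> AlgH C) \<and>
      (\<forall>S\<in>(SpecH C :: 'x nabla_space set). \<forall>T\<in>(SpecH C :: 'y nabla_space set).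
        \<forall>f\<in>specH_hom S T. alg_mor S T f \<in> algH_hom (algH_obj T) (algH_obj S)) \<and>
      (\<forall>S\<in>(SpecH C :: 'x nabla_space set). alg_mor S S (\<lambda>x\<in>pts S. x) = (\<lambda>U\<in>carrier (algH_obj S). U)) \<and>
      (\<forall>S\<in>(SpecH C :: 'x nabla_space set). \<forall>T\<in>(SpecH C :: 'y nabla_space set). \<forall>W\<in>(SpecH C :: 'z nabla_space set).
        \<forall>f\<in>specH_hom S T. \<forall>g\<in>specH_hom T W.
          alg_mor S W (compose (pts S) g f) =
          compose (carrier (algH_obj W)) (alg_mor S T f) (alg_mor T W g)) \<and>
      \<comment> \<open>alpha is a natural isomorphism\<close>
      (\<forall>A\<in>(AlgH C :: 'a heyting_nabla_alg set). iso_arrow (algH_hom A (algH_obj (spec_obj A))) (algH_hom (algH_obj (spec_obj A)) A)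
        (carrier A) (carrier (algH_obj (spec_obj A))) (alpha A)) \<and>
      (\<forall>A\<in>(AlgH C :: 'a heyting_nabla_alg set). \<forall>B\<in>(AlgH C :: 'b heyting_nabla_alg set).
        \<forall>f\<in>algH_hom A B.
          compose (carrier A) (alpha B) f =
          compose (carrier A) (alg_mor (spec_obj B) (spec_obj A) (spec_mor A B f)) (alpha A)) \<and>
      \<comment> \<open>beta is a natural isomorphism\<close>
      (\<forall>S\<in>(SpecH C :: 'x nabla_space set). iso_arrow (specH_hom S (spec_obj (algH_obj S))) (specH_hom (spec_obj (algH_obj S)) S)
        (pts S) (pts (spec_obj (algH_obj S))) (beta S)) \<and>
      (\<forall>S\<in>(SpecH C :: 'x nabla_space set). \<forall>T\<in>(SpecH C :: 'y nabla_space set).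
        \<forall>f\<in>specH_hom S T.
          compose (pts S) (beta T) f =
          compose (pts S) (spec_mor (algH_obj T) (algH_obj S) (alg_mor S T f)) (beta S)))"
proof (rule conjI; intro conjI ballI)
  fix A :: "'a nabla_alg" assume A: "A \<in> Alg C"
  interpret A: nabla_lattice A by (rule Alg_nabla_lattice[OF A])
  show "(\<lambda>a\<in>carrier A. a) \<in> alg_hom A A" by (rule A.alg_hom_id)
  show "spec_obj A \<in> Spec C" by (rule spec_obj_Spec[OF A])
  show "spec_mor A A (\<lambda>a\<in>carrier A. a) = (\<lambda>P\<in>pts (spec_obj A). P)" by (rule A.spec_mor_id)
  show "iso_arrow (alg_hom A (alg_obj (spec_obj A))) (alg_hom (alg_obj (spec_obj A)) A)
      (carrier A) (carrier (alg_obj (spec_obj A))) (alpha A)"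
    by (rule A.iso_arrow_alpha[OF CO_nabla_alg_obj[OF A.nabla_spectral_space_spec_obj]])
  fix B :: "'b nabla_alg" and f assume B: "B \<in> Alg C" and f: "f \<in> alg_hom A B"
  interpret f: alg_morphism A B f by (rule Alg_morphism[OF A B f])
  show "spec_mor A B f \<in> spec_hom (spec_obj B) (spec_obj A)" by (rule f.spec_mor_spec_hom)
  show "compose (carrier A) (alpha B) f =
      compose (carrier A) (alg_mor (spec_obj B) (spec_obj A) (spec_mor A B f)) (alpha A)"
    by (rule f.alpha_natural)
  fix D :: "'c nabla_alg" and g assume D: "D \<in> Alg C" and g: "g \<in> alg_hom B D"
  show "compose (carrier A) g f \<in> alg_hom A D" by (rule alg_hom_comp[OF A.nabla_lattice_axioms f g])
  show "spec_mor A D (compose (carrier A) g f) =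
      compose (pts (spec_obj D)) (spec_mor A B f) (spec_mor B D g)"
    by (rule spec_mor_comp[OF f.alg_morphism_axioms Alg_morphism[OF B D g]])
next
  fix S :: "'x nabla_space" assume S: "S \<in> Spec C"
  note S' = Spec_nabla_spectral[OF S]
  show "(\<lambda>x\<in>pts S. x) \<in> spec_hom S S" by (rule spec_hom_id[OF S'])
  show "alg_obj S \<in> Alg C" by (rule alg_obj_Alg[OF S])
  show "alg_mor S S (\<lambda>x\<in>pts S. x) = (\<lambda>U\<in>carrier (alg_obj S). U)"
    by (simp add: alg_mor_id alg_obj_def)
  show "iso_arrow (spec_hom S (spec_obj (alg_obj S))) (spec_hom (spec_obj (alg_obj S)) S)
      (pts S) (pts (spec_obj (alg_obj S))) (beta S)"
    by (rule CO_nabla.iso_arrow_beta[OF CO_nabla_alg_obj[OF S']])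
  fix T :: "'y nabla_space" and f assume T: "T \<in> Spec C" and f: "f \<in> spec_hom S T"
  note T' = Spec_nabla_spectral[OF T]
  show "alg_mor S T f \<in> alg_hom (alg_obj T) (alg_obj S)"
    by (rule alg_mor_alg_hom[OF CO_nabla_alg_obj[OF S'] CO_nabla_alg_obj[OF T'] f])
  show "compose (pts S) (beta T) f =
      compose (pts S) (spec_mor (alg_obj T) (alg_obj S) (alg_mor S T f)) (beta S)"
    by (rule beta_natural[OF CO_nabla_alg_obj[OF S'] CO_nabla_alg_obj[OF T'] f])
  fix W :: "'z nabla_space" and g assume W: "W \<in> Spec C" and g: "g \<in> spec_hom T W"
  show "compose (pts S) g f \<in> spec_hom S W"
    by (rule spec_hom_comp[OF S' T' Spec_nabla_spectral[OF W] f g])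
  show "alg_mor S W (compose (pts S) g f) =
      compose (carrier (alg_obj W)) (alg_mor S T f) (alg_mor T W g)"
    using alg_mor_comp[OF f g] by (simp add: alg_obj_def)
next
  fix A :: "'a heyting_nabla_alg" assume A: "A \<in> AlgH C"
  interpret A: nabla_lattice A by (rule AlgH_nabla_lattice[OF A])
  show "(\<lambda>a\<in>carrier A. a) \<in> algH_hom A A" by (rule algH_hom_id[OF A])
  show "spec_obj A \<in> SpecH C" by (rule spec_obj_SpecH[OF A])
  show "spec_mor A A (\<lambda>a\<in>carrier A. a) = (\<lambda>P\<in>pts (spec_obj A). P)" by (rule A.spec_mor_id)
  show "iso_arrow (algH_hom A (algH_obj (spec_obj A))) (algH_hom (algH_obj (spec_obj A)) A)
      (carrier A) (carrier (algH_obj (spec_obj A))) (alpha A)"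
    by (rule iso_arrow_alpha_heyting[OF A])
  fix B :: "'b heyting_nabla_alg" and f assume B: "B \<in> AlgH C" and f: "f \<in> algH_hom A B"
  interpret f: alg_morphism A B f by (rule AlgH_morphism[OF A B f])
  show "spec_mor A B f \<in> specH_hom (spec_obj B) (spec_obj A)" by (rule spec_mor_specH_hom[OF A B f])
  show "compose (carrier A) (alpha B) f =
      compose (carrier A) (alg_mor (spec_obj B) (spec_obj A) (spec_mor A B f)) (alpha A)"
    by (rule f.alpha_natural)
  fix D :: "'c heyting_nabla_alg" and g assume D: "D \<in> AlgH C" and g: "g \<in> algH_hom B D"
  show "compose (carrier A) g f \<in> algH_hom A D" by (rule algH_hom_comp[OF A B f g])
  show "spec_mor A D (compose (carrier A) g f) =
      compose (pts (spec_obj D)) (spec_mor A B f) (spec_mor B D g)"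
    by (rule spec_mor_comp[OF f.alg_morphism_axioms AlgH_morphism[OF B D g]])
next
  fix S :: "'x nabla_space" assume S: "S \<in> SpecH C"
  then have S': "nabla_spectral_space S" "heyting_spectral_space (Top S)"
    by (auto simp: SpecH_def Spec_def)
  show "(\<lambda>x\<in>pts S. x) \<in> specH_hom S S" by (rule specH_hom_id[OF S])
  show "algH_obj S \<in> AlgH C" by (rule algH_obj_AlgH[OF S])
  show "alg_mor S S (\<lambda>x\<in>pts S. x) = (\<lambda>U\<in>carrier (algH_obj S). U)"
    by (simp add: alg_mor_id algH_obj_def)
  show "iso_arrow (specH_hom S (spec_obj (algH_obj S))) (specH_hom (spec_obj (algH_obj S)) S)
      (pts S) (pts (spec_obj (algH_obj S))) (beta S)"
    by (rule CO_nabla.iso_arrow_beta_heyting[OF CO_nabla_algH_obj[OF S'(1)] S'(2)])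
  fix T :: "'y nabla_space" and f assume T: "T \<in> SpecH C" and f: "f \<in> specH_hom S T"
  then have T': "nabla_spectral_space T" and f': "f \<in> spec_hom S T"
    by (auto simp: SpecH_def Spec_def specH_hom_def)
  show "alg_mor S T f \<in> algH_hom (algH_obj T) (algH_obj S)" by (rule alg_mor_algH_hom[OF S T f])
  show "compose (pts S) (beta T) f =
      compose (pts S) (spec_mor (algH_obj T) (algH_obj S) (alg_mor S T f)) (beta S)"
    by (rule beta_natural[OF CO_nabla_algH_obj[OF S'(1)] CO_nabla_algH_obj[OF T'] f'])
  fix W :: "'z nabla_space" and g assume W: "W \<in> SpecH C" and g: "g \<in> specH_hom T W"
  then have g': "g \<in> spec_hom T W" by (simp add: specH_hom_def)
  show "compose (pts S) g f \<in> specH_hom S W" by (rule specH_hom_comp[OF S T W f g])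
  show "alg_mor S W (compose (pts S) g f) =
      compose (carrier (algH_obj W)) (alg_mor S T f) (alg_mor T W g)"
    using alg_mor_comp[OF f' g'] by (simp add: algH_obj_def)
qed

end
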